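(* Let $\psi$ be any fixed one of the iterated logarithms $\ln_3 T,\ \ln_4 T,\ \ln_5 T,\dots$, and let $\epsilon>0$ be fixed and sufficiently small (i.e. there is $\epsilon_0>0$ such that the following holds for every fixed $\epsilon$ with $0<\epsilon\le\epsilon_0$). For $T$ sufficiently large put $$\bar H=\sqrt{T}\,\psi(T),\qquad L=[(\psi(T))^{\epsilon}],$$ $$h_\nu=t_\nu+\frac{\pi}{\ln\frac{T}{2\pi}},\qquad \bar\tau_p=\frac{(2p-1)\pi}{\ln\frac{T}{2\pi}}\ (p=1,\dots,L),\qquad \overset{*}{Z}(t)=\frac{Z(t)}{\sqrt{\ln\frac{T}{2\pi}}}.$$ Then the formula $$\overset{*}{Z}(h_\nu)=\frac{4}{\pi}\sum_{p=1}^{L}\frac{(-1)^{p+1}}{2p-1}\,\frac{\overset{*}{Z}(h_\nu+\bar\tau_p)+\overset{*}{Z}(h_\nu-\bar\tau_p)}{2}+\mathcal{O}\left\{[\psi(T)]^{-\epsilon/4}\right\}$$ holds for almost all $h_\nu\in[T,T+\bar H]$. Precisely: there is a constant $C>0$, independent of $T$ and $\nu$, such that the number of indices $\nu$ with $h_\nu\in[T,T+\bar H]$ and $$\left|\overset{*}{Z}(h_\nu)-\frac{4}{\pi}\sum_{p=1}^{L}\frac{(-1)^{p+1}}{2p-1}\,\frac{\overset{*}{Z}(h_\nu+\bar\tau_p)+\overset{*}{Z}(h_\nu-\bar\tau_p)}{2}\right|\le C\,[\psi(T)]^{-\epsilon/4}$$ is asymptotically $$\sim\frac{1}{2\pi}\,\bar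 H\ln\frac{T}{2\pi}\qquad\text{as } T\to\infty .$$
   Context: $\zeta$ is the Riemann zeta-function. The Riemann $Z$-function and the Riemann–Siegel theta function are, for real $t$, $$Z(t)=e^{i\vartheta(t)}\zeta\left(\tfrac12+it\right),\qquad \vartheta(t)=-\frac t2\ln\pi+\operatorname{Im}\ln\Gamma\left(\frac14+i\frac t2\right),$$ where $\ln\Gamma$ is the branch continuous along $t\ge 0$ and real at $t=0$. The sequence $\{t_\nu\}_{\nu\ge1}$ is defined by $t_\nu>0$ and $\vartheta(t_\nu)=\pi\nu$, $\nu=1,2,\dots$. $[x]$ denotes the integer part of $x$. Iterated logarithms: $\ln_3T=\ln\ln\ln T$ and $\ln_{k+1}T=\ln(\ln_kT)$. The quantities $h_\nu$, $\bar\tau_p$, $\overset{*}{Z}$, $L$ and $\bar H$ all depend on $T$. "Almost all" refers to the fact that the total number of $h_\nu$ in $[T,T+\bar H]$ is itself $\sim\frac{1}{2\pi}\bar H\ln\frac{T}{2\pi}$ as $T\to\infty$. *)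

theory Defs
  imports "HOL-Complex_Analysis.Complex_Analysis" "HOL-Library.Landau_Symbols"
begin

(* The value at the pole s = 1 is left unspecified; elsewhere the function is determined
   by the identity theorem, - {1} being connected. *)
definition zeta :: "complex \<Rightarrow> complex" where
  "zeta = (SOME f. f holomorphic_on (- {1}) \<and>
             (\<forall>s. Re s > 1 \<longrightarrow> (\<lambda>n. 1 / of_nat (Suc n) powr s) sums f s))"

(* The library's complex ln_Gamma is holomorphic off the nonpositive reals and real on the
   positive reals, hence it is the branch required along 1/4 + i t/2 (it is not Ln o Gamma). *)
definition theta :: "real \<Rightarrow> real" where
  "theta t = - (t / 2) * ln pi + Im (ln_Gamma (Complex (1 / 4) (t / 2)))"

(* Z is real-valued, but this is a consequence of the functional equation; the defining
   formula is kept with complex values. *)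
definition riemann_Z :: "real \<Rightarrow> complex" where
  "riemann_Z t = exp (\<i> * of_real (theta t)) * zeta (1 / 2 + \<i> * of_real t)"

definition t_seq :: "nat \<Rightarrow> real" where
  "t_seq \<nu> = (THE t. t > 0 \<and> theta t = pi * real \<nu>)"

definition iter_ln :: "nat \<Rightarrow> real \<Rightarrow> real" where
  "iter_ln k T = (ln ^^ k) T"

definition H_bar :: "(real \<Rightarrow> real) \<Rightarrow> real \<Rightarrow> real" where
  "H_bar \<psi> T = sqrt T * \<psi> T"

definition L_num :: "(real \<Rightarrow> real) \<Rightarrow> real \<Rightarrow> real \<Rightarrow> nat" where
  "L_num \<psi> \<epsilon> T = nat \<lfloor>\<psi> T powr \<epsilon>\<rfloor>"

definition h_seq :: "real \<Rightarrow> nat \<Rightarrow> real" where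
  "h_seq T \<nu> = t_seq \<nu> + pi / ln (T / (2 * pi))"

definition tau_bar :: "real \<Rightarrow> nat \<Rightarrow> real" where
  "tau_bar T p = (2 * real p - 1) * pi / ln (T / (2 * pi))"

definition Z_star :: "real \<Rightarrow> real \<Rightarrow> complex" where
  "Z_star T t = riemann_Z t / of_real (sqrt (ln (T / (2 * pi))))"

definition interp_sum :: "(real \<Rightarrow> real) \<Rightarrow> real \<Rightarrow> real \<Rightarrow> nat \<Rightarrow> complex" where
  "interp_sum \<psi> \<epsilon> T \<nu> =
     of_real (4 / pi) *
       (\<Sum>p = 1..L_num \<psi> \<epsilon> T. (-1) ^ (p + 1) / (2 * of_nat p - 1) *
          ((Z_star T (h_seq T \<nu> + tau_bar T p) + Z_star T (h_seq T \<nu> - tau_bar T p)) / 2))"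

end

theory Submission
  imports Defs "HOL-Real_Asymp.Real_Asymp"
begin

text \<open>
  Put \<open>P = sqrt (T / 2 pi)\<close> and \<open>l = ln P\<close>.  On the window the approximate functional equation gives
  \<open>Z t = 2 Re (\<Sum>n\<le>P. n powr (-1/2) exp (\<i> (theta t - t ln n))) + O(1)\<close>, and \<open>theta\<close> is linear with slope
  \<open>l\<close> up to a negligible error.  Averaging the \<open>n\<close>-th term over \<open>h + tau\<close> and \<open>h - tau\<close>, \<open>tau = (2p-1) pi / 2l\<close>,
  multiplies it by \<open>(-1) ^ (p+1) sin ((2p-1) v)\<close> with \<open>v = (pi/2) ln n / l\<close>; so the interpolation sum
  multiplies it by a partial sum of the Fourier series of a square wave, which is 1 up to
  \<open>O(min 1 (1 / (L v)))\<close>.  The defect is therefore a Dirichlet polynomial of length \<open>P\<close> with small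
  coefficients.  Its mean square over the window is a power of \<open>1/L\<close> smaller than that of \<open>Z\<close>, because
  \<open>H = sqrt T psi\<close> exceeds the length \<open>P\<close> by the unbounded factor \<open>psi\<close>; a Sobolev inequality passes from
  the integral to the separated points \<open>h_seq\<close>, and Chebyshev's inequality bounds the exceptional set.

  The approximate functional equation comes from Jensen's formula: \<open>(s - 1) (\<zeta>(s) - \<Sum>n<a. n powr -s)\<close> is the
  integral of \<open>z powr (1-s) (pi / sin (pi z))^2 / 2 pi\<close> along \<open>Re z = a\<close>.  Expanding the kernel in powers
  of \<open>exp (2 pi \<i> z)\<close> turns its main terms into Gamma integrals, which are the dual sum.
\<close>

section \<open>Jensen's integral for zeta\<close>

text \<open>The defect is bounded at every \<open>h\<close> of the window; the points
  \<open>h_seq\<close> enter through their number and spacing. Write \<open>y = \<psi> T\<close> and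
  \<open>l = ln (T / (2 * pi)) / 2\<close>. Three sizes decide the outcome. All approximations
  together cost \<open>O(L ^ 2)\<close> in \<open>Z\<close>, which has to stay below
  \<open>sqrt l * y powr (- \<epsilon> / 4)\<close>; hence the slow growth of \<psi>. The
  coefficients of the defect are small only when \<open>ln n\<close> is well above
  \<open>l / L\<close>; a cut at \<open>ln n = lam * l\<close> gives the square sum
  \<open>l * (lam + 1 / (L * lam) ^ 2)\<close> up to constants, and
  \<open>lam = L powr (-2/3)\<close> balances it at about
  \<open>l * y powr (- 2 * \<epsilon> / 3)\<close>. The off-diagonal terms of the mean square add
  about \<open>sqrt T * l\<close>, a fraction \<open>1 / y\<close> of \<open>H * l\<close>. Against
  the squared threshold \<open>l * y powr (- \<epsilon> / 2)\<close> there remains an exceptional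
  share \<open>y powr (- \<epsilon> / 6)\<close>. That the two halves of \<open>Z\<close> are
  conjugate comes from the Gamma factor of the dual sum, which equals
  \<open>exp (- 2 * \<i> * theta t)\<close> up to a relative error
  \<open>exp (- pi * t)\<close>.\<close>

lemma integral_exp_bound_atLeast_0:
  fixes f :: "real \<Rightarrow> complex"
  assumes cont: "continuous_on {0..} f" and c: "c > 0"
    and bd: "\<And>y. y \<ge> 0 \<Longrightarrow> norm (f y) \<le> B * exp (- c * y)"
  shows "f integrable_on {0..}"
    and "norm (integral {0..} f) \<le> B / c"
    and "(\<lambda>n. integral {0..real n} f) \<longlonglongrightarrow> integral {0..} f"
    and "\<And>n. norm (integral {0..} f - integral {0..real n} f) \<le> B / c * exp (- c * real n)"
proof -
  have int_exp: "((\<lambda>y. B * exp (- c * y)) has_integral B * (exp (-c*0)/c)) {0..}"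
    by (intro has_integral_mult_right has_integral_exp_minus_to_infinity c)
  have meas: "f \<in> borel_measurable (lebesgue_on {0..})"
    using cont by (intro continuous_imp_measurable_on_sets_lebesgue) auto
  show int: "f integrable_on {0..}"
    by (rule measurable_bounded_by_integrable_imp_integrable[OF meas _ _ ])
       (use int_exp bd in \<open>auto simp: integrable_on_def\<close>)
  show "norm (integral {0..} f) \<le> B / c"
    using integral_norm_bound_integral[OF int has_integral_integrable[OF int_exp]] bd
      integral_unique[OF int_exp] by auto
  \<comment> \<open>Contour arguments deliver integrals over \<open>{0..n}\<close> only; domination
    by the exponential carries them to the half-line.\<close>
  have "(\<lambda>n. integral {0..} (\<lambda>y. if y \<in> {0..real n} then f y else 0)) \<longlonglongrightarrow> integral {0..} f"
  proof (rule dominated_convergence(2)[where h = "\<lambda>y. B * exp (- c * y)"])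
    show "(\<lambda>y. if y \<in> {0..real n} then f y else 0) integrable_on {0..}" for n
    proof -
      have "f integrable_on {0..real n}"
        by (intro integrable_continuous_real continuous_on_subset[OF cont]) auto
      thus ?thesis by (subst integrable_restrict_Int) (auto simp: Int_absorb2 Int_absorb1)
    qed
    show "(\<lambda>y. B * exp (- c * y)) integrable_on {0..}" using int_exp by blast
    show "norm (if y \<in> {0..real n} then f y else 0) \<le> B * exp (- c * y)" if "y \<in> {0..}" for y n
      using bd[of y] that norm_ge_zero[of "f y"] by (auto intro: order_trans simp del: norm_ge_zero)
    show "(\<lambda>n. if y \<in> {0..real n} then f y else 0) \<longlonglongrightarrow> f y" if "y \<in> {0..}" for y
    proof (rule tendsto_eventually)
      have "\<forall>\<^sub>F n in sequentially. y \<le> real n"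
        by (rule eventually_compose_filterlim[OF eventually_ge_at_top filterlim_real_sequentially])
      thus "\<forall>\<^sub>F n in sequentially. (if y \<in> {0..real n} then f y else 0) = f y"
        by eventually_elim (use that in auto)
    qed
  qed
  moreover have "integral {0..} (\<lambda>y. if y \<in> {0..real n} then f y else 0) = integral {0..real n} f" for n
    by (subst integral_restrict_Int) (auto simp: Int_absorb1 Int_absorb2)
  ultimately show lim: "(\<lambda>n. integral {0..real n} f) \<longlonglongrightarrow> integral {0..} f" by simp
  have fi: "f integrable_on {u..v}" if "u \<ge> 0" for u v
    by (intro integrable_continuous_real continuous_on_subset[OF cont]) (use that in auto)
  have B: "B \<ge> 0" using bd[of 0] norm_ge_zero[of "f 0"] by (simp del: norm_ge_zero)
  \<comment> \<open>The tail bound depends on \<open>f\<close> only through \<open>B\<close> and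
    \<open>c\<close>, so it is uniform in any parameter that leaves these fixed. Locally uniform
    convergence in \<open>w\<close> will rest on this.\<close>
  show "norm (integral {0..} f - integral {0..real n} f) \<le> B / c * exp (- c * real n)" for n
  proof (rule tendsto_upperbound)
    show "(\<lambda>m. norm (integral {0..real m} f - integral {0..real n} f)) \<longlonglongrightarrow>
            norm (integral {0..} f - integral {0..real n} f)"
      by (intro tendsto_intros lim)
    show "\<forall>\<^sub>F m in sequentially. norm (integral {0..real m} f - integral {0..real n} f) \<le> B / c * exp (- c * real n)"
      using eventually_ge_at_top[of n]
    proof eventually_elim
      case (elim m)
      have "integral {0..real m} f - integral {0..real n} f = integral {real n..real m} f"
        using Henstock_Kurzweil_Integration.integral_combine[where a = 0 and c = "real n" and b = "real m" and f = f] elim fi by (simp add: algebra_simps)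
      also have "norm \<dots> \<le> integral {real n..} (\<lambda>y. if y \<in> {real n..real m} then B * exp (- c * y) else 0)"
      proof -
        have "norm (integral {real n..real m} f) \<le> integral {real n..real m} (\<lambda>y. B * exp (- c * y))"
          by (intro integral_norm_bound_integral fi integrable_continuous_real continuous_intros) (use bd in auto)
        also have "\<dots> = integral {real n..} (\<lambda>y. if y \<in> {real n..real m} then B * exp (- c * y) else 0)"
          by (subst integral_restrict_Int) (auto simp: Int_absorb1 Int_absorb2)
        finally show ?thesis .
      qed
      also have "\<dots> \<le> integral {real n..} (\<lambda>y. B * exp (- c * y))"
      proof (rule integral_le)
        have "(\<lambda>y. B * exp (- c * y)) integrable_on {real n..real m}"
          by (intro integrable_continuous_real continuous_intros)
        thus "(\<lambda>y. if y \<in> {real n..real m} then B * exp (- c * y) else 0) integrable_on {real n..}"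
          by (subst integrable_restrict_Int) (auto simp: Int_absorb1 Int_absorb2)
        show "(\<lambda>y. B * exp (- c * y)) integrable_on {real n..}"
          using has_integral_mult_right[OF has_integral_exp_minus_to_infinity[OF c]] by blast
      qed (use B in auto)
      also have "\<dots> = B / c * exp (- c * real n)"
        using has_integral_exp_minus_to_infinity[OF c, of "real n"]
        by (simp add: integral_unique)
      finally show ?case .
    qed
  qed auto
qed

text \<open>Jensen's kernel: a double pole with coefficient 1 at every integer.\<close>

definition jker :: "complex \<Rightarrow> complex" where
  "jker z = of_real (pi ^ 2) / sin (of_real pi * z) ^ 2"

section \<open>Bounds for Jensen's kernel and its residues\<close>

lemma norm_sin_pi_squared:
  "norm (sin (of_real pi * Complex x y)) ^ 2 = (exp (2 * pi * y) + exp (- (2 * pi * y)) - 2 * cos (2 * pi * x)) / 4"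
  using norm_sin_squared[of "of_real pi * Complex x y"] by (simp add: exp_minus mult_ac)

text \<open>The condition on the cosine says that \<open>a\<close> is at least 1/4 away from every
  integer; in the formula for the squared modulus of the sine the cosine term then only helps. In
  this form it serves throughout as the requirement that a vertical line avoid the poles.\<close>

lemma norm_jker_le_vertical:
  assumes "cos (2 * pi * a) \<le> 0"
  shows "norm (jker (Complex a y)) \<le> 4 * pi ^ 2 * exp (- (2 * pi * \<bar>y\<bar>))"
proof -
  let ?s = "norm (sin (of_real pi * Complex a y)) ^ 2"
  have "exp (2 * pi * \<bar>y\<bar>) \<le> exp (2 * pi * y) + exp (- (2 * pi * y))"
    by (cases "y \<ge> 0") auto
  hence s: "?s \<ge> exp (2 * pi * \<bar>y\<bar>) / 4"
    using assms norm_sin_pi_squared[of a y] by simp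
  have "norm (jker (Complex a y)) = pi ^ 2 / ?s"
    by (simp add: jker_def norm_divide norm_power del: of_real_power)
  also have "\<dots> \<le> pi ^ 2 / (exp (2 * pi * \<bar>y\<bar>) / 4)"
    by (intro divide_left_mono s mult_pos_pos less_le_trans[OF _ s]) auto
  also have "\<dots> = 4 * pi ^ 2 * exp (- (2 * pi * \<bar>y\<bar>))"
    by (simp add: exp_minus field_simps)
  finally show ?thesis .
qed

text \<open>At height 1 or more, \<open>exp (2 * pi * \<bar>y\<bar>)\<close> is at least 4, and half
  of it absorbs the cosine term whatever \<open>x\<close> is. Horizontal sides of contours can
  therefore pass above and below the poles.\<close>

lemma norm_jker_le_horizontal:
  assumes "\<bar>y\<bar> \<ge> 1"
  shows "norm (jker (Complex x y)) \<le> 8 * pi ^ 2 * exp (- (2 * pi * \<bar>y\<bar>))"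
proof -
  let ?s = "norm (sin (of_real pi * Complex x y)) ^ 2"
  have e: "exp (2 * pi * \<bar>y\<bar>) \<le> exp (2 * pi * y) + exp (- (2 * pi * y))"
    by (cases "y \<ge> 0") auto
  have "pi \<le> pi * \<bar>y\<bar>" using assms by simp
  hence "3 \<le> 2 * pi * \<bar>y\<bar>" using pi_gt3 by linarith
  moreover have "1 + 2 * pi * \<bar>y\<bar> \<le> exp (2 * pi * \<bar>y\<bar>)" by (rule exp_ge_add_one_self)
  ultimately have "4 \<le> exp (2 * pi * \<bar>y\<bar>)" by linarith
  hence s: "?s \<ge> exp (2 * pi * \<bar>y\<bar>) / 8"
    using e norm_sin_pi_squared[of x y] cos_le_one[of "2 * pi * x"] by argo
  have "norm (jker (Complex x y)) = pi ^ 2 / ?s"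
    by (simp add: jker_def norm_divide norm_power del: of_real_power)
  also have "\<dots> \<le> pi ^ 2 / (exp (2 * pi * \<bar>y\<bar>) / 8)"
    by (intro divide_left_mono s mult_pos_pos less_le_trans[OF _ s]) auto
  also have "\<dots> = 8 * pi ^ 2 * exp (- (2 * pi * \<bar>y\<bar>))"
    by (simp add: exp_minus field_simps)
  finally show ?thesis .
qed

lemma sin_pi_complex_eq_0_iff: "sin (of_real pi * z) = 0 \<longleftrightarrow> z \<in> \<int>" for z :: complex
proof
  assume "sin (of_real pi * z) = 0"
  then obtain n :: int where "of_real pi * z = of_real (of_int n * pi)"
    by (auto simp: sin_eq_0)
  hence "z = of_int n" by (simp add: field_simps)
  thus "z \<in> \<int>" by simp
next
  assume "z \<in> \<int>"
  then obtain n where "z = of_int n" by (elim Ints_cases)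
  thus "sin (of_real pi * z) = 0"
    using sin_eq_0[of "of_real pi * z"] by (auto intro!: exI[of _ n])
qed

lemma cos_2pi_nonpos_not_Ints: "cos (2 * pi * a) \<le> 0 \<Longrightarrow> Complex a y \<notin> \<int>"
proof
  assume *: "cos (2 * pi * a) \<le> 0" "Complex a y \<in> \<int>"
  then obtain n where "Complex a y = of_int n" by (elim Ints_cases)
  hence "a = of_int n" by (simp add: complex_eq_iff)
  with *(1) show False using cos_int_2pin[of n] by (simp add: mult_ac)
qed

lemma holomorphic_on_jker [holomorphic_intros]:
  assumes "A \<inter> \<int> = {}"
  shows "jker holomorphic_on A"
  unfolding jker_def
  by (intro holomorphic_intros) (use assms in \<open>auto simp: sin_pi_complex_eq_0_iff\<close>)

text \<open>The polynomial growth of the power is traded for an exponential of rate 1, which the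
  kernel, decaying at rate \<open>2 * pi\<close>, can absorb. The constant depends on
  \<open>w\<close> only through the bound \<open>r\<close>.\<close>

lemma norm_powr_complex_le:
  fixes z w :: complex
  assumes "1/2 \<le> norm z" "norm z \<le> u" "r \<ge> norm w"
  shows "norm (z powr w) \<le> exp (r * (pi + 1)) * (r + 1) powr r * exp (1 + u)"
proof -
  have z: "z \<noteq> 0" using assms(1) by auto
  have r: "r \<ge> 0" using assms(3) norm_ge_zero order_trans by blast
  have u: "u > 0" using assms by linarith
  have "norm (Ln z) \<le> \<bar>Re (Ln z)\<bar> + \<bar>Im (Ln z)\<bar>" by (rule cmod_le)
  moreover have "\<bar>Im (Ln z)\<bar> \<le> pi" using Im_Ln_le_pi[OF z] mpi_less_Im_Ln[OF z] by linarith
  moreover have "\<bar>Re (Ln z)\<bar> \<le> 1 + ln (1 + u)"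
  proof -
    have "ln (norm z) \<le> ln (1 + u)" using assms z by (subst ln_le_cancel_iff) auto
    moreover have "ln (norm z) \<ge> ln (1/2)" using assms z by (subst ln_le_cancel_iff) auto
    moreover have "ln (1/2::real) \<ge> - 1" using ln_2_less_1 by (simp add: ln_div)
    moreover have "ln (1 + u) \<ge> 0" using u by simp
    ultimately show ?thesis unfolding Re_Ln[OF z] by linarith
  qed
  ultimately have L: "norm (Ln z) \<le> (pi + 1) + ln (1 + u)" by linarith
  have "norm (z powr w) = exp (Re (w * Ln z))" using z by (simp add: powr_def)
  also have "Re (w * Ln z) \<le> norm (w * Ln z)" by (rule complex_Re_le_cmod)
  also have "norm (w * Ln z) \<le> r * ((pi + 1) + ln (1 + u))"
    unfolding norm_mult by (intro mult_mono assms L) (use r in auto)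
  also have "exp (r * ((pi + 1) + ln (1 + u))) = exp (r * (pi + 1)) * (1 + u) powr r"
    using u by (simp add: powr_def exp_add[symmetric] algebra_simps)
  also have "(1 + u) powr r \<le> (r + 1) powr r * exp (1 + u)"
  proof -
    \<comment> \<open>The inequality \<open>x \<le> exp x\<close> at
      \<open>x = (1 + u) / (r + 1)\<close>, raised to the power \<open>r\<close>, costs no more than
      the factor \<open>exp (1 + u)\<close>.\<close>
    have "(1 + u) / (r + 1) \<le> exp ((1 + u) / (r + 1))"
      using exp_ge_add_one_self[of "(1 + u) / (r + 1)"] by linarith
    hence "1 + u \<le> (r + 1) * exp ((1 + u) / (r + 1))" using r by (simp add: field_simps)
    hence "(1 + u) powr r \<le> ((r + 1) * exp ((1 + u) / (r + 1))) powr r"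
      using u r by (intro powr_mono2) auto
    also have "\<dots> = (r + 1) powr r * exp (r * ((1 + u) / (r + 1)))"
    proof -
      have "exp ((1 + u) / (r + 1)) powr r = exp (r * ((1 + u) / (r + 1)))"
        by (simp add: powr_def)
      thus ?thesis using r by (subst powr_mult) auto
    qed
    also have "r * ((1 + u) / (r + 1)) \<le> 1 + u"
    proof -
      have "r * (1 + u) \<le> (r + 1) * (1 + u)" using u by (simp add: algebra_simps)
      thus ?thesis using r by (simp add: field_simps)
    qed
    finally show ?thesis by (simp add: mult_left_mono)
  qed
  finally show ?thesis by (simp add: mult_ac mult_left_mono)
qed

text \<open>In the applications \<open>w\<close> is \<open>1 - s\<close>: the double poles of the
  kernel pick out the derivative of \<open>z powr w\<close> at \<open>n\<close>, which is
  \<open>1 - s\<close> times the term \<open>n powr (- s)\<close> of the Dirichlet series.\<close>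

definition jint :: "complex \<Rightarrow> complex \<Rightarrow> complex" where
  "jint w z = z powr w * jker z"

lemma residue_powr_cot:
  assumes n: "n > 0"
  shows "residue (\<lambda>z. w * z powr (w - 1) * (of_real pi * cot (of_real pi * z))) (of_nat n)
           = w * of_nat n powr (w - 1)"
proof (rule residue_simple'[where s = "ball (of_nat n) 1"])
  have nI: "z \<notin> \<int>" if "z \<in> ball (of_nat n) 1 - {of_nat n}" for z :: complex
  proof
    assume "z \<in> \<int>"
    then obtain m where m: "z = of_int m" by (elim Ints_cases)
    have "norm (of_int (int n - m) :: complex) < 1" using that m by (simp add: dist_norm)
    hence "\<bar>int n - m\<bar> < 1" by (simp only: norm_of_int)
    hence "m = int n" by simp
    hence "z = of_nat n" using m by simp
    with that show False by simp
  qed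
  have nR: "z \<notin> \<real>\<^sub>\<le>\<^sub>0" if "z \<in> ball (of_nat n) 1" for z :: complex
  proof
    assume "z \<in> \<real>\<^sub>\<le>\<^sub>0"
    hence "Re z \<le> 0" by (auto simp: complex_nonpos_Reals_iff)
    moreover have "\<bar>Re (of_nat n - z)\<bar> < 1"
      using that abs_Re_le_cmod[of "of_nat n - z"] by (simp add: dist_norm)
    ultimately show False using n by simp
  qed
  show "(\<lambda>z. w * z powr (w - 1) * (of_real pi * cot (of_real pi * z))) holomorphic_on
          ball (of_nat n) 1 - {of_nat n}"
    unfolding cot_def
    by (intro holomorphic_intros) (use nI nR in \<open>auto simp: sin_pi_complex_eq_0_iff\<close>)
  have ev: "\<forall>\<^sub>F z in at (of_nat n). z \<in> ball (of_nat n) 1 - {of_nat n :: complex}"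
    by (rule eventually_at_in_open) auto
  have d: "((\<lambda>z. sin (of_real pi * z)) has_field_derivative
         of_real pi * cos (of_real pi * of_nat n)) (at (of_nat n :: complex))"
    by (auto intro!: derivative_eq_intros)
  have c0: "cos (of_real pi * of_nat n :: complex) \<noteq> 0"
  proof
    assume "cos (of_real pi * of_nat n :: complex) = 0"
    moreover have "sin (of_real pi * of_nat n :: complex) = 0" by (simp add: sin_pi_complex_eq_0_iff)
    ultimately show False using sin_cos_squared_add[of "of_real pi * of_nat n :: complex"] by simp
  qed
  have "((\<lambda>z. (sin (of_real pi * z) - sin (of_real pi * of_nat n)) / (z - of_nat n))
          \<longlongrightarrow> of_real pi * cos (of_real pi * of_nat n)) (at (of_nat n :: complex))"
    using d by (simp add: has_field_derivative_iff)
  hence lim: "((\<lambda>z. sin (of_real pi * z) / (z - of_nat n))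
          \<longlongrightarrow> of_real pi * cos (of_real pi * of_nat n)) (at (of_nat n :: complex))"
    using sin_pi_complex_eq_0_iff[of "of_nat n"] by simp
  have "((\<lambda>z. w * z powr (w - 1) * (of_real pi * cos (of_real pi * z)) / (sin (of_real pi * z) / (z - of_nat n)))
          \<longlongrightarrow> w * of_nat n powr (w - 1) * (of_real pi * cos (of_real pi * of_nat n)) /
             (of_real pi * cos (of_real pi * of_nat n))) (at (of_nat n :: complex))"
    by (intro tendsto_intros lim) (use c0 nR[of "of_nat n"] in auto)
  also have "(w * of_nat n powr (w - 1) * (of_real pi * cos (of_real pi * of_nat n)) /
             (of_real pi * cos (of_real pi * of_nat n))) = w * of_nat n powr (w - 1)"
    using c0 by simp
  finally show "((\<lambda>z. w * z powr (w - 1) * (of_real pi * cot (of_real pi * z)) * (z - of_nat n))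
     \<longlongrightarrow> w * of_nat n powr (w - 1)) (at (of_nat n))"
    by (rule Lim_transform_eventually)
       (use ev in eventually_elim, auto simp: cot_def)
qed auto

text \<open>Integration by parts against \<open>pi cot (pi z)\<close> trades the double poles of the kernel for simple ones.\<close>

lemma contour_integral_rect_jint:
  assumes ab: "0 < a" "a < b" and ca: "cos (2 * pi * a) \<le> 0" and cb: "cos (2 * pi * b) \<le> 0"
    and Y: "Y > 0"
  shows "contour_integral (rectpath (Complex a (-Y)) (Complex b Y)) (jint w)
           = 2 * pi * \<i> * (\<Sum>n | a < real n \<and> real n < b. w * of_nat n powr (w - 1))"
proof -
  define N where "N = {n. a < real n \<and> real n < b}"
  have finN: "finite N"
    by (rule finite_subset[of _ "{..nat \<lceil>b\<rceil>}"]) (auto simp: N_def, linarith)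
  \<comment> \<open>The strip between the integers next to \<open>a\<close> and \<open>b\<close>: it
    contains the closed rectangle, avoids the branch cut, and its integers are exactly those in
    \<open>N\<close>.\<close>
  define S where "S = {z. of_int \<lfloor>a\<rfloor> < Re z \<and> Re z < of_int \<lceil>b\<rceil>}"
  define pts where "pts = (of_nat ` N :: complex set)"
  define R where "R = rectpath (Complex a (-Y)) (Complex b Y)"
  define p where "p = (\<lambda>z :: complex. w * z powr (w - 1) * (of_real pi * cot (of_real pi * z)))"
  have na: "of_int \<lfloor>a\<rfloor> < a"
    using cos_2pi_nonpos_not_Ints[OF ca, of 0]
    by (metis Ints_of_int complex_of_real_def floor_correct of_real_of_int_eq order_le_less)
  have nb: "b < of_int \<lceil>b\<rceil>"
    using cos_2pi_nonpos_not_Ints[OF cb, of 0]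
    by (metis Ints_of_int complex_of_real_def le_of_int_ceiling of_real_of_int_eq order_le_less)
  have Sint: "S = {z. of_int \<lfloor>a\<rfloor> < Re z} \<inter> {z. Re z < of_int \<lceil>b\<rceil>}" by (auto simp: S_def)
  have openS: "open S" unfolding Sint by (intro open_Int open_halfspace_Re_gt open_halfspace_Re_lt)
  have convS: "convex S" unfolding Sint by (intro convex_Int convex_halfspace_Re_gt convex_halfspace_Re_lt)
  have Spos: "z \<notin> \<real>\<^sub>\<le>\<^sub>0" if "z \<in> S" for z
  proof
    assume "z \<in> \<real>\<^sub>\<le>\<^sub>0"
    moreover have "\<lfloor>a\<rfloor> \<ge> 0" using ab by simp
    ultimately show False using that unfolding S_def complex_nonpos_Reals_iff by (auto; linarith)
  qed
  have Snint: "z \<notin> \<int>" if z: "z \<in> S - pts" for z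
  proof
    assume "z \<in> \<int>"
    then obtain m where m: "z = of_int m" by (elim Ints_cases)
    have m1: "\<lfloor>a\<rfloor> < m" "m < \<lceil>b\<rceil>" using z m by (auto simp: S_def)
    have "a < of_int m" "of_int m < b" using m1 by linarith+
    moreover have "m \<ge> 0" using m1 ab by (meson dual_order.strict_trans2 less_imp_le zero_le_floor)
    ultimately have "nat m \<in> N" "z = of_nat (nat m)" using m by (auto simp: N_def)
    with z show False by (auto simp: pts_def)
  qed
  have imR: "path_image R \<subseteq> S - \<int>"
  proof
    fix z assume "z \<in> path_image R"
    hence "Re z \<in> {a, b} \<and> Im z \<in> {-Y..Y} \<or> Im z \<in> {-Y, Y} \<and> Re z \<in> {a..b}"
      unfolding R_def using ab Y by (subst (asm) path_image_rectpath) auto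
    moreover have "z \<in> \<int> \<Longrightarrow> Im z = 0" by (auto elim!: Ints_cases)
    moreover have "z = Complex (Re z) (Im z)" by simp
    ultimately show "z \<in> S - \<int>"
      using na nb ab Y cos_2pi_nonpos_not_Ints[OF ca] cos_2pi_nonpos_not_Ints[OF cb]
      unfolding S_def by (smt (verit) DiffI atLeastAtMost_iff insert_iff mem_Collect_eq singletonD)
  qed
  have hol_p: "p holomorphic_on S - pts"
    unfolding p_def cot_def
    by (intro holomorphic_intros) (use Snint Spos in \<open>auto simp: sin_pi_complex_eq_0_iff\<close>)
  have hol_j: "jint w holomorphic_on S - pts"
    unfolding jint_def by (intro holomorphic_intros) (use Snint Spos in auto)
  have open': "open (S - pts)" using openS finN by (auto simp: pts_def finite_imp_closed)
  have vR: "valid_path R" by (simp add: R_def)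
  have imR': "path_image R \<subseteq> S - pts" using imR by (auto simp: pts_def)
  have int_p: "p contour_integrable_on R" and int_j: "jint w contour_integrable_on R"
    using contour_integrable_holomorphic_simple[OF _ open' vR imR'] hol_p hol_j by auto
  have "contour_integral R p = 2 * pi * \<i> * (\<Sum>z\<in>pts. winding_number R z * residue p z)"
  proof (rule Residue_theorem[OF openS _ _ hol_p vR])
    show "connected S" using convS by (rule convex_connected)
    show "finite pts" using finN by (simp add: pts_def)
    show "\<forall>z. z \<notin> S \<longrightarrow> winding_number R z = 0"
    proof (intro allI impI)
      fix z assume "z \<notin> S"
      hence "z \<notin> cbox (Complex a (-Y)) (Complex b Y)"
        using na nb by (auto simp: S_def in_cbox_complex_iff)
      thus "winding_number R z = 0"
        unfolding R_def using ab Y by (intro winding_number_rectpath_outside) auto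
    qed
  qed (use imR' in \<open>auto simp: R_def\<close>)
  also have "(\<Sum>z\<in>pts. winding_number R z * residue p z) = (\<Sum>n\<in>N. w * of_nat n powr (w - 1))"
    unfolding pts_def
  proof (subst sum.reindex)
    show "inj_on (of_nat :: nat \<Rightarrow> complex) N" by (auto simp: inj_on_def)
    show "sum ((\<lambda>z. winding_number R z * residue p z) \<circ> of_nat) N = (\<Sum>n\<in>N. w * of_nat n powr (w - 1))"
    proof (intro sum.cong refl)
      fix n assume n: "n \<in> N"
      have "winding_number R (of_nat n) = 1"
        unfolding R_def using n Y by (intro winding_number_rectpath) (auto simp: N_def in_box_complex_iff)
      moreover have "n > 0" using n ab by (auto simp: N_def intro: gr0I)
      ultimately show "((\<lambda>z. winding_number R z * residue p z) \<circ> of_nat) n = w * of_nat n powr (w - 1)"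
        using residue_powr_cot[of n w] by (simp add: p_def)
    qed
  qed
  finally have 1: "contour_integral R p = 2 * pi * \<i> * (\<Sum>n\<in>N. w * of_nat n powr (w - 1))" .
  \<comment> \<open>The boundary term of the integration by parts is single-valued on the punctured
    strip, so it contributes nothing around a closed path.\<close>
  have "((\<lambda>z. p z - jint w z) has_contour_integral 0) R"
  proof (rule Cauchy_theorem_primitive)
    show "((\<lambda>z. z powr w * (of_real pi * cot (of_real pi * z))) has_field_derivative p z - jint w z)
            (at z within S - pts)" if z: "z \<in> S - pts" for z
    proof -
      have s: "sin (of_real pi * z) \<noteq> 0" using Snint[OF z] by (simp add: sin_pi_complex_eq_0_iff)
      have "(cot has_field_derivative - inverse (sin (of_real pi * z) ^ 2)) (at (of_real pi * z))"
        using s by (rule DERIV_cot)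
      hence c: "((\<lambda>z. cot (of_real pi * z)) has_field_derivative
              - inverse (sin (of_real pi * z) ^ 2) * of_real pi) (at z)"
        by (rule DERIV_chain2) (auto intro!: derivative_eq_intros)
      have "((\<lambda>z. z powr w * (of_real pi * cot (of_real pi * z))) has_field_derivative
               (w * z powr (w - 1)) * (of_real pi * cot (of_real pi * z)) +
               (of_real pi * (- inverse (sin (of_real pi * z) ^ 2) * of_real pi)) * z powr w) (at z)"
        using Spos z by (intro DERIV_mult has_field_derivative_powr DERIV_cmult c) auto
      also have "(w * z powr (w - 1)) * (of_real pi * cot (of_real pi * z)) +
               (of_real pi * (- inverse (sin (of_real pi * z) ^ 2) * of_real pi)) * z powr w = p z - jint w z"
        by (simp add: p_def jint_def jker_def field_simps power2_eq_square)
      finally show ?thesis by (rule has_field_derivative_at_within)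
    qed
  qed (use vR imR' in \<open>auto simp: R_def\<close>)
  hence "contour_integral R p - contour_integral R (jint w) = 0"
    using contour_integral_unique contour_integral_diff[OF int_p int_j] by metis
  thus ?thesis using 1 by (simp add: R_def N_def)
qed

definition jbound :: "real \<Rightarrow> real \<Rightarrow> real" where
  "jbound r b = 8 * pi ^ 2 * (exp (r * (pi + 1)) * (r + 1) powr r * exp (1 + b))"

lemma norm_jint_le:
  assumes "1/2 \<le> x" "x \<le> b" "norm w \<le> r"
    and "cos (2 * pi * x) \<le> 0 \<or> \<bar>y\<bar> \<ge> 1"
  shows "norm (jint w (Complex x y)) \<le> jbound r b * exp (- \<bar>y\<bar>)"
proof -
  have "norm (jker (Complex x y)) \<le> 8 * pi ^ 2 * exp (- (2 * pi * \<bar>y\<bar>))"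
  proof (cases "\<bar>y\<bar> \<ge> 1")
    case False
    hence "norm (jker (Complex x y)) \<le> 4 * pi ^ 2 * exp (- (2 * pi * \<bar>y\<bar>))"
      using assms by (intro norm_jker_le_vertical) auto
    also have "\<dots> \<le> 8 * pi ^ 2 * exp (- (2 * pi * \<bar>y\<bar>))" by simp
    finally show ?thesis .
  qed (rule norm_jker_le_horizontal)
  \<comment> \<open>The decay rate \<open>2 * pi\<close> is weakened to 2: one unit pays for the
    growth of the power, the other is left for the result.\<close>
  also have "\<dots> \<le> 8 * pi ^ 2 * exp (- (2 * \<bar>y\<bar>))"
    using pi_gt3 mult_right_mono[of 1 pi "\<bar>y\<bar>"] by (intro mult_left_mono) auto
  finally have 1: "norm (jker (Complex x y)) \<le> 8 * pi ^ 2 * exp (- (2 * \<bar>y\<bar>))" .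
  have 2: "norm (Complex x y powr w) \<le> exp (r * (pi + 1)) * (r + 1) powr r * exp (1 + (b + \<bar>y\<bar>))"
  proof (rule norm_powr_complex_le)
    show "1 / 2 \<le> norm (Complex x y)" using abs_Re_le_cmod[of "Complex x y"] assms by simp
    show "norm (Complex x y) \<le> b + \<bar>y\<bar>" using cmod_le[of "Complex x y"] assms by simp
  qed fact
  have "norm (jint w (Complex x y)) \<le>
      (exp (r * (pi + 1)) * (r + 1) powr r * exp (1 + (b + \<bar>y\<bar>))) * (8 * pi ^ 2 * exp (- (2 * \<bar>y\<bar>)))"
    unfolding jint_def norm_mult by (intro mult_mono 1 2) auto
  also have "exp (1 + (b + \<bar>y\<bar>)) = exp (1 + b) * exp (\<bar>y\<bar>)" by (simp flip: exp_add)
  also have "exp (- (2 * \<bar>y\<bar>)) = exp (- \<bar>y\<bar>) * exp (- \<bar>y\<bar>)" by (simp flip: exp_add)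
  also have "exp (r * (pi + 1)) * (r + 1) powr r * (exp (1 + b) * exp \<bar>y\<bar>) * (8 * pi\<^sup>2 * (exp (- \<bar>y\<bar>) * exp (- \<bar>y\<bar>)))
     = jbound r b * exp (- \<bar>y\<bar>) * (exp \<bar>y\<bar> * exp (- \<bar>y\<bar>))" by (simp add: jbound_def mult_ac)
  also have "exp \<bar>y\<bar> * exp (- \<bar>y\<bar>) = 1" by (simp flip: exp_add)
  finally show ?thesis by simp
qed

lemma continuous_on_jint:
  assumes "0 < a" "cos (2 * pi * a) \<le> 0"
  shows "continuous_on A (\<lambda>y. jint w (Complex a y))"
proof -
  have "of_real a + \<i> * of_real y \<notin> \<int>" "of_real a + \<i> * of_real y \<notin> \<real>\<^sub>\<le>\<^sub>0" for y
    using assms cos_2pi_nonpos_not_Ints[OF assms(2), of y]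
    by (auto simp: complex_nonpos_Reals_iff Complex_eq)
  moreover have "of_real a + \<i> * of_real y \<noteq> 0" for y using assms by (simp add: complex_eq_iff)
  ultimately show ?thesis
    unfolding jint_def jker_def Complex_eq
    using assms(1) by (intro continuous_intros) (auto simp: sin_pi_complex_eq_0_iff)
qed

text \<open>The integral of \<open>jint w\<close> up the line \<open>Re z = a\<close>, divided by
  \<open>\<i>\<close> and folded at the real axis. Folding gives one half-line integral; the upper
  and the lower half will later behave quite differently.\<close>

definition vline :: "real \<Rightarrow> complex \<Rightarrow> complex" where
  "vline a w = integral {0..} (\<lambda>y. jint w (Complex a y) + jint w (Complex a (- y)))"

lemma vline_props:
  assumes a: "1/2 \<le> a" "cos (2 * pi * a) \<le> 0"
  defines "f \<equiv> \<lambda>w y. jint w (Complex a y) + jint w (Complex a (- y))"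
  shows "(\<lambda>n. integral {0..real n} (f w)) \<longlonglongrightarrow> vline a w"
    and "norm w \<le> r \<Longrightarrow> norm (vline a w - integral {0..real n} (f w)) \<le> 2 * jbound r a * exp (- real n)"
proof -
  have cont: "continuous_on {0..} (f w)" for w
  proof -
    have "continuous_on {0..} (\<lambda>y. jint w (Complex a (- y)))"
      by (rule continuous_on_compose2[OF continuous_on_jint[OF _ a(2), of UNIV]])
         (use a in \<open>auto intro!: continuous_intros\<close>)
    thus ?thesis unfolding f_def by (intro continuous_on_add continuous_on_jint) (use a in auto)
  qed
  have bd: "norm (f w y) \<le> 2 * jbound r a * exp (- 1 * y)" if "norm w \<le> r" "y \<ge> 0" for w y r
    using norm_jint_le[of a a w r y] norm_jint_le[of a a w r "-y"] that a
      norm_triangle_ineq[of "jint w (Complex a y)" "jint w (Complex a (- y))"]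
    unfolding f_def by auto
  have v: "vline a w = integral {0..} (f w)" by (simp add: vline_def f_def)
  show "(\<lambda>n. integral {0..real n} (f w)) \<longlonglongrightarrow> vline a w"
    unfolding v by (rule integral_exp_bound_atLeast_0(3)[OF cont _ bd[OF order_refl]]) auto
  show "norm (vline a w - integral {0..real n} (f w)) \<le> 2 * jbound r a * exp (- real n)" if "norm w \<le> r"
    using integral_exp_bound_atLeast_0(4)[OF cont _ bd[OF that], of n] by (simp add: v)
qed

lemma contour_integral_vline:
  assumes "a > 0" "cos (2 * pi * a) \<le> 0" "Y > 0"
  shows "contour_integral (linepath (Complex a (-Y)) (Complex a Y)) (jint w) =
           \<i> * integral {0..Y} (\<lambda>y. jint w (Complex a y) + jint w (Complex a (- y)))"
proof -
  let ?g = "\<lambda>y. jint w (Complex a y)"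
  have i: "?g integrable_on {u..v}" for u v
    by (intro integrable_continuous_real continuous_on_jint assms)
  have "contour_integral (linepath (Complex a (-Y)) (Complex a Y)) (jint w) = \<i> * integral {-Y..Y} ?g"
    using assms by (intro contour_integral_linepath_same_Re) auto
  also have "integral {-Y..Y} ?g = integral {-Y..0} ?g + integral {0..Y} ?g"
    using Henstock_Kurzweil_Integration.integral_combine[where a = "-Y" and c = 0 and b = Y and f = ?g] i assms by simp
  also have "integral {-Y..0} ?g = integral {0..Y} (\<lambda>y. ?g (- y))"
    using Henstock_Kurzweil_Integration.integral_reflect_real[of Y 0 "\<lambda>y. ?g (- y)"] by simp
  also have "\<dots> + integral {0..Y} ?g = integral {0..Y} (\<lambda>y. ?g (- y) + ?g y)"
    using i[of "-Y" 0] Henstock_Kurzweil_Integration.integrable_reflect_real[of "\<lambda>y. ?g (- y)" Y 0]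
    by (intro integral_add[symmetric] i) auto
  finally show ?thesis by (simp add: add_ac)
qed

text \<open>The rectangle formula with its horizontal sides pushed to infinity, where the kernel
  extinguishes them. It makes the position of the line a free parameter, at the price of a finite
  sum.\<close>

lemma vline_diff:
  fixes w :: complex
  assumes ab: "1/2 \<le> a" "a < b" and ca: "cos (2 * pi * a) \<le> 0" and cb: "cos (2 * pi * b) \<le> 0"
  shows "vline b w - vline a w = 2 * pi * (\<Sum>n | a < real n \<and> real n < b. w * of_nat n powr (w - 1))"
    (is "_ = ?R")
proof -
  define V where "V = (\<lambda>c Y. integral {0..Y} (\<lambda>y. jint w (Complex c y) + jint w (Complex c (- y))))"
  define H where "H = (\<lambda>y. contour_integral (linepath (Complex a y) (Complex b y)) (jint w))"
  have cl: "jint w contour_integrable_on linepath (Complex a y) (Complex b y)"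
    and Hb: "norm (H y) \<le> jbound (norm w) b * exp (- \<bar>y\<bar>) * (b - a)" if y: "\<bar>y\<bar> \<ge> 1" for y
  proof -
    have im: "z \<in> closed_segment (Complex a y) (Complex b y) \<longleftrightarrow> Im z = y \<and> Re z \<in> {a..b}" for z
      using closed_segment_same_Im[of "Complex a y" "Complex b y"] ab
      by (auto simp: closed_segment_eq_real_ivl)
    have "continuous_on (closed_segment (Complex a y) (Complex b y)) (jint w)"
    proof (rule holomorphic_on_imp_continuous_on)
      show "jint w holomorphic_on closed_segment (Complex a y) (Complex b y)"
        unfolding jint_def using ab y
        by (intro holomorphic_intros) (auto simp: im complex_nonpos_Reals_iff elim!: Ints_cases)
    qed
    thus c: "jint w contour_integrable_on linepath (Complex a y) (Complex b y)"
      by (rule contour_integrable_continuous_linepath)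
    have "norm (H y) \<le> jbound (norm w) b * exp (- \<bar>y\<bar>) * norm (Complex b y - Complex a y)"
      unfolding H_def
    proof (rule contour_integral_bound_linepath[OF c])
      show "0 \<le> jbound (norm w) b * exp (- \<bar>y\<bar>)" by (auto simp: jbound_def)
      fix z assume "z \<in> closed_segment (Complex a y) (Complex b y)"
      hence "z = Complex (Re z) y" "Re z \<in> {a..b}" using im[of z] by (auto simp: complex_eq_iff)
      thus "norm (jint w z) \<le> jbound (norm w) b * exp (- \<bar>y\<bar>)"
        using norm_jint_le[of "Re z" b w "norm w" y] ab y by auto
    qed
    also have "Complex b y - Complex a y = of_real (b - a)" by (simp add: complex_eq_iff)
    finally show "norm (H y) \<le> jbound (norm w) b * exp (- \<bar>y\<bar>) * (b - a)"
      using ab by (simp del: of_real_diff)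
  qed
  have eq: "H (- real n) + \<i> * V b (real n) - H (real n) - \<i> * V a (real n) = \<i> * ?R" if n: "n \<ge> 1" for n
  proof -
    let ?Y = "real n"
    have "a > 0" using ab by simp
    have vl: "jint w contour_integrable_on linepath (Complex c (-?Y)) (Complex c ?Y)"
      if "c \<in> {a, b}" for c
    proof (rule contour_integrable_continuous_linepath, rule holomorphic_on_imp_continuous_on)
      have *: "cos (2 * pi * c) \<le> 0" "c > 0" using that ca cb ab by auto
      have "z = Complex c (Im z)" if "z \<in> closed_segment (Complex c (-?Y)) (Complex c ?Y)" for z
        using that closed_segment_same_Re[of "Complex c (-?Y)" "Complex c ?Y"] by (auto simp: complex_eq_iff)
      hence "z \<notin> \<int>" "Re z > 0" if "z \<in> closed_segment (Complex c (-?Y)) (Complex c ?Y)" for z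
        using that cos_2pi_nonpos_not_Ints[OF *(1)] *(2) by (metis, metis complex.sel(1))
      thus "jint w holomorphic_on closed_segment (Complex c (-?Y)) (Complex c ?Y)"
        unfolding jint_def
        by (intro holomorphic_intros) (auto simp: complex_nonpos_Reals_iff, smt (verit))
    qed
    have "contour_integral (rectpath (Complex a (-?Y)) (Complex b ?Y)) (jint w) =
            contour_integral (linepath (Complex a (-?Y)) (Complex b (-?Y))) (jint w) +
            (contour_integral (linepath (Complex b (-?Y)) (Complex b ?Y)) (jint w) +
            (contour_integral (linepath (Complex b ?Y) (Complex a ?Y)) (jint w) +
             contour_integral (linepath (Complex a ?Y) (Complex a (-?Y))) (jint w)))"
      unfolding rectpath_def Let_def
      using cl[of "-?Y"] cl[of ?Y] vl[of a] vl[of b] n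
      by (simp add: contour_integral_join contour_integrable_joinI valid_path_join
           contour_integrable_reversepath_eq[of "linepath (Complex b ?Y) (Complex a ?Y)", symmetric]
           contour_integrable_reversepath_eq[of "linepath (Complex a ?Y) (Complex a (-?Y))", symmetric])
    also have "contour_integral (linepath (Complex b ?Y) (Complex a ?Y)) (jint w) = - H ?Y"
      unfolding H_def using contour_integral_reversepath[of "linepath (Complex a ?Y) (Complex b ?Y)" "jint w"] by simp
    also have "contour_integral (linepath (Complex a ?Y) (Complex a (-?Y))) (jint w) = - (\<i> * V a ?Y)"
      unfolding V_def
      using contour_integral_reversepath[of "linepath (Complex a (-?Y)) (Complex a ?Y)" "jint w"]
        contour_integral_vline[of a ?Y w] n \<open>a > 0\<close> ca by simp
    also have "contour_integral (linepath (Complex b (-?Y)) (Complex b ?Y)) (jint w) = \<i> * V b ?Y"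
      unfolding V_def using contour_integral_vline[of b ?Y w] n ab cb by simp
    also have "contour_integral (rectpath (Complex a (-?Y)) (Complex b ?Y)) (jint w) = \<i> * ?R"
      using contour_integral_rect_jint[OF \<open>a > 0\<close> ab(2) ca cb, of ?Y w] n by simp
    finally show ?thesis by (simp add: H_def)
  qed
  have H0: "(\<lambda>n. H (real n)) \<longlonglongrightarrow> 0" "(\<lambda>n. H (- real n)) \<longlonglongrightarrow> 0"
  proof -
    have lim: "(\<lambda>n. jbound (norm w) b * exp (- real n) * (b - a)) \<longlonglongrightarrow> jbound (norm w) b * 0 * (b - a)"
      by (intro tendsto_intros filterlim_compose[OF exp_at_bot] filterlim_compose[OF filterlim_uminus_at_bot_at_top]
            filterlim_real_sequentially)
    have "\<forall>\<^sub>F n in sequentially. norm (H (real n)) \<le> jbound (norm w) b * exp (- real n) * (b - a)"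
      using eventually_ge_at_top[of 1] by eventually_elim (use Hb[of "real _"] in auto)
    thus "(\<lambda>n. H (real n)) \<longlonglongrightarrow> 0" by (rule Lim_null_comparison) (use lim in simp)
    have "\<forall>\<^sub>F n in sequentially. norm (H (- real n)) \<le> jbound (norm w) b * exp (- real n) * (b - a)"
      using eventually_ge_at_top[of 1] by eventually_elim (use Hb[of "- real _"] in auto)
    thus "(\<lambda>n. H (- real n)) \<longlonglongrightarrow> 0" by (rule Lim_null_comparison) (use lim in simp)
  qed
  have "(\<lambda>n. H (- real n) + \<i> * V b (real n) - H (real n) - \<i> * V a (real n))
           \<longlonglongrightarrow> 0 + \<i> * vline b w - 0 - \<i> * vline a w"
    unfolding V_def by (intro tendsto_intros H0 vline_props(1)) (use ab ca cb in auto)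
  moreover have "(\<lambda>n. H (- real n) + \<i> * V b (real n) - H (real n) - \<i> * V a (real n)) \<longlonglongrightarrow> \<i> * ?R"
    by (rule tendsto_eventually) (rule eventually_mono[OF eventually_ge_at_top[of 1] eq])
  ultimately have "0 + \<i> * vline b w - 0 - \<i> * vline a w = \<i> * ?R" by (rule LIMSEQ_unique)
  hence "\<i> * (vline b w - vline a w) = \<i> * ?R" by (simp add: algebra_simps)
  thus ?thesis by simp
qed

text \<open>The truncated integrals are entire by differentiation under the integral sign, and the
  tail bound is uniform on discs because it sees only a bound on the modulus of
  \<open>w\<close>.\<close>

lemma holomorphic_vline:
  assumes a: "1/2 \<le> a" "cos (2 * pi * a) \<le> 0"
  shows "vline a holomorphic_on UNIV"
proof (rule holomorphic_uniform_sequence)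
  define f where "f = (\<lambda>w y. jint w (Complex a y) + jint w (Complex a (- y)))"
  have neg: "of_real a + \<i> * of_real y \<notin> \<int>" "of_real a + \<i> * of_real y \<notin> \<real>\<^sub>\<le>\<^sub>0" "of_real a + \<i> * of_real y \<noteq> 0" for y
    using a cos_2pi_nonpos_not_Ints[OF a(2), of y]
    by (auto simp: complex_nonpos_Reals_iff Complex_eq complex_eq_iff)
  show "(\<lambda>w. integral (cbox 0 (real n)) (f w)) holomorphic_on UNIV" for n
  proof (rule leibniz_rule_holomorphic)
    show "((\<lambda>w. f w y) has_field_derivative
            Ln (Complex a y) * jint w (Complex a y) + Ln (Complex a (-y)) * jint w (Complex a (-y))) (at w within UNIV)" for w y
    proof -
      have 1: "((\<lambda>w. z powr w * c) has_field_derivative Ln z * (z powr w * c)) (at w)" if "z \<noteq> 0" for z c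
        using DERIV_cmult_right[OF has_field_derivative_powr_right[OF that, of w], of c] by (simp add: mult.assoc)
      have "((\<lambda>w. f w y) has_field_derivative
            Ln (Complex a y) * jint w (Complex a y) + Ln (Complex a (-y)) * jint w (Complex a (-y))) (at w)"
        unfolding f_def jint_def by (intro DERIV_add 1) (use a in \<open>auto simp: complex_eq_iff\<close>)
      thus ?thesis by (rule has_field_derivative_at_within)
    qed
    show "f w integrable_on cbox 0 (real n)" for w
      unfolding f_def box_real
    proof (intro integrable_continuous_real continuous_on_add continuous_on_jint)
      show "continuous_on {0..real n} (\<lambda>y. jint w (Complex a (- y)))"
        by (rule continuous_on_compose2[OF continuous_on_jint[OF _ a(2), of UNIV]])
           (use a in \<open>auto intro!: continuous_intros\<close>)
    qed (use a in auto)
    show "continuous_on (UNIV \<times> cbox 0 (real n))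
            (\<lambda>(w, y). Ln (Complex a y) * jint w (Complex a y) + Ln (Complex a (-y)) * jint w (Complex a (-y)))"
    proof -
      have cj: "continuous_on UNIV (\<lambda>y. jker (Complex a y))"
        unfolding jker_def Complex_eq using neg
        by (intro continuous_intros) (auto simp: sin_pi_complex_eq_0_iff)
      have cL: "continuous_on UNIV (\<lambda>y. Ln (Complex a y))"
        unfolding Complex_eq using neg by (intro continuous_on_Ln continuous_intros) auto
      have comp: "continuous_on (UNIV \<times> cbox 0 (real n)) (\<lambda>x :: complex \<times> real. h (e * snd x))"
        if "continuous_on UNIV h" for h :: "real \<Rightarrow> complex" and e
        by (rule continuous_on_compose2[OF that]) (auto intro!: continuous_on_mult continuous_on_const continuous_on_snd continuous_on_id)
      have "continuous_on (UNIV \<times> cbox 0 (real n)) (\<lambda>x.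
         Ln (Complex a (1 * snd x)) * (exp (fst x * Ln (Complex a (1 * snd x))) * jker (Complex a (1 * snd x))) +
         Ln (Complex a (-1 * snd x)) * (exp (fst x * Ln (Complex a (-1 * snd x))) * jker (Complex a (-1 * snd x))))"
        by (intro continuous_on_add continuous_on_mult continuous_on_exp continuous_on_fst continuous_on_id
              comp[OF cj] comp[OF cL])
      moreover have "jint w (Complex a y) = exp (w * Ln (Complex a y)) * jker (Complex a y)" for w y
      proof -
        have "Complex a y \<noteq> 0" using a by (auto simp: complex_eq_iff)
        thus ?thesis by (simp only: jint_def powr_def if_False)
      qed
      ultimately show ?thesis
        by (simp only: case_prod_unfold mult_1 mult_minus1)
    qed
  qed auto
  show "\<exists>d>0. cball w d \<subseteq> UNIV \<and>
         uniform_limit (cball w d) (\<lambda>n w. integral (cbox 0 (real n)) (f w)) (vline a) sequentially" for w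
  proof (intro exI[of _ 1] conjI)
    have lim: "(\<lambda>n. 2 * jbound (norm w + 1) a * exp (- real n)) \<longlonglongrightarrow> 2 * jbound (norm w + 1) a * 0"
      by (intro tendsto_intros filterlim_compose[OF exp_at_bot] filterlim_compose[OF filterlim_uminus_at_bot_at_top]
            filterlim_real_sequentially)
    show "uniform_limit (cball w 1) (\<lambda>n w. integral (cbox 0 (real n)) (f w)) (vline a) sequentially"
    proof (rule uniform_limitI)
      fix e :: real assume "e > 0"
      hence "\<forall>\<^sub>F n in sequentially. 2 * jbound (norm w + 1) a * exp (- real n) < e"
        using order_tendstoD(2)[OF lim] by simp
      thus "\<forall>\<^sub>F n in sequentially. \<forall>x\<in>cball w 1. dist (integral (cbox 0 (real n)) (f x)) (vline a x) < e"
      proof eventually_elim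
        case (elim n)
        show ?case
        proof
          fix x assume "x \<in> cball w 1"
          hence "norm x \<le> norm w + 1"
            using norm_triangle_ineq2[of x w] by (simp add: dist_norm norm_minus_commute)
          from vline_props(2)[OF a this, of n] elim
          show "dist (integral (cbox 0 (real n)) (f x)) (vline a x) < e"
            by (simp add: dist_norm norm_minus_commute f_def)
        qed
      qed
    qed
  qed auto
qed auto

section \<open>Jensen's integral as the continuation of the Dirichlet series\<close>

lemma cos_2pi_add_half: "cos (2 * pi * (real N + 1/2)) = -1"
proof -
  have "cos (2 * pi * (real N + 1/2)) = cos (pi + 2 * pi * real N)" by (simp add: algebra_simps)
  also have "\<dots> = -1" using cos_2npi[of N] sin_2npi[of N] by (simp add: cos_add mult_ac)
  finally show ?thesis .
qed

text \<open>On the line \<open>Re z = a\<close> the modulus of \<open>z\<close> is at least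
  \<open>a\<close>, so for negative \<open>Re w\<close> the power is at most
  \<open>a powr Re w\<close> up to a constant depending on \<open>Im w\<close>, while the kernel
  stays integrable uniformly in \<open>a\<close>.\<close>

lemma vline_tendsto_0:
  assumes w: "Re w < 0"
  shows "(\<lambda>N. vline (real N + 1/2) w) \<longlonglongrightarrow> 0"
proof (rule Lim_null_comparison)
  let ?c = "exp (\<bar>Im w\<bar> * pi) * (8 * pi ^ 2)"
  show "\<forall>\<^sub>F N in sequentially. norm (vline (real N + 1/2) w) \<le> ?c * (real N + 1/2) powr Re w"
  proof (intro always_eventually allI)
    fix N :: nat
    define a where "a = real N + 1/2"
    have a: "a \<ge> 1/2" by (simp add: a_def)
    have ca: "cos (2 * pi * a) \<le> 0" by (simp only: a_def cos_2pi_add_half)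
    have bd: "norm (jint w (Complex a y)) \<le> exp (\<bar>Im w\<bar> * pi) * (4 * pi ^ 2) * a powr Re w * exp (- \<bar>y\<bar>)" for y
    proof -
      let ?z = "Complex a y"
      have z: "?z \<noteq> 0" using a by (auto simp: complex_eq_iff)
      have na: "norm ?z \<ge> a" using abs_Re_le_cmod[of ?z] a by simp
      have "norm (?z powr w) = exp (Re w * ln (norm ?z) - Im w * Im (Ln ?z))"
        using z by (simp add: powr_def Re_Ln)
      also have "\<dots> \<le> exp (Re w * ln a + \<bar>Im w\<bar> * pi)"
      proof -
        have "Re w * ln (norm ?z) \<le> Re w * ln a"
          using w na a by (intro mult_left_mono_neg ln_mono) auto
        moreover have "\<bar>Im w * Im (Ln ?z)\<bar> \<le> \<bar>Im w\<bar> * pi"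
          unfolding abs_mult using Im_Ln_le_pi[OF z] mpi_less_Im_Ln[OF z] by (intro mult_left_mono) auto
        ultimately show ?thesis by simp
      qed
      also have "\<dots> = a powr Re w * exp (\<bar>Im w\<bar> * pi)" using a by (simp add: powr_def exp_add)
      finally have 1: "norm (?z powr w) \<le> a powr Re w * exp (\<bar>Im w\<bar> * pi)" .
      have "norm (jker ?z) \<le> 4 * pi ^ 2 * exp (- (2 * pi * \<bar>y\<bar>))" by (rule norm_jker_le_vertical[OF ca])
      also have "\<dots> \<le> 4 * pi ^ 2 * exp (- \<bar>y\<bar>)"
        using pi_gt3 mult_right_mono[of 1 "2 * pi" "\<bar>y\<bar>"] by (intro mult_left_mono) auto
      finally have 2: "norm (jker ?z) \<le> 4 * pi ^ 2 * exp (- \<bar>y\<bar>)" .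
      have "norm (jint w ?z) \<le> (a powr Re w * exp (\<bar>Im w\<bar> * pi)) * (4 * pi ^ 2 * exp (- \<bar>y\<bar>))"
        unfolding jint_def norm_mult by (intro mult_mono 1 2) auto
      thus ?thesis by (simp add: mult_ac)
    qed
    have "norm (vline a w) \<le> ?c * a powr Re w / 1"
      unfolding vline_def
    proof (rule integral_exp_bound_atLeast_0(2))
      have "continuous_on {0..} (\<lambda>y. jint w (Complex a (- y)))"
        by (rule continuous_on_compose2[OF continuous_on_jint[OF _ ca, of UNIV]])
           (use a in \<open>auto intro!: continuous_intros\<close>)
      thus "continuous_on {0..} (\<lambda>y. jint w (Complex a y) + jint w (Complex a (- y)))"
        by (intro continuous_on_add continuous_on_jint) (use a ca in auto)
      show "norm (jint w (Complex a y) + jint w (Complex a (- y))) \<le> ?c * a powr Re w * exp (- 1 * y)" if "y \<ge> 0" for y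
        using norm_triangle_ineq[of "jint w (Complex a y)" "jint w (Complex a (- y))"] bd[of y] bd[of "-y"] that
        by auto
    qed auto
    thus "norm (vline (real N + 1/2) w) \<le> ?c * (real N + 1/2) powr Re w" by (simp add: a_def)
  qed
  have "filterlim (\<lambda>N. real N + 1/2) at_top sequentially"
    by (rule filterlim_at_top_mono[OF filterlim_real_sequentially]) auto
  hence "(\<lambda>N. (real N + 1/2) powr Re w) \<longlonglongrightarrow> 0" using w by (rule tendsto_neg_powr[rotated])
  thus "(\<lambda>N. ?c * (real N + 1/2) powr Re w) \<longlonglongrightarrow> 0"
    using tendsto_mult_right_zero by blast
qed

text \<open>Moving the line from 1/2 to \<open>N + 1/2\<close> collects the first \<open>N\<close>
  terms; for \<open>Re s > 1\<close> the line integral left over tends to 0.\<close>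

lemma dirichlet_series_sums_vline:
  fixes s :: complex
  assumes s: "Re s > 1"
  shows "(\<lambda>n. 1 / of_nat (Suc n) powr s) sums (vline (1/2) (1 - s) / (2 * pi * (s - 1)))"
proof -
  have s1: "s \<noteq> 1" using s by auto
  have eq: "(\<Sum>n<N. 1 / of_nat (Suc n) powr s) = (vline (1/2) (1 - s) - vline (real N + 1/2) (1 - s)) / (2 * pi * (s - 1))" for N
  proof (cases "N = 0")
    case False
    have set: "{n. 1/2 < real n \<and> real n < real N + 1/2} = Suc ` {..<N}"
    proof -
      have "1/2 < real n \<and> real n < real N + 1/2 \<longleftrightarrow> n \<in> {1..N}" for n by (auto; linarith)
      thus ?thesis unfolding image_Suc_lessThan by blast
    qed
    have "vline (real N + 1/2) (1 - s) - vline (1/2) (1 - s) =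
            2 * pi * (\<Sum>n\<in>Suc ` {..<N}. (1 - s) * of_nat n powr (1 - s - 1))"
      unfolding set[symmetric]
    proof (rule vline_diff)
      show "cos (2 * pi * (real N + 1/2)) \<le> 0" by (simp only: cos_2pi_add_half)
    qed (use False in auto)
    also have "(\<Sum>n\<in>Suc ` {..<N}. (1 - s) * of_nat n powr (1 - s - 1)) = (1 - s) * (\<Sum>n<N. 1 / of_nat (Suc n) powr s)"
    proof -
      have "(\<Sum>n\<in>Suc ` {..<N}. (1 - s) * of_nat n powr (1 - s - 1)) = (\<Sum>n<N. (1 - s) * of_nat (Suc n) powr (- s))"
        by (subst sum.reindex) (auto simp: o_def)
      also have "\<dots> = (\<Sum>n<N. (1 - s) * (1 / of_nat (Suc n) powr s))"
        by (intro sum.cong refl arg_cong2[of _ _ _ _ "(*)"] powr_minus_divide)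
      finally show ?thesis by (simp only: sum_distrib_left)
    qed
    finally have "vline (1/2) (1 - s) - vline (real N + 1/2) (1 - s) = (\<Sum>n<N. 1 / of_nat (Suc n) powr s) * (2 * pi * (s - 1))"
      by (simp add: algebra_simps)
    thus ?thesis using s1 by (subst eq_divide_eq) auto
  qed simp
  have "(\<lambda>N. (vline (1/2) (1 - s) - vline (real N + 1/2) (1 - s)) / (2 * pi * (s - 1)))
          \<longlonglongrightarrow> (vline (1/2) (1 - s) - 0) / (2 * pi * (s - 1))"
    by (intro tendsto_intros vline_tendsto_0) (use s s1 in auto)
  thus ?thesis unfolding sums_def eq by simp
qed

text \<open>As \<open>zeta\<close> is a choice, its defining properties are available only once some
  function has them; Jensen's integral is that witness.\<close>

lemma zeta_spec: "zeta holomorphic_on - {1}" "Re s > 1 \<Longrightarrow> (\<lambda>n. 1 / of_nat (Suc n) powr s) sums zeta s"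
proof -
  let ?P = "\<lambda>f. f holomorphic_on (- {1}) \<and> (\<forall>s. Re s > 1 \<longrightarrow> (\<lambda>n. 1 / of_nat (Suc n) powr s) sums f s)"
  have "(\<lambda>s. vline (1/2) (1 - s)) holomorphic_on - {1}"
    by (rule holomorphic_on_compose_gen[OF _ holomorphic_vline[of "1/2"], unfolded o_def])
       (use cos_2pi_add_half[of 0] in \<open>auto intro!: holomorphic_intros\<close>)
  hence "?P (\<lambda>s. vline (1/2) (1 - s) / (2 * pi * (s - 1)))"
    using dirichlet_series_sums_vline by (auto intro!: holomorphic_intros)
  hence "?P zeta" unfolding zeta_def by (rule someI[of ?P])
  thus "zeta holomorphic_on - {1}" "Re s > 1 \<Longrightarrow> (\<lambda>n. 1 / of_nat (Suc n) powr s) sums zeta s" by auto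
qed

text \<open>This removes the freedom of the choice: both sides are holomorphic on the connected set
  \<open>- {1}\<close> and agree where the series converges.\<close>

lemma zeta_eq_vline_half:
  fixes s :: complex
  assumes s: "s \<noteq> 1"
  shows "2 * pi * (s - 1) * zeta s = vline (1/2) (1 - s)"
proof -
  have "2 * pi * (s - 1) * zeta s - vline (1/2) (1 - s) = 0"
  proof (rule analytic_continuation_open[where s = "{s. Re s > 1}" and s' = "- {1}" and
           f = "\<lambda>s :: complex. 2 * pi * (s - 1) * zeta s - vline (1/2) (1 - s)" and g = "\<lambda>_. 0"])
    have "(\<lambda>s. vline (1/2) (1 - s)) holomorphic_on - {1}"
      by (rule holomorphic_on_compose_gen[OF _ holomorphic_vline[of "1/2"], unfolded o_def])
         (use cos_2pi_add_half[of 0] in \<open>auto intro!: holomorphic_intros\<close>)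
    thus "(\<lambda>s. 2 * pi * (s - 1) * zeta s - vline (1/2) (1 - s)) holomorphic_on - {1}"
      by (intro holomorphic_intros zeta_spec)
    show "open {s. Re s > 1}" by (rule open_halfspace_Re_gt)
    show "connected (- {1 :: complex})" by (rule connected_punctured_universe) simp
    show "{s :: complex. Re s > 1} \<noteq> {}" by (auto intro!: exI[of _ 2])
    show "2 * pi * (s - 1) * zeta s - vline (1/2) (1 - s) = 0" if "s \<in> {s. Re s > 1}" for s :: complex
      using sums_unique2[OF zeta_spec(2) dirichlet_series_sums_vline, of s] that by auto
  qed (use s in auto)
  thus ?thesis by simp
qed

text \<open>Cutting the series at \<open>a\<close> leaves the line integral through
  \<open>a\<close>. With \<open>a\<close> near \<open>sqrt (t / (2 * pi))\<close> this integral will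
  produce a dual sum of about the same length.\<close>

lemma zeta_eq_vline:
  fixes s :: complex
  assumes s: "s \<noteq> 1" and a: "1/2 < a" "cos (2 * pi * a) \<le> 0"
  shows "2 * pi * (s - 1) * (zeta s - (\<Sum>n | 0 < n \<and> real n < a. of_nat n powr (- s))) = vline a (1 - s)"
proof -
  have "1/2 < real n \<longleftrightarrow> 0 < n" for n by (cases n) auto
  hence set: "{n. 1/2 < real n \<and> real n < a} = {n. 0 < n \<and> real n < a}"
    by auto
  have "vline a (1 - s) - vline (1/2) (1 - s) =
          2 * pi * (\<Sum>n | 0 < n \<and> real n < a. (1 - s) * of_nat n powr (1 - s - 1))"
    unfolding set[symmetric] using a cos_2pi_add_half[of 0] by (intro vline_diff) auto
  also have "\<dots> = - 2 * pi * (s - 1) * (\<Sum>n | 0 < n \<and> real n < a. of_nat n powr (- s))"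
    by (simp add: sum_distrib_left algebra_simps)
  finally have "vline a (1 - s) = vline (1/2) (1 - s) - 2 * pi * (s - 1) * (\<Sum>n | 0 < n \<and> real n < a. of_nat n powr (- s))"
    by (simp add: algebra_simps)
  thus ?thesis unfolding zeta_eq_vline_half[OF s, symmetric] by (simp add: right_diff_distrib)
qed

section \<open>The approximate functional equation\<close>

lemma arctan_le_self_of_nonneg: "arctan x \<le> x" if "x \<ge> 0" for x :: real
proof -
  have "0 - arctan 0 \<le> x - arctan x"
  proof (rule DERIV_nonneg_imp_nondecreasing[OF that])
    fix u :: real
    have "((\<lambda>x. x - arctan x) has_real_derivative 1 - inverse (1 + u ^ 2)) (at u)"
      by (auto intro!: derivative_eq_intros)
    moreover have "1 - inverse (1 + u ^ 2) \<ge> 0"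
      by (simp add: inverse_le_1_iff)
    ultimately show "\<exists>y. ((\<lambda>x. x - arctan x) has_real_derivative y) (at u) \<and> 0 \<le> y" by blast
  qed
  thus ?thesis by simp
qed

text \<open>The modulus contains \<open>exp (t * arg z)\<close>. Above the real axis the argument is
  at most \<open>y / a\<close>, which gives growth at rate \<open>t / a\<close>; below it the
  argument is negative and the factor is at most 1. Because of this asymmetry the upper half-line
  carries the dual sum and the lower one only an error.\<close>

lemma norm_Complex_powr_le:
  fixes t :: real
  assumes a: "a > 0" and t: "t \<ge> 0" and y: "y \<ge> 0"
  shows "norm (Complex a y powr (1/2 - \<i> * t)) \<le> sqrt a * exp (y / (2 * a) + t * y / a)"
    and "norm (Complex a (- y) powr (1/2 - \<i> * t)) \<le> sqrt a * exp (y / (2 * a))"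
proof -
  have main: "norm (Complex a v powr (1/2 - \<i> * t)) \<le> sqrt a * exp (y / (2 * a) + b)"
    if v: "\<bar>v\<bar> = y" and b: "t * arctan (v / a) \<le> b" for v b
  proof -
    let ?z = "Complex a v"
    have z: "?z \<noteq> 0" using a by (simp add: complex_eq_iff)
    have im: "Im (Ln ?z) = arctan (v / a)" using a z by (subst Im_Ln_eq) auto
    have n: "norm ?z \<le> a * exp (y / a)"
    proof -
      have "norm ?z \<le> a + y" using cmod_le[of ?z] v a by simp
      also have "a + y = a * (1 + y / a)" using a by (simp add: field_simps)
      also have "\<dots> \<le> a * exp (y / a)" using a by (intro mult_left_mono exp_ge_add_one_self) auto
      finally show ?thesis .
    qed
    have "ln (norm ?z) \<le> ln (a * exp (y / a))" using n z by (intro ln_mono) auto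
    also have "\<dots> = ln a + y / a" using a by (simp add: ln_mult)
    finally have l: "ln (norm ?z) \<le> ln a + y / a" .
    have "norm (?z powr (1/2 - \<i> * t)) = exp (ln (norm ?z) / 2 + t * arctan (v / a))"
      using z by (simp add: powr_def Re_Ln im)
    also have "\<dots> \<le> exp ((ln a + y / a) / 2 + b)" using add_mono[OF divide_right_mono[OF l, of 2] b] by simp
    also have "\<dots> = sqrt a * exp (y / (2 * a) + b)"
      using a by (simp add: powr_half_sqrt[symmetric] powr_def exp_add[symmetric] add_divide_distrib)
    finally show ?thesis .
  qed
  have "arctan (y / a) \<le> y / a" using a y by (intro arctan_le_self_of_nonneg) auto
  hence "t * arctan (y / a) \<le> t * y / a" using mult_left_mono[OF _ t] by fastforce
  thus "norm (Complex a y powr (1/2 - \<i> * t)) \<le> sqrt a * exp (y / (2 * a) + t * y / a)"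
    using main[of y] y by simp
  have "t * arctan (- y / a) \<le> 0" using a y t by (intro mult_nonneg_nonpos) (auto simp: arctan_minus)
  thus "norm (Complex a (- y) powr (1/2 - \<i> * t)) \<le> sqrt a * exp (y / (2 * a))"
    using main[of "- y" 0] y by simp
qed

text \<open>A finite expansion with exact remainder: it is applied with
  \<open>q = exp (2 * pi * \<i> * z)\<close>, whose modulus reaches 1 on the real axis, where the
  infinite series diverges.\<close>

lemma sum_mult_geometric:
  fixes q :: "'a :: field"
  assumes "q \<noteq> 1"
  shows "q / (1 - q) ^ 2 = (\<Sum>k=1..K. of_nat k * q ^ k)
           + q ^ (K + 1) * (of_nat (K + 1) - of_nat K * q) / (1 - q) ^ 2"
proof (induction K)
  case (Suc K)
  have d: "(1 - q) ^ 2 \<noteq> 0" using assms by simp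
  have "of_nat (K + 1) - of_nat K * q = of_nat (K + 1) * (1 - q) ^ 2 + q * (of_nat (Suc K + 1) - of_nat (Suc K) * q)"
    by (simp add: algebra_simps power2_eq_square)
  hence "q ^ (K + 1) * (of_nat (K + 1) - of_nat K * q) / (1 - q) ^ 2 =
        (of_nat (K + 1) * q ^ (K + 1)) * (1 - q) ^ 2 / (1 - q) ^ 2 + q ^ (Suc K + 1) * (of_nat (Suc K + 1) - of_nat (Suc K) * q) / (1 - q) ^ 2"
    by (simp only: distrib_left add_divide_distrib power_add power_one_right power_Suc mult_ac Suc_eq_plus1)
  also have "(of_nat (K + 1) * q ^ (K + 1)) * (1 - q) ^ 2 / (1 - q) ^ 2 = of_nat (Suc K) * q ^ Suc K"
    using d by (subst nonzero_mult_div_cancel_right) auto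
  finally have "q ^ (K + 1) * (of_nat (K + 1) - of_nat K * q) / (1 - q) ^ 2 =
        of_nat (Suc K) * q ^ Suc K + q ^ (Suc K + 1) * (of_nat (Suc K + 1) - of_nat (Suc K) * q) / (1 - q) ^ 2" .
  thus ?case using Suc.IH by simp
qed simp

lemma jker_eq_exp:
  "jker z = - 4 * of_real pi ^ 2 * (exp (2 * pi * \<i> * z) / (1 - exp (2 * pi * \<i> * z)) ^ 2)"
proof -
  let ?e = "exp (\<i> * (of_real pi * z))"
  have q: "exp (2 * pi * \<i> * z) = ?e ^ 2"
    by (simp add: exp_double[symmetric] power2_eq_square exp_add[symmetric] mult_ac)
  have e0: "?e \<noteq> 0" by simp
  have "sin (of_real pi * z) ^ 2 = ((?e - inverse ?e) / (2 * \<i>)) ^ 2"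
    by (simp add: sin_exp_eq exp_minus)
  also have "\<dots> = - (1/4) * (?e - inverse ?e) ^ 2" by (simp add: power_divide power_mult_distrib)
  also have "(?e - inverse ?e) ^ 2 = (1 - ?e ^ 2) ^ 2 / ?e ^ 2"
    using e0 by (simp add: field_simps power2_eq_square)
  finally have s: "sin (of_real pi * z) ^ 2 = - (1/4) * ((1 - ?e ^ 2) ^ 2 / ?e ^ 2)" .
  show ?thesis unfolding jker_def q s by (simp add: divide_simps)
qed

text \<open>The phase \<open>c * x - t * ln x\<close> has derivative
  \<open>- (t - c * x) / x\<close>, and \<open>c * a < t\<close> places its stationary point beyond
  \<open>a\<close>. One integration by parts then bounds the integral by twice its boundary term at
  \<open>a\<close>.\<close>

lemma powr_times_exp_primitive_bound:
  fixes t :: real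
  assumes c: "c \<ge> 0" and t: "t > 0" and a: "a > 0" and ca: "c * a < t"
  defines "m \<equiv> \<lambda>x :: real. of_real x powr (1/2 - \<i> * t) * exp (\<i> * c * x)"
  shows "norm (integral {0..a} m) \<le> 2 * (a * sqrt a / (t - c * a))"
proof -
  have cpow: "continuous_on {0..a} (\<lambda>x. of_real x powr (1/2 - \<i> * t) :: complex)"
    unfolding continuous_on_def
  proof
    fix x :: real assume x: "x \<in> {0..a}"
    show "((\<lambda>x. of_real x powr (1/2 - \<i> * t) :: complex) \<longlongrightarrow> of_real x powr (1/2 - \<i> * t)) (at x within {0..a})"
    proof (cases "x = 0")
      case True
      \<comment> \<open>At 0 the value of \<open>powr\<close> is 0 by convention, which is also the
        limit, since the modulus is \<open>sqrt x\<close>.\<close>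
      have "((\<lambda>x. of_real x powr (1/2 - \<i> * t) :: complex) \<longlongrightarrow> 0) (at 0 within {0..a})"
      proof (rule Lim_null_comparison)
        show "\<forall>\<^sub>F x in at 0 within {0..a}. norm (of_real x powr (1/2 - \<i> * t) :: complex) \<le> sqrt x"
          by (auto simp: eventually_at_filter norm_powr_real_powr powr_half_sqrt intro!: always_eventually)
        have "(sqrt \<longlongrightarrow> sqrt 0) (at 0 within {0..a})" by (intro tendsto_intros)
        thus "(sqrt \<longlongrightarrow> 0) (at 0 within {0..a})" by simp
      qed
      thus ?thesis using True by simp
    next
      case False
      with x have "complex_of_real x \<notin> \<real>\<^sub>\<le>\<^sub>0" by auto
      thus ?thesis by (intro tendsto_intros) auto
    qed
  qed
  have cm: "continuous_on {0..a} m" unfolding m_def by (intro continuous_intros cpow)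
  have pos: "t - c * x > 0" if "x \<le> a" for x
    using that ca mult_left_mono[OF that c] by linarith
  define G where "G = (\<lambda>x. x * sqrt x / (t - c * x))"
  \<comment> \<open>the boundary term of an integration by parts; the remaining integrand has norm exactly \<open>G'\<close>\<close>
  define \<Phi> where "\<Phi> = (\<lambda>x. \<i> * of_real (x / (t - c * x)) * m x)"
  define F where "F = (\<lambda>x. integral {0..x} m - \<Phi> x)"
  have normm: "norm (m x) = sqrt x" if "x \<ge> 0" for x
    using that by (simp add: m_def norm_mult norm_powr_real_powr powr_half_sqrt)
  have "norm (F a - F 0) \<le> G a - G 0"
  proof (rule differentiable_bound_general[OF a])
    show "continuous_on {0..a} F"
      unfolding F_def \<Phi>_def
      by (intro continuous_intros cm indefinite_integral_continuous_1 integrable_continuous_real)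
         (use pos in force)
    show "continuous_on {0..a} G"
      unfolding G_def by (intro continuous_intros) (use pos in force)
    fix x assume x: "0 < x" "x < a"
    define D where "D = t - c * x"
    have D: "D > 0" using pos[of x] x by (simp add: D_def)
    show "(G has_vector_derivative sqrt x * ((1/2) / D + t / D ^ 2)) (at x)"
    proof -
      have "((\<lambda>x. (x * sqrt x) / (t - c * x)) has_real_derivative
          ((1 * sqrt x + (inverse (sqrt x) / 2) * x) * (t - c * x) - (x * sqrt x) * (0 - c * 1)) / ((t - c * x) * (t - c * x))) (at x)"
        using x D unfolding D_def
        by (intro DERIV_divide DERIV_mult DERIV_ident DERIV_real_sqrt DERIV_diff DERIV_const DERIV_cmult) auto
      also have "((1 * sqrt x + (inverse (sqrt x) / 2) * x) * (t - c * x) - (x * sqrt x) * (0 - c * 1)) / ((t - c * x) * (t - c * x))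
          = sqrt x * ((1/2) / D + t / D ^ 2)"
      proof -
        have h: "(inverse (sqrt x) / 2) * x = sqrt x / 2" using x by (simp add: field_simps)
        have num: "(1 * sqrt x + (inverse (sqrt x) / 2) * x) * (t - c * x) - (x * sqrt x) * (0 - c * 1) = sqrt x * (D / 2 + t)"
          unfolding h D_def by (simp add: ring_distribs diff_divide_distrib mult_ac)
        show ?thesis unfolding num unfolding D_def[symmetric] using D by (simp add: field_simps power2_eq_square)
      qed
      finally show ?thesis by (simp add: has_real_derivative_iff_has_vector_derivative G_def)
    qed
    have dI: "((\<lambda>x. integral {0..x} m) has_vector_derivative m x) (at x)"
    proof -
      have "((\<lambda>x. integral {0..x} m) has_vector_derivative m x) (at x within {0..a})"
        using x by (intro integral_has_vector_derivative cm) auto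
      thus ?thesis using at_within_Icc_at[of 0 x a] x by simp
    qed
    have dm: "(m has_vector_derivative m x * ((1/2 - \<i> * t) / x + \<i> * c)) (at x)"
    proof -
      have nx: "complex_of_real x \<notin> \<real>\<^sub>\<le>\<^sub>0" "complex_of_real x \<noteq> 0" using x by auto
      have e: "((\<lambda>z. exp (\<i> * c * z)) has_field_derivative exp (\<i> * c * x) * (\<i> * c)) (at (of_real x))"
        by (auto intro!: derivative_eq_intros)
      have "((\<lambda>z. z powr (1/2 - \<i> * t) * exp (\<i> * c * z)) has_field_derivative
              (1/2 - \<i> * t) * of_real x powr (1/2 - \<i> * t - 1) * exp (\<i> * c * x) +
              (exp (\<i> * c * x) * (\<i> * c)) * of_real x powr (1/2 - \<i> * t)) (at (of_real x))"
        by (intro DERIV_mult has_field_derivative_powr e nx)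
      also have "of_real x powr (1/2 - \<i> * t - 1) = of_real x powr (1/2 - \<i> * t) / of_real x"
        using powr_diff[of "of_real x" "1/2 - \<i> * t" 1] nx by simp
      also have "(1/2 - \<i> * t) * (of_real x powr (1/2 - \<i> * t) / of_real x) * exp (\<i> * c * x) +
              (exp (\<i> * c * x) * (\<i> * c)) * of_real x powr (1/2 - \<i> * t) = m x * ((1/2 - \<i> * t) / x + \<i> * c)"
        by (simp add: m_def ring_distribs mult_ac)
      finally have "((\<lambda>z. z powr (1/2 - \<i> * t) * exp (\<i> * c * z)) has_field_derivative
              m x * ((1/2 - \<i> * t) / x + \<i> * c)) (at (of_real x))" .
      thus ?thesis unfolding m_def by (rule has_vector_derivative_real_field)
    qed
    have dr: "((\<lambda>x. complex_of_real (x / (t - c * x))) has_vector_derivative of_real (t / D ^ 2)) (at x)"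
    proof -
      have "((\<lambda>x. x / (t - c * x)) has_real_derivative t / D ^ 2) (at x)"
        using D unfolding D_def by (auto intro!: derivative_eq_intros simp: field_simps power2_eq_square)
      thus ?thesis by (intro has_vector_derivative_of_real) (simp add: has_real_derivative_iff_has_vector_derivative)
    qed
    have "(\<Phi> has_vector_derivative
            \<i> * (of_real (x / (t - c * x)) * (m x * ((1/2 - \<i> * t) / x + \<i> * c)) + of_real (t / D ^ 2) * m x)) (at x)"
      unfolding \<Phi>_def mult.assoc
      by (intro has_vector_derivative_mult_right has_vector_derivative_mult dr dm)
    also have "\<i> * (of_real (x / (t - c * x)) * (m x * ((1/2 - \<i> * t) / x + \<i> * c)) + of_real (t / D ^ 2) * m x)
          = m x + \<i> * m x * of_real ((1/2) / D + t / D ^ 2)"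
    proof -
      have "of_real (x / (t - c * x)) * ((1/2 - \<i> * t) / x + \<i> * c) = (1/2 - \<i> * D) / D"
      proof -
        have "(1/2 - \<i> * t) / x + \<i> * c = (1/2 - \<i> * D) / x" using x by (simp add: D_def field_simps)
        moreover have "complex_of_real (x / (t - c * x)) = of_real x / of_real D" by (simp add: D_def)
        ultimately show ?thesis using x D by simp
      qed
      also have "\<dots> = (1/2) / D - \<i>" using D by (simp add: field_simps)
      finally have 1: "of_real (x / (t - c * x)) * ((1/2 - \<i> * t) / x + \<i> * c) = of_real ((1/2) / D) - \<i>" .
      have "\<i> * (of_real (x / (t - c * x)) * (m x * ((1/2 - \<i> * t) / x + \<i> * c)) + of_real (t / D ^ 2) * m x) =
          \<i> * m x * ((of_real (x / (t - c * x)) * ((1/2 - \<i> * t) / x + \<i> * c)) + of_real (t / D ^ 2))"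
        by (simp only: ring_distribs mult_ac)
      also have "\<dots> = m x + \<i> * m x * of_real ((1/2) / D + t / D ^ 2)"
        unfolding 1 by (simp add: algebra_simps)
      finally show ?thesis .
    qed
    finally show "(F has_vector_derivative - (\<i> * m x * of_real ((1/2) / D + t / D ^ 2))) (at x)"
      unfolding F_def using has_vector_derivative_diff[OF dI] by fastforce
    show "norm (- (\<i> * m x * of_real ((1/2) / D + t / D ^ 2))) \<le> sqrt x * ((1/2) / D + t / D ^ 2)"
    proof -
      have "(1/2) / D + t / D ^ 2 \<ge> 0" using D t by simp
      thus ?thesis using x by (simp only: norm_minus_cancel norm_mult normm norm_of_real) auto
    qed
  qed
  moreover have "F 0 = 0" by (simp add: F_def \<Phi>_def)
  moreover have "norm (\<Phi> a) = G a"
    using a ca by (simp add: \<Phi>_def G_def norm_mult normm norm_divide abs_of_pos flip: of_real_diff of_real_mult)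
  moreover have "norm (integral {0..a} m) \<le> norm (F a) + norm (\<Phi> a)"
    using norm_triangle_ineq[of "F a" "\<Phi> a"] by (simp add: F_def)
  ultimately show ?thesis by (simp add: G_def)
qed

section \<open>Gamma integrals for the main terms of the kernel\<close>

lemma norm_powr_half_le:
  fixes t :: real
  assumes t: "t \<ge> 0"
  shows "norm (z powr (1/2 - \<i> * t)) \<le> sqrt (norm z) * exp (t * pi)"
proof (cases "z = 0")
  case False
  have "norm (z powr (1/2 - \<i> * t)) = exp (ln (norm z) / 2 + t * Im (Ln z))"
    using False by (simp add: powr_def Re_Ln)
  also have "\<dots> \<le> exp (ln (norm z) / 2 + t * pi)"
    using t Im_Ln_le_pi[OF False] by (simp add: mult_left_mono)
  also have "\<dots> = sqrt (norm z) * exp (t * pi)"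
    using False by (simp add: powr_half_sqrt[symmetric] powr_def exp_add)
  finally show ?thesis .
qed simp

text \<open>The origin and the imaginary axis are included because the contour for the Gamma
  integral starts at 0 and runs up that axis.\<close>

lemma continuous_on_powr_right_half_plane:
  assumes t: "(t :: real) > 0"
  shows "continuous_on {z. Re z \<ge> 0} (\<lambda>z. z powr (1/2 - \<i> * t))"
  unfolding continuous_on_def
proof
  fix z :: complex assume z: "z \<in> {z. Re z \<ge> 0}"
  show "((\<lambda>z. z powr (1/2 - \<i> * t)) \<longlongrightarrow> z powr (1/2 - \<i> * t)) (at z within {z. Re z \<ge> 0})"
  proof (cases "z = 0")
    case True
    have "((\<lambda>z. z powr (1/2 - \<i> * t)) \<longlongrightarrow> 0) (at 0 within {z. Re z \<ge> 0})"
    proof (rule Lim_null_comparison)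
      show "\<forall>\<^sub>F z in at 0 within {z. Re z \<ge> 0}. norm (z powr (1/2 - \<i> * t)) \<le> sqrt (norm z) * exp (t * pi)"
        using norm_powr_half_le[OF less_imp_le[OF t]] by (auto intro!: always_eventually)
      have "((\<lambda>z :: complex. sqrt (norm z) * exp (t * pi)) \<longlongrightarrow> sqrt (norm (0::complex)) * exp (t * pi)) (at 0 within {z. Re z \<ge> 0})"
        by (intro tendsto_intros)
      thus "((\<lambda>z :: complex. sqrt (norm z) * exp (t * pi)) \<longlongrightarrow> 0) (at 0 within {z. Re z \<ge> 0})" by simp
    qed
    thus ?thesis using True by simp
  next
    case False
    with z have "z \<notin> \<real>\<^sub>\<le>\<^sub>0" by (auto simp: complex_nonpos_Reals_iff complex_eq_iff)
    thus ?thesis by (intro tendsto_intros) auto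
  qed
qed

text \<open>On the imaginary axis \<open>exp (\<i> * c * z)\<close> becomes a real decaying
  exponential, so this is Euler's integral for Gamma after scaling by \<open>c\<close>; the power of
  \<open>\<i>\<close> supplies the first factor.\<close>

lemma integral_powr_times_exp_atLeast_0:
  fixes t :: real
  assumes c: "c > 0" and t: "t > 0"
  shows "((\<lambda>y. Complex 0 y powr (1/2 - \<i> * t) * exp (- of_real (c * y))) has_integral
           exp (\<i> * pi / 2 * (1/2 - \<i> * t)) * Gamma (3/2 - \<i> * t) * of_real c powr (- (3/2 - \<i> * t))) {0..}"
proof -
  define w where "w = 1/2 - \<i> * t"
  \<comment> \<open>The scaling is carried out for the Lebesgue integral over the whole line of the
    integrand extended by 0; afterwards the result is moved back to the half-line.\<close>
  define f where "f = (\<lambda>u. indicator {0<..} u *\<^sub>R (complex_of_real u powr w / of_real (exp u)))"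
  have w1: "w + 1 = 3/2 - \<i> * t" by (simp add: w_def)
  have G: "((\<lambda>u. complex_of_real u powr (w + 1 - 1) / of_real (exp u)) has_integral Gamma (w + 1)) {0<..}"
    by (rule Gamma_integral_complex') (simp add: w_def)
  have A: "(\<lambda>u. complex_of_real u powr (w + 1 - 1) / of_real (exp u)) absolutely_integrable_on {0<..}"
    by (rule absolutely_integrable_Gamma_integral') (simp add: w_def)
  have mf: "f \<in> borel_measurable borel" unfolding f_def by measurable
  have "integrable lebesgue f" using A by (simp add: set_integrable_def f_def)
  hence If: "integrable lborel f" using mf by (subst (asm) integrable_completion) auto
  have "integral\<^sup>L lborel f = Gamma (w + 1)"
  proof -
    have "(f has_integral integral\<^sup>L lborel f) UNIV" by (rule has_integral_integral_lborel[OF If])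
    moreover have "f = (\<lambda>u. if u \<in> {0<..} then complex_of_real u powr (w + 1 - 1) / of_real (exp u) else 0)"
      by (auto simp: f_def fun_eq_iff)
    ultimately have "((\<lambda>u. complex_of_real u powr (w + 1 - 1) / of_real (exp u)) has_integral integral\<^sup>L lborel f) {0<..}"
      by (simp only: has_integral_restrict_UNIV)
    thus ?thesis using G has_integral_unique by blast
  qed
  hence "Gamma (w + 1) = c *\<^sub>R integral\<^sup>L lborel (\<lambda>y. f (0 + c * y))"
    using lborel_integral_real_affine[of c f 0] c by simp
  hence "integral\<^sup>L lborel (\<lambda>y. f (0 + c * y)) = Gamma (w + 1) / c"
    using c by (simp add: scaleR_conv_of_real field_simps)
  moreover have "integrable lborel (\<lambda>y. f (0 + c * y))"
    using If c by (intro lborel_integrable_real_affine) auto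
  ultimately have "((\<lambda>y. f (0 + c * y)) has_integral Gamma (w + 1) / c) UNIV"
    using has_integral_integral_lborel by metis
  moreover have "f (0 + c * y) = (if y \<in> {0<..} then of_real (c * y) powr w / of_real (exp (c * y)) else 0)" for y
    using c by (auto simp: f_def zero_less_mult_iff)
  ultimately have "((\<lambda>y. of_real (c * y) powr w / of_real (exp (c * y))) has_integral Gamma (w + 1) / c) {0<..}"
    by (simp only: has_integral_restrict_UNIV)
  from has_integral_mult_right[OF this, of "exp (\<i> * pi / 2 * w) * of_real c powr (- w)"]
  have "((\<lambda>y. exp (\<i> * pi / 2 * w) * of_real c powr (- w) * (of_real (c * y) powr w / of_real (exp (c * y))))
          has_integral exp (\<i> * pi / 2 * w) * of_real c powr (- w) * (Gamma (w + 1) / c)) {0<..}" .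
  also have "exp (\<i> * pi / 2 * w) * of_real c powr (- w) * (Gamma (w + 1) / c) =
      exp (\<i> * pi / 2 * w) * Gamma (w + 1) * of_real c powr (- (w + 1))"
    using c by (simp add: powr_diff)
  finally have "((\<lambda>y. Complex 0 y powr w * exp (- of_real (c * y))) has_integral
      exp (\<i> * pi / 2 * w) * Gamma (w + 1) * of_real c powr (- (w + 1))) {0<..}"
  proof (rule has_integral_eq[rotated])
    fix y :: real assume y: "y \<in> {0<..}"
    have "Complex 0 y = \<i> * of_real y" by (simp add: complex_eq_iff)
    hence "Ln (Complex 0 y) = \<i> * pi / 2 + of_real (ln y)"
      using y Ln_times_of_real[of y "\<i>"] by (simp add: mult.commute Ln_of_real)
    moreover have "Complex 0 y \<noteq> 0" using y by (simp add: complex_eq_iff)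
    ultimately have 1: "Complex 0 y powr w = exp (\<i> * pi / 2 * w) * exp (w * of_real (ln y))"
      unfolding powr_def by (simp only: if_False exp_add[symmetric]) (simp add: algebra_simps)
    have 2: "of_real c powr (- w) * of_real (c * y) powr w = exp (w * of_real (ln y))"
      using y c by (simp add: powr_def ln_mult exp_add[symmetric] Ln_of_real algebra_simps flip: of_real_mult)
    have 3: "exp (- complex_of_real (c * y)) = 1 / of_real (exp (c * y))"
      by (simp only: exp_minus exp_of_real inverse_eq_divide)
    show "exp (\<i> * pi / 2 * w) * of_real c powr (- w) * (of_real (c * y) powr w / of_real (exp (c * y))) =
          Complex 0 y powr w * exp (- of_real (c * y))"
      unfolding 1 2[symmetric] 3 by (simp only: mult_ac times_divide_eq_right times_divide_eq_left mult_1)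
  qed
  hence "((\<lambda>y. Complex 0 y powr w * exp (- of_real (c * y))) has_integral
      exp (\<i> * pi / 2 * w) * Gamma (w + 1) * of_real c powr (- (w + 1))) {0..}"
    by (subst has_integral_spike_set_eq[of _ "{0<..}"]) (auto intro: negligible_subset[of "{0}"])
  thus ?thesis unfolding w1 by (simp add: w_def)
qed

text \<open>Cauchy's theorem in the half-strip over \<open>{0..a}\<close>: the line through
  \<open>a\<close> is exchanged for the imaginary axis, which gives the Gamma factor, and the real
  segment, which is an error controlled by \<open>powr_times_exp_primitive_bound\<close>.\<close>

lemma integral_powr_times_exp_shift:
  fixes t :: real
  assumes c: "c \<ge> 1" and t: "t > 0" and a: "a > 0"
  defines "m \<equiv> \<lambda>z. z powr (1/2 - \<i> * t) * exp (\<i> * c * z)"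
  shows "(\<lambda>y. m (Complex a y)) integrable_on {0..}"
    and "integral {0..} (\<lambda>y. m (Complex a y)) =
           exp (\<i> * pi / 2 * (1/2 - \<i> * t)) * Gamma (3/2 - \<i> * t) * of_real c powr (- (3/2 - \<i> * t))
             + \<i> * integral {0..a} (\<lambda>x. m (of_real x))"
proof -
  define S where "S = {z. Re z \<ge> 0}"
  have cont: "continuous_on S m"
    unfolding m_def S_def by (intro continuous_intros continuous_on_powr_right_half_plane t)
  have "S = {z. 0 \<le> Re z}" by (simp add: S_def)
  hence convS: "convex S" by (simp add: convex_halfspace_Re_ge)
  have intS: "interior S = {z. Re z > 0}" 
    unfolding S_def using interior_halfspace_ge[of "1 :: complex" 0] by (simp add: inner_complex_def)
  \<comment> \<open>The branch point and the imaginary axis lie on the boundary of \<open>S\<close>.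
    Holomorphy inside together with continuity up to the boundary yields a primitive on the closed
    half-plane, so the contour may pass through 0.\<close>
  obtain F where F: "\<And>z. z \<in> S \<Longrightarrow> (F has_field_derivative m z) (at z within S)"
  proof (rule holomorphic_convex_primitive[OF convS _ cont])
    show "m field_differentiable at z" if "z \<in> interior S - {}" for z
    proof -
      have "z \<notin> \<real>\<^sub>\<le>\<^sub>0" using that by (auto simp: intS complex_nonpos_Reals_iff)
      moreover from this have "z \<noteq> 0" by auto
      ultimately show ?thesis unfolding m_def field_differentiable_def
        by (intro exI) (auto intro!: derivative_eq_intros)
    qed
  qed auto
  have seg: "(m has_contour_integral F v - F u) (linepath u v)" if "u \<in> S" "v \<in> S" for u v
  proof -
    have "closed_segment u v \<subseteq> S" using that convS by (simp add: closed_segment_subset)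
    thus ?thesis using contour_integral_primitive[of S F m "linepath u v"] F by simp
  qed
  define B where "B = exp (t * pi + a / 2)"
  have nm: "norm (m z) \<le> B * exp (- (1/2) * Im z)" if "0 \<le> Re z" "Re z \<le> a" "Im z \<ge> 0" for z
  proof -
    have nz: "norm z \<le> a + Im z" using cmod_le[of z] that by simp
    have "sqrt (norm z) \<le> exp (norm z / 2)"
    proof (rule real_le_lsqrt)
      have "norm z \<le> exp (norm z)" using exp_ge_add_one_self[of "norm z"] by linarith
      thus "norm z \<le> (exp (norm z / 2))\<^sup>2" by (simp flip: exp_double)
    qed auto
    also have "\<dots> \<le> exp ((a + Im z) / 2)" using nz by simp
    finally have s: "sqrt (norm z) \<le> exp ((a + Im z) / 2)" .
    have "norm (m z) = norm (z powr (1/2 - \<i> * t)) * exp (- c * Im z)"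
      by (simp add: m_def norm_mult)
    also have "\<dots> \<le> (exp ((a + Im z) / 2) * exp (t * pi)) * exp (- 1 * Im z)"
      using norm_powr_half_le[of t z] s t c that
      by (intro mult_mono order_trans[OF norm_powr_half_le] mult_right_mono) (use mult_right_mono[of 1 c "Im z"] in auto)
    also have "\<dots> = B * exp (- (1/2) * Im z)"
      by (simp add: B_def exp_add[symmetric] add_divide_distrib)
    finally show ?thesis .
  qed
  have cV: "continuous_on {0..} (\<lambda>y. m (Complex b y))" if "b \<ge> 0" for b
    by (rule continuous_on_compose2[OF cont]) (use that in \<open>auto simp: S_def Complex_eq intro!: continuous_intros\<close>)
  note lims = integral_exp_bound_atLeast_0[OF cV, of _ "1/2" B]
  show "(\<lambda>y. m (Complex a y)) integrable_on {0..}"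
    by (rule lims(1)) (use a nm[of "Complex a _"] in auto)
  define V where "V = (\<lambda>b n. integral {0..real n} (\<lambda>y. m (Complex b y)))"
  have Va: "V a \<longlonglongrightarrow> integral {0..} (\<lambda>y. m (Complex a y))"
    unfolding V_def by (rule lims(3)) (use a nm[of "Complex a _"] in auto)
  have V0: "V 0 \<longlonglongrightarrow> integral {0..} (\<lambda>y. m (Complex 0 y))"
    unfolding V_def by (rule lims(3)) (use a nm[of "Complex 0 _"] in auto)
  have Vn: "\<i> * V b n = F (Complex b (real n)) - F (Complex b 0)" if "b \<ge> 0" "n \<ge> 1" for b n
  proof -
    have "\<i> * V b n = contour_integral (linepath (Complex b 0) (Complex b (real n))) m"
      unfolding V_def using that by (intro contour_integral_linepath_same_Re[symmetric]) auto
    also have "\<dots> = F (Complex b (real n)) - F (Complex b 0)"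
      using that by (intro contour_integral_unique seg) (auto simp: S_def)
    finally show ?thesis .
  qed
  define R where "R = integral {0..a} (\<lambda>x. m (of_real x))"
  have R: "R = F (Complex a 0) - F (Complex 0 0)"
  proof -
    have "contour_integral (linepath (of_real 0) (of_real a)) m = integral {0..a} (\<lambda>x. m (of_real x))"
      using a by (subst contour_integral_linepath_Reals_eq) auto
    moreover have "contour_integral (linepath (of_real 0) (of_real a)) m = F (of_real a) - F (of_real 0)"
      using a by (intro contour_integral_unique seg) (auto simp: S_def)
    ultimately show ?thesis by (simp add: R_def complex_of_real_def)
  qed
  have "(\<lambda>n. F (Complex a (real n)) - F (Complex 0 (real n))) \<longlonglongrightarrow> 0"
  proof (rule Lim_null_comparison[OF always_eventually], rule allI)
    fix n :: nat
    have "norm (F (Complex a (real n)) - F (Complex 0 (real n))) \<le>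
            (B * exp (- (1/2) * real n)) * norm (Complex a (real n) - Complex 0 (real n))"
    proof (rule has_contour_integral_bound_linepath[OF seg])
      fix z assume "z \<in> closed_segment (Complex 0 (real n)) (Complex a (real n))"
      hence "Im z = real n" "0 \<le> Re z" "Re z \<le> a"
        using closed_segment_same_Im[of "Complex 0 (real n)" "Complex a (real n)"] a
        by (auto simp: closed_segment_eq_real_ivl)
      thus "norm (m z) \<le> B * exp (- (1/2) * real n)" using nm[of z] by simp
    qed (use a in \<open>auto simp: S_def B_def\<close>)
    also have "Complex a (real n) - Complex 0 (real n) = of_real a" by (simp add: complex_eq_iff)
    finally show "norm (F (Complex a (real n)) - F (Complex 0 (real n))) \<le> (B * exp (- (1/2) * real n)) * a"
      using a by simp
  next
    have "(\<lambda>n. B * exp (- (1/2) * real n) * a) \<longlonglongrightarrow> B * 0 * a"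
      by (intro tendsto_intros filterlim_compose[OF exp_at_bot]
            filterlim_tendsto_neg_mult_at_bot[OF tendsto_const] filterlim_real_sequentially) auto
    thus "(\<lambda>n. B * exp (- (1/2) * real n) * a) \<longlonglongrightarrow> 0" by simp
  qed
  hence "(\<lambda>n. (F (Complex a (real n)) - F (Complex 0 (real n))) + \<i> * V 0 n - R) \<longlonglongrightarrow>
          0 + \<i> * integral {0..} (\<lambda>y. m (Complex 0 y)) - R"
    by (intro tendsto_intros V0)
  moreover have "\<forall>\<^sub>F n in sequentially. (F (Complex a (real n)) - F (Complex 0 (real n))) + \<i> * V 0 n - R = \<i> * V a n"
    using eventually_ge_at_top[of 1] by eventually_elim (use Vn[of a] Vn[of 0] a R in auto)
  ultimately have "(\<lambda>n. \<i> * V a n) \<longlonglongrightarrow> 0 + \<i> * integral {0..} (\<lambda>y. m (Complex 0 y)) - R"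
    by (rule Lim_transform_eventually)
  moreover have "(\<lambda>n. \<i> * V a n) \<longlonglongrightarrow> \<i> * integral {0..} (\<lambda>y. m (Complex a y))"
    by (intro tendsto_intros Va)
  ultimately have "\<i> * integral {0..} (\<lambda>y. m (Complex a y)) = 0 + \<i> * integral {0..} (\<lambda>y. m (Complex 0 y)) - R"
    using LIMSEQ_unique by blast
  hence "\<i> * integral {0..} (\<lambda>y. m (Complex a y)) = \<i> * (integral {0..} (\<lambda>y. m (Complex 0 y)) + \<i> * R)"
    by (simp add: algebra_simps)
  hence "integral {0..} (\<lambda>y. m (Complex a y)) = integral {0..} (\<lambda>y. m (Complex 0 y)) + \<i> * R" by simp
  moreover have "integral {0..} (\<lambda>y. m (Complex 0 y)) =
       exp (\<i> * pi / 2 * (1/2 - \<i> * t)) * Gamma (3/2 - \<i> * t) * of_real c powr (- (3/2 - \<i> * t))"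
  proof -
    have "\<i> * of_real c * Complex 0 y = - of_real (c * y)" for y by (simp add: complex_eq_iff)
    thus ?thesis using integral_unique[OF integral_powr_times_exp_atLeast_0[of c t]] c t
      unfolding m_def by simp
  qed
  ultimately show "integral {0..} (\<lambda>y. m (Complex a y)) =
           exp (\<i> * pi / 2 * (1/2 - \<i> * t)) * Gamma (3/2 - \<i> * t) * of_real c powr (- (3/2 - \<i> * t))
             + \<i> * integral {0..a} (\<lambda>x. m (of_real x))" by (simp add: R_def)
qed

text \<open>The true size is logarithmic, but a root is affordable: the sum gets multiplied by
  \<open>sqrt a * K\<close> and divided by \<open>t\<close>, where \<open>a * K = O(t)\<close> and
  \<open>K = O(sqrt t)\<close>.\<close>

lemma harmonic_sum_le_sqrt: "(\<Sum>k=1..K. 1 / real k) \<le> 2 * sqrt (real K)"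
proof (induction K)
  case (Suc K)
  have "1 / real (Suc K) \<le> 2 * (sqrt (real (Suc K)) - sqrt (real K))"
  proof -
    let ?u = "sqrt (real (Suc K))" and ?v = "sqrt (real K)"
    have uv: "?v \<le> ?u" "?u \<ge> 1" "?v \<ge> 0" by auto
    have "(?u - ?v) * (?u + ?v) = 1" by (simp add: algebra_simps)
    hence "?u - ?v = 1 / (?u + ?v)" using uv by (subst eq_divide_eq) auto
    also have "\<dots> \<ge> 1 / (2 * ?u)"
      by (rule divide_left_mono) (use uv in \<open>auto intro!: mult_pos_pos add_pos_nonneg simp del: of_nat_Suc\<close>)
    finally have "2 * (?u - ?v) \<ge> 1 / ?u" by simp
    moreover have "1 / real (Suc K) \<le> 1 / ?u"
    proof -
      have "?u * 1 \<le> ?u * ?u" using uv by (intro mult_left_mono) auto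
      hence "?u \<le> real (Suc K)" by simp
      thus ?thesis using uv by (intro divide_left_mono) auto
    qed
    ultimately show ?thesis by linarith
  qed
  thus ?case using Suc.IH by simp
qed simp

text \<open>The margin 1/8 gives \<open>x - k \<ge> (K + 1 - k) / 8\<close>; counting backwards
  leaves a harmonic sum.\<close>

lemma sum_inverse_gap_le:
  assumes "real K + 1/8 \<le> x"
  shows "(\<Sum>k=1..K. 1 / (x - real k)) \<le> 16 * sqrt (real K)"
proof -
  have "(\<Sum>k=1..K. 1 / (x - real k)) \<le> (\<Sum>k=1..K. 8 * (1 / real (K + 1 - k)))"
  proof (intro sum_mono)
    fix k assume k: "k \<in> {1..K}"
    hence "real (K + 1 - k) = real K + 1 - real k" by (simp add: of_nat_diff)
    hence 1: "real (K + 1 - k) / 8 \<le> x - real k" using assms k by auto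
    have "real (K + 1 - k) > 0" using k by auto
    hence "1 / (x - real k) \<le> 1 / (real (K + 1 - k) / 8)"
      using 1 by (intro divide_left_mono mult_pos_pos) linarith+
    thus "1 / (x - real k) \<le> 8 * (1 / real (K + 1 - k))" by simp
  qed
  also have "\<dots> = 8 * (\<Sum>k=1..K. 1 / real k)"
    by (subst (2) sum.atLeastAtMost_rev) (simp add: sum_distrib_left)
  also have "\<dots> \<le> 16 * sqrt (real K)" using harmonic_sum_le_sqrt[of K] by simp
  finally show ?thesis .
qed

text \<open>The factor \<open>2 * (2 * pi) powr (- w) * cos (pi * w / 2) * Gamma w\<close>,
  \<open>w = 1/2 - \<i> * t\<close>, of the functional equation, with the cosine replaced by its
  dominant exponential. This is what the Gamma integrals produce.\<close>

definition chi_main :: "real \<Rightarrow> complex" where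
  "chi_main t = exp (\<i> * pi / 2 * (1/2 - \<i> * t)) * Gamma (1/2 - \<i> * t) * of_real (2 * pi) powr (- (1/2 - \<i> * t))"

text \<open>
  No deformation to a slanted line through the saddle point is needed: since \<open>arctan (y / a) \<le> y / a\<close>, the
  truncated kernel is exponentially small on the vertical line as soon as \<open>t / (2 pi a)\<close> stays away from
  the integers.
\<close>

lemma zeta_approx_functional_equation:
  fixes t a :: real
  assumes t: "t \<ge> 1" and a: "10 \<le> a" "a \<le> t" "t \<le> 2 * pi * a ^ 2" and ca: "cos (2 * pi * a) \<le> 0"
    and K: "real K + 1/8 \<le> t / (2 * pi * a)" "t / (2 * pi * a) \<le> real K + 7/8"
  shows "norm (zeta (1/2 + \<i> * t) - (\<Sum>n | 0 < n \<and> real n < a. of_nat n powr (- (1/2 + \<i> * t)))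
            - chi_main t * (\<Sum>k=1..K. of_nat k powr (- (1/2 - \<i> * t)))) \<le> 40"
proof -
  define w where "w = 1/2 - \<i> * t"
  define s where "s = 1/2 + \<i> * t"
  have ws: "1 - s = w" "s - 1 = - w" "s \<noteq> 1" by (auto simp: w_def s_def complex_eq_iff)
  have w0: "w \<noteq> 0" by (auto simp: w_def complex_eq_iff)
  define S1 where "S1 = (\<Sum>n | 0 < n \<and> real n < a. of_nat n powr (- s) :: complex)"
  define S2 where "S2 = (\<Sum>k=1..K. of_nat k powr (- w) :: complex)"
  have E: "2 * pi * (- w) * (zeta s - S1) = vline a w"
    using zeta_eq_vline[OF ws(3), of a] a ca unfolding ws S1_def by simp
  define K0 where "K0 = t / (2 * pi * a)"
  have K0: "real K + 1/8 \<le> K0" "K0 \<le> real K + 7/8" using K by (simp_all add: K0_def)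
  have tK0: "t = 2 * pi * a * K0" using a by (simp add: K0_def)
  define up where "up = (\<lambda>y. jint w (Complex a y))"
  define low where "low = (\<lambda>y. jint w (Complex a (- y)))"
  define m where "m = (\<lambda>k z. z powr (1/2 - \<i> * t) * exp (\<i> * of_real (2 * pi * real k) * z))"
  define M where "M = (\<lambda>k. integral {0..a} (\<lambda>x. m k (of_real x)))"
  define A where "A = (\<lambda>k. exp (\<i> * pi / 2 * (1/2 - \<i> * t)) * Gamma (3/2 - \<i> * t) *
            of_real (2 * pi * real k) powr (- (3/2 - \<i> * t)) + \<i> * M k)"
  \<comment> \<open>In terms of \<open>q = exp (2 * pi * \<i> * z)\<close> the kernel is
    \<open>- 4 * pi ^ 2 * q / (1 - q) ^ 2\<close>; \<open>r\<close> is what remains of the upper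
    half-line after the first \<open>K\<close> terms of the expansion in powers of
    \<open>q\<close>.\<close>
  define r where "r = (\<lambda>y. - up y / of_real (4 * pi ^ 2) - (\<Sum>k=1..K. of_nat k * m k (Complex a y)))"
  have cont_up: "continuous_on {0..} up"
    unfolding up_def by (rule continuous_on_jint) (use a ca in auto)
  have cont_low: "continuous_on {0..} low"
    unfolding low_def by (rule continuous_on_compose2[OF continuous_on_jint[OF _ ca, of UNIV]])
           (use a in \<open>auto intro!: continuous_intros\<close>)
  have cont_m: "continuous_on {0..} (\<lambda>y. m k (Complex a y))" for k
    unfolding m_def Complex_eq
    using a by (intro continuous_intros) (auto simp: complex_nonpos_Reals_iff complex_eq_iff)
  have cont_r: "continuous_on {0..} r"
    unfolding r_def by (intro continuous_intros cont_up cont_m) auto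
  have rb: "norm (r y) \<le> (sqrt a * (2 * real K + 1)) * exp (- (1/2) * y)" if y: "y \<ge> 0" for y
  proof -
    define q where "q = exp (2 * pi * \<i> * Complex a y)"
    have nq: "norm q = exp (- (2 * pi * y))" by (simp add: q_def)
    have jq: "jker (Complex a y) = - 4 * of_real pi ^ 2 * (q / (1 - q) ^ 2)"
      by (simp add: jker_eq_exp q_def)
    have q1: "q \<noteq> 1"
    proof
      assume "q = 1"
      then obtain n :: int where "2 * pi * \<i> * Complex a y = of_int (2 * n) * pi * \<i>"
        unfolding q_def exp_eq_1 by (auto simp: complex_eq_iff)
      hence "Complex a y = of_int n" by (simp add: field_simps)
      thus False using cos_2pi_nonpos_not_Ints[OF ca, of y] by simp
    qed
    \<comment> \<open>The real part of \<open>q\<close> has the sign of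
      \<open>cos (2 * pi * a)\<close>, so \<open>1 - q\<close> has modulus at least 1. The kernel
      bound is this fact in another form and is converted back here.\<close>
    have "(4 * pi ^ 2) * (norm q / norm (1 - q) ^ 2) \<le> (4 * pi ^ 2) * exp (- (2 * pi * y))"
      using norm_jker_le_vertical[OF ca, of y] y unfolding jq
      by (simp add: norm_mult norm_divide norm_power)
    hence "norm q / norm (1 - q) ^ 2 \<le> exp (- (2 * pi * y))"
      by (subst (asm) mult_le_cancel_left_pos) auto
    hence "exp (- (2 * pi * y)) * (1 / norm (1 - q) ^ 2) \<le> exp (- (2 * pi * y)) * 1" by (simp add: nq)
    hence n1: "1 / norm (1 - q) ^ 2 \<le> 1" by (subst (asm) mult_le_cancel_left_pos) auto
    have mk: "m k (Complex a y) = Complex a y powr w * q ^ k" for k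
      by (simp add: m_def w_def q_def exp_of_nat_mult[symmetric] mult_ac)
    have "- up y / of_real (4 * pi ^ 2) = Complex a y powr w * (q / (1 - q) ^ 2)"
      by (simp add: up_def jint_def jq field_simps)
    also have "q / (1 - q) ^ 2 = (\<Sum>k=1..K. of_nat k * q ^ k)
           + q ^ (K + 1) * (of_nat (K + 1) - of_nat K * q) / (1 - q) ^ 2"
      by (rule sum_mult_geometric[OF q1])
    finally have "r y = Complex a y powr w * (q ^ (K + 1) * (of_nat (K + 1) - of_nat K * q) / (1 - q) ^ 2)"
      by (simp add: r_def mk distrib_left sum_distrib_left mult_ac)
    hence "norm (r y) = norm (Complex a y powr w) * (norm q ^ (K + 1) * norm (of_nat (K + 1) - of_nat K * q) * (1 / norm (1 - q) ^ 2))"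
      by (simp add: norm_mult norm_divide norm_power)
    also have "\<dots> \<le> (sqrt a * exp (y / (2 * a) + t * y / a)) * (exp (- (2 * pi * (real K + 1) * y)) * (2 * real K + 1) * 1)"
    proof (intro mult_mono n1)
      show "norm (Complex a y powr w) \<le> sqrt a * exp (y / (2 * a) + t * y / a)"
        unfolding w_def using a t y by (intro norm_Complex_powr_le) auto
      show "norm q ^ (K + 1) \<le> exp (- (2 * pi * (real K + 1) * y))"
        by (simp add: nq exp_of_nat_mult[symmetric] algebra_simps flip: exp_add)
      have "norm (of_nat (K + 1) - of_nat K * q) \<le> real (K + 1) + real K * norm q"
        using norm_triangle_ineq4[of "of_nat (K + 1)" "of_nat K * q"] by (simp add: norm_mult del: of_nat_Suc of_nat_add)
      also have "\<dots> \<le> real (K + 1) + real K * 1"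
        using y by (intro add_left_mono mult_left_mono) (auto simp: nq)
      finally show "norm (of_nat (K + 1) - of_nat K * q) \<le> 2 * real K + 1" by simp
    qed (use a in auto)
    also have "\<dots> = sqrt a * (2 * real K + 1) * exp (y / (2 * a) + t * y / a - 2 * pi * (real K + 1) * y)"
    proof -
      have "exp (y / (2 * a) + t * y / a - 2 * pi * (real K + 1) * y) =
            exp (y / (2 * a) + t * y / a) * exp (- (2 * pi * (real K + 1) * y))"
        by (simp only: exp_add[symmetric] diff_conv_add_uminus)
      thus ?thesis by (simp only: mult_ac mult_1_right)
    qed
    \<comment> \<open>The power grows at rate \<open>t / a \<le> 2 * pi * (K + 7/8)\<close>, up to
      \<open>1 / (2 * a)\<close>, and the first omitted power of \<open>q\<close> decays at rate
      \<open>2 * pi * (K + 1)\<close>. The difference \<open>pi / 4\<close> exceeds 3/4, and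
      \<open>a \<ge> 10\<close> keeps \<open>y / (2 * a)\<close> below
      \<open>y / 20\<close>.\<close>
    also have "\<dots> \<le> sqrt a * (2 * real K + 1) * exp (- (1/2) * y)"
    proof -
      have "t * y / a = 2 * pi * K0 * y" using a by (simp add: tK0)
      moreover have "y / (2 * a) \<le> y / 20" using a y by (intro divide_left_mono) auto
      moreover have "2 * pi * K0 * y \<le> 2 * pi * (real K + 7/8) * y"
        using K0 y by (intro mult_mono) auto
      moreover have "2 * pi * (real K + 7/8) * y - 2 * pi * (real K + 1) * y = - (pi / 4) * y"
        by (simp add: algebra_simps)
      moreover have "3 / 4 * y \<le> pi / 4 * y" using pi_gt3 y by (intro mult_right_mono) auto
      ultimately have "y / (2 * a) + t * y / a - 2 * pi * (real K + 1) * y \<le> - (1/2) * y" using y by linarith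
      thus ?thesis using a by (intro mult_left_mono) auto
    qed
    finally show ?thesis .
  qed
  have lowb: "norm (low y) \<le> (4 * pi ^ 2 * sqrt a) * exp (- 1 * y)" if y: "y \<ge> 0" for y
  proof -
    have "norm (low y) \<le> (sqrt a * exp (y / (2 * a))) * (4 * pi ^ 2 * exp (- (2 * pi * y)))"
      unfolding low_def jint_def norm_mult w_def
      using norm_Complex_powr_le(2)[of a t y] norm_jker_le_vertical[OF ca, of "-y"] a t y
      by (intro mult_mono) auto
    also have "\<dots> = (4 * pi ^ 2 * sqrt a) * exp (y / (2 * a) - 2 * pi * y)"
    proof -
      have "exp (y / (2 * a) - 2 * pi * y) = exp (y / (2 * a)) * exp (- (2 * pi * y))"
        by (simp only: exp_add[symmetric] diff_conv_add_uminus)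
      thus ?thesis by (simp only: mult_ac)
    qed
    also have "\<dots> \<le> (4 * pi ^ 2 * sqrt a) * exp (- 1 * y)"
    proof -
      have "y / (2 * a) \<le> y / 20" using a y by (intro divide_left_mono) auto
      moreover have "6 * y \<le> 2 * pi * y" using pi_gt3 y by (intro mult_right_mono) auto
      ultimately have "y / (2 * a) - 2 * pi * y \<le> - 1 * y" using y by linarith
      thus ?thesis using a by (intro mult_left_mono) auto
    qed
    finally show ?thesis .
  qed
  have ri: "r integrable_on {0..}" and rn: "norm (integral {0..} r) \<le> 2 * (sqrt a * (2 * real K + 1))"
    using integral_exp_bound_atLeast_0(1,2)[OF cont_r _ rb] by auto
  have li: "low integrable_on {0..}" and ln: "norm (integral {0..} low) \<le> 4 * pi ^ 2 * sqrt a"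
    using integral_exp_bound_atLeast_0(1,2)[OF cont_low _ lowb] by auto
  have mi: "((\<lambda>y. m k (Complex a y)) has_integral A k) {0..}" if "k \<ge> 1" for k
  proof -
    have c: "2 * pi * real k \<ge> 1" using pi_gt3 that mult_mono[of 1 "2 * pi" 1 "real k"] by simp
    have "t > 0" "a > 0" using t a by auto
    note I = integral_powr_times_exp_shift[OF c this]
    show ?thesis
      using integrable_integral[OF I(1)] unfolding I(2) unfolding A_def M_def m_def .
  qed
  have "(up has_integral - of_real (4 * pi ^ 2) * ((\<Sum>k=1..K. of_nat k * A k) + integral {0..} r)) {0..}"
  proof -
    have "((\<lambda>y. - of_real (4 * pi ^ 2) * ((\<Sum>k=1..K. of_nat k * m k (Complex a y)) + r y)) has_integral
            - of_real (4 * pi ^ 2) * ((\<Sum>k=1..K. of_nat k * A k) + integral {0..} r)) {0..}"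
      by (intro has_integral_mult_right has_integral_add has_integral_sum mi integrable_integral[OF ri]) auto
    moreover have "- of_real (4 * pi ^ 2) * ((\<Sum>k=1..K. of_nat k * m k (Complex a y)) + r y) = up y" for y
      by (simp add: r_def)
    ultimately show ?thesis by simp
  qed
  hence "((\<lambda>y. up y + low y) has_integral
     - of_real (4 * pi ^ 2) * ((\<Sum>k=1..K. of_nat k * A k) + integral {0..} r) + integral {0..} low) {0..}"
    by (intro has_integral_add integrable_integral[OF li])
  hence V: "vline a w = - of_real (4 * pi ^ 2) * ((\<Sum>k=1..K. of_nat k * A k) + integral {0..} r) + integral {0..} low"
    unfolding vline_def up_def low_def by (rule integral_unique)
  \<comment> \<open>The recurrence of Gamma pulls out the factor \<open>w\<close>, which Jensen's
    formula carries as well. Cancelling it leaves the dual term and divides all errors by a number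
    of modulus at least \<open>t\<close>.\<close>
  have kA: "of_real (4 * pi ^ 2) * (of_nat k * A k) =
     2 * pi * w * (chi_main t * of_nat k powr (- w)) + of_real (4 * pi ^ 2) * \<i> * (of_nat k * M k)" if k: "k \<in> {1..K}" for k
  proof -
    have w1: "3/2 - \<i> * t = w + 1" by (simp add: w_def)
    have "w \<notin> \<int>\<^sub>\<le>\<^sub>0" by (auto simp: w_def elim!: nonpos_Ints_cases dest!: arg_cong[where f = Re])
    hence G: "Gamma (w + 1) = w * Gamma w" by (intro Gamma_plus1)
    have P: "of_real (4 * pi ^ 2) * (of_nat k * of_real (2 * pi * real k) powr (- (w + 1))) =
             2 * pi * (of_real (2 * pi) powr (- w) * of_nat k powr (- w))"
    proof -
      have "of_real (2 * pi * real k) powr (- (w + 1)) = of_real (2 * pi * real k) powr (- w) / of_real (2 * pi * real k)"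
        using k powr_diff[of "of_real (2 * pi * real k)" "- w" 1] by simp
      moreover have "of_real (2 * pi * real k) powr (- w) = of_real (2 * pi) powr (- w) * of_real (real k) powr (- w)"
        by (subst of_real_mult, subst powr_times_real) auto
      ultimately show ?thesis using k by (simp add: field_simps power2_eq_square)
    qed
    have "of_real (4 * pi ^ 2) * (of_nat k * A k) = exp (\<i> * pi / 2 * w) * (w * Gamma w) *
       (of_real (4 * pi ^ 2) * (of_nat k * of_real (2 * pi * real k) powr (- (w + 1)))) +
       of_real (4 * pi ^ 2) * \<i> * (of_nat k * M k)"
      unfolding A_def w1 G by (simp add: w_def[symmetric] algebra_simps)
    also have "\<dots> = 2 * pi * w * (chi_main t * of_nat k powr (- w)) + of_real (4 * pi ^ 2) * \<i> * (of_nat k * M k)"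
      unfolding P chi_main_def w_def[symmetric] by (simp add: mult_ac)
    finally show ?thesis .
  qed
  have "2 * pi * w * (zeta s - S1) = of_real (4 * pi ^ 2) * (\<Sum>k=1..K. of_nat k * A k)
           + of_real (4 * pi ^ 2) * integral {0..} r - integral {0..} low"
    using E unfolding V by (simp add: algebra_simps)
  also have "of_real (4 * pi ^ 2) * (\<Sum>k=1..K. of_nat k * A k) =
      2 * pi * w * (chi_main t * S2) + of_real (4 * pi ^ 2) * \<i> * (\<Sum>k=1..K. of_nat k * M k)"
    unfolding sum_distrib_left S2_def sum.distrib[symmetric] by (intro sum.cong refl kA)
  finally have eq: "2 * pi * w * (zeta s - S1 - chi_main t * S2) =
      of_real (4 * pi ^ 2) * (\<i> * (\<Sum>k=1..K. of_nat k * M k) + integral {0..} r) - integral {0..} low"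
    by (simp add: algebra_simps)
  have Mb: "norm (of_nat k * M k) \<le> sqrt a * real K / pi * (1 / (K0 - real k))" if k: "k \<in> {1..K}" for k
  proof -
    have kK: "real k \<le> real K" using k by simp
    have "2 * pi * real k * a < t" unfolding tK0 using k K0 a by simp
    hence "norm (M k) \<le> 2 * (a * sqrt a / (t - 2 * pi * real k * a))"
      unfolding M_def m_def using powr_times_exp_primitive_bound[of "2 * pi * real k" t a] t a by simp
    also have "t - 2 * pi * real k * a = 2 * pi * a * (K0 - real k)" unfolding tK0 by (simp add: algebra_simps)
    also have "2 * (a * sqrt a / (2 * pi * a * d)) = sqrt a / pi * (1 / d)" for d
      using a by (cases "d = 0") (simp_all add: field_simps)
    finally have b: "norm (M k) \<le> sqrt a / pi * (1 / (K0 - real k))" .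
    have "norm (of_nat k * M k) \<le> real K * (sqrt a / pi * (1 / (K0 - real k)))"
      unfolding norm_mult using b kK by (intro mult_mono) auto
    thus ?thesis by (simp add: mult_ac)
  qed
  have Ms: "norm (\<Sum>k=1..K. of_nat k * M k) \<le> sqrt a * real K / pi * (16 * sqrt (real K))"
  proof -
    have "norm (\<Sum>k=1..K. of_nat k * M k) \<le> (\<Sum>k=1..K. sqrt a * real K / pi * (1 / (K0 - real k)))"
      by (rule sum_norm_le) (rule Mb)
    also have "\<dots> = sqrt a * real K / pi * (\<Sum>k=1..K. 1 / (K0 - real k))" by (rule sum_distrib_left[symmetric])
    also have "\<dots> \<le> sqrt a * real K / pi * (16 * sqrt (real K))"
      using a by (intro mult_left_mono sum_inverse_gap_le K0) auto
    finally show ?thesis .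
  qed
  have nw: "norm w \<ge> t" using abs_Im_le_cmod[of w] t by (simp add: w_def)
  have aK: "a * real K \<le> t / 4"
  proof -
    have "a * real K \<le> a * K0" using K0 a by (intro mult_left_mono) auto
    also have "\<dots> = t / (2 * pi)" using a by (simp add: K0_def)
    also have "\<dots> \<le> t / 4" using pi_gt3 t by (intro divide_left_mono) auto
    finally show ?thesis .
  qed
  \<comment> \<open>Together with \<open>a * K \<le> t / 4\<close> this forces
    \<open>K = O(sqrt t)\<close>: neither of the two sums can be long at the expense of the
    other.\<close>
  have sa: "sqrt t / 3 \<le> a"
  proof -
    have "t \<le> 2 * pi * a ^ 2" by fact
    also have "\<dots> \<le> 9 * a ^ 2" using pi_less_4 by (intro mult_right_mono) auto
    finally have "t \<le> (3 * a) ^ 2" by (simp add: power_mult_distrib)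
    hence "sqrt t \<le> \<bar>3 * a\<bar>" unfolding real_sqrt_abs[symmetric] by (rule real_sqrt_le_mono)
    thus ?thesis using a by simp
  qed
  have K1: "real K \<le> 3/4 * sqrt t"
  proof -
    have "sqrt t / 3 * real K \<le> a * real K" using sa by (intro mult_right_mono) auto
    also have "\<dots> \<le> t / 4" by (rule aK)
    also have "\<dots> = sqrt t / 3 * (3/4 * sqrt t)" using t by simp
    finally show ?thesis using t by (subst (asm) mult_le_cancel_left_pos) auto
  qed
  have saK: "sqrt a * sqrt (real K) \<le> sqrt t / 2"
  proof -
    have "sqrt a * sqrt (real K) = sqrt (a * real K)" by (simp add: real_sqrt_mult)
    also have "\<dots> \<le> sqrt (t / 4)" using aK by simp
    finally show ?thesis by (simp add: real_sqrt_divide)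
  qed
  have sa1: "sqrt a \<le> a" using a real_sqrt_le_mono[of a "a ^ 2"] by (simp add: power2_eq_square)
  \<comment> \<open>The factor \<open>2 * pi / t\<close> is \<open>4 * pi ^ 2\<close> divided by
    \<open>2 * pi * t\<close>. The share 12 belongs to the real segments, the share 28 below to the
    truncation remainder and the lower half-line; together they are the 40 of the statement.\<close>
  have T1: "sqrt a * real K / pi * (16 * sqrt (real K)) * (2 * pi / t) \<le> 12"
  proof -
    have "sqrt a * real K / pi * (16 * sqrt (real K)) * (2 * pi / t) = 32 * ((sqrt a * sqrt (real K)) * real K) / t"
      using t by (simp add: field_simps)
    also have "\<dots> \<le> 32 * ((sqrt t / 2) * (3/4 * sqrt t)) / t"
      using t K1 saK by (intro divide_right_mono mult_left_mono mult_mono) auto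
    also have "\<dots> = 12" using t by simp
    finally show ?thesis .
  qed
  have T2: "(2 * (sqrt a * (2 * real K + 1)) + sqrt a) * (2 * pi / t) \<le> 28"
  proof -
    have "sqrt a * real K \<le> a * real K" using sa1 by (intro mult_right_mono) auto
    hence 1: "2 * (sqrt a * (2 * real K + 1)) + sqrt a \<le> 4 * t" using aK sa1 a by (simp add: algebra_simps)
    have "(2 * (sqrt a * (2 * real K + 1)) + sqrt a) * (2 * pi / t) \<le> (4 * t) * (2 * (7/2) / t)"
      using t 1 a pi_less_4 pi_approx by (intro mult_mono divide_right_mono) auto
    also have "\<dots> = 28" using t by simp
    finally show ?thesis .
  qed
  have N: "norm (of_real (4 * pi ^ 2) * (\<i> * (\<Sum>k=1..K. of_nat k * M k) + integral {0..} r)) \<le>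
       4 * pi ^ 2 * (sqrt a * real K / pi * (16 * sqrt (real K)) + 2 * (sqrt a * (2 * real K + 1)))"
  proof -
    have "norm (\<i> * (\<Sum>k=1..K. of_nat k * M k) + integral {0..} r) \<le>
         sqrt a * real K / pi * (16 * sqrt (real K)) + 2 * (sqrt a * (2 * real K + 1))"
      using Ms rn by (intro norm_triangle_mono) (auto simp: norm_mult)
    thus ?thesis unfolding norm_mult norm_of_real by (intro mult_mono) auto
  qed
  have "(2 * pi * t) * norm (zeta s - S1 - chi_main t * S2) \<le> norm (2 * pi * w * (zeta s - S1 - chi_main t * S2))"
    unfolding norm_mult using nw t by (intro mult_mono) auto
  also have "\<dots> \<le> norm (of_real (4 * pi ^ 2) * (\<i> * (\<Sum>k=1..K. of_nat k * M k) + integral {0..} r)) + norm (integral {0..} low)"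
    unfolding eq by (rule norm_triangle_ineq4)
  also have "\<dots> \<le> 4 * pi ^ 2 * (sqrt a * real K / pi * (16 * sqrt (real K)) + 2 * (sqrt a * (2 * real K + 1))) + norm (integral {0..} low)"
    by (intro add_right_mono N)
  also have "4 * pi ^ 2 * (sqrt a * real K / pi * (16 * sqrt (real K)) + 2 * (sqrt a * (2 * real K + 1))) + norm (integral {0..} low)
      \<le> 4 * pi ^ 2 * (sqrt a * real K / pi * (16 * sqrt (real K)) + (2 * (sqrt a * (2 * real K + 1)) + sqrt a))"
    using ln by (simp add: algebra_simps)
  also have "\<dots> = (2 * pi * t) * (sqrt a * real K / pi * (16 * sqrt (real K)) * (2 * pi / t)
                     + (2 * (sqrt a * (2 * real K + 1)) + sqrt a) * (2 * pi / t))"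
  proof -
    have "4 * pi ^ 2 = (2 * pi * t) * (2 * pi / t)" using t by (simp add: power2_eq_square)
    thus ?thesis by (simp only: distrib_left distrib_right mult_ac)
  qed
  also have "\<dots> \<le> (2 * pi * t) * 40" using T1 T2 t by (intro mult_left_mono) auto
  finally have "norm (zeta s - S1 - chi_main t * S2) \<le> 40"
    using t by (subst (asm) mult_le_cancel_left_pos) auto
  thus ?thesis by (simp add: s_def S1_def S2_def w_def)
qed

section \<open>The Riemann--Siegel main sum\<close>

text \<open>This does the work of the functional equation. \<open>exp (2 * \<i> * theta t)\<close>
  is a power of \<open>pi\<close> times a quotient of Gamma values at conjugate points; duplication
  and reflection remove every Gamma factor, and the product comes out as
  \<open>\<i> / (u + \<i>)\<close> with \<open>u = exp (- pi * t)\<close>.\<close>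

lemma norm_chi_main_theta_le:
  assumes t: "t > 0"
  shows "norm (chi_main t * exp (2 * \<i> * theta t) - 1) \<le> exp (- pi * t)"
proof -
  define w where "w = 1/2 - \<i> * t"
  define z where "z = Complex (1/4) (t / 2)"
  define v where "v = cnj z"
  have z_eq: "z = 1/4 + \<i> * t / 2" and v_eq: "v = 1/4 - \<i> * t / 2"
    by (simp_all add: z_def v_def complex_eq_iff)
  have w_eq: "2 * v = w" "1 - z = v + 1/2" by (simp_all add: v_eq z_eq w_def)
  have nz: "Complex x y \<notin> \<int>\<^sub>\<le>\<^sub>0" if "x > 0" for x y
    using that by (auto elim!: nonpos_Ints_cases simp: complex_eq_iff)
  have zn: "z \<notin> \<int>\<^sub>\<le>\<^sub>0" "v \<notin> \<int>\<^sub>\<le>\<^sub>0" "v + 1/2 \<notin> \<int>\<^sub>\<le>\<^sub>0" "w \<notin> \<int>\<^sub>\<le>\<^sub>0"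
    using nz[of "1/4" "t/2"] nz[of "1/4" "-t/2"] nz[of "3/4" "-t/2"] nz[of "1/2" "-t"]
    by (simp_all add: z_def v_def w_def Complex_eq algebra_simps)
  have Gn: "Gamma z \<noteq> 0" "Gamma v \<noteq> 0" "Gamma (v + 1/2) \<noteq> 0" "Gamma w \<noteq> 0"
    using zn by (simp_all add: Gamma_eq_zero_iff)
  have th: "exp (2 * \<i> * theta t) = exp (- \<i> * t * ln pi) * (Gamma z / Gamma v)"
  proof -
    define g where "g = ln_Gamma z"
    have Gz: "Gamma z = exp g" using zn by (simp add: Gamma_complex_altdef g_def)
    have Gv: "Gamma v = exp (cnj g)" unfolding v_def cnj_Gamma[symmetric] Gz by (simp add: exp_cnj)
    have "2 * \<i> * theta t = - \<i> * t * ln pi + (g - cnj g)"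
      by (simp add: theta_def g_def z_def complex_eq_iff)
    thus ?thesis unfolding Gz Gv by (simp only: exp_add exp_diff)
  qed
  \<comment> \<open>Since \<open>2 * v = w\<close> and \<open>1 - z = v + 1/2\<close>, duplication
    and reflection share the factor \<open>Gamma (v + 1/2)\<close>, which drops out of the
    quotient.\<close>
  have dup: "Gamma v * Gamma (v + 1/2) = exp ((1 - w) * of_real (ln 2)) * of_real (sqrt pi) * Gamma w"
    using Gamma_legendre_duplication[of v] zn by (simp add: w_eq)
  have refl: "Gamma z * Gamma (v + 1/2) = of_real pi / sin (of_real pi * z)"
    using Gamma_reflection_complex[of z] by (simp add: w_eq)
  have sn: "sin (of_real pi * z) \<noteq> 0" using refl Gn by auto
  have "Gamma z / Gamma v = (Gamma z * Gamma (v + 1/2)) / (Gamma v * Gamma (v + 1/2))" using Gn by simp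
  also have "\<dots> = of_real pi / sin (of_real pi * z) / (exp ((1 - w) * of_real (ln 2)) * of_real (sqrt pi) * Gamma w)"
    by (simp only: dup refl)
  finally have ratio: "Gamma z / Gamma v = of_real pi / sin (of_real pi * z) / (exp ((1 - w) * of_real (ln 2)) * of_real (sqrt pi) * Gamma w)" .
  have sp: "complex_of_real pi / x = of_real (sqrt pi) * of_real (sqrt pi) / x" for x by (simp flip: of_real_mult)
  have spe: "complex_of_real (sqrt pi) = exp (of_real (ln pi) / 2)"
  proof -
    have "sqrt pi = exp (ln pi / 2)" by (simp add: powr_half_sqrt[symmetric] powr_def)
    hence "complex_of_real (sqrt pi) = of_real (exp (ln pi / 2))" by simp
    also have "\<dots> = exp (of_real (ln pi / 2))" by (rule exp_of_real[symmetric])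
    finally show ?thesis by simp
  qed
  have pw: "of_real (2 * pi) powr (- w) = exp (- w * of_real (ln 2)) * exp (- w * of_real (ln pi))"
  proof -
    have "Ln (of_real (2 * pi)) = of_real (ln 2) + of_real (ln pi)"
      by (subst Ln_of_real) (auto simp: ln_mult)
    thus ?thesis by (simp add: powr_def exp_add[symmetric] ring_distribs)
  qed
  have "chi_main t * exp (2 * \<i> * theta t) =
     exp (\<i> * pi / 2 * w) * (of_real (2 * pi) powr (- w)) * exp (- \<i> * t * ln pi) *
       (of_real (sqrt pi) / exp ((1 - w) * of_real (ln 2)) / sin (of_real pi * z))"
  proof -
    have h: "A * G * B * (C * (p * p / S / (D * p * G))) = A * B * C * (p / D / S)"
      if "p \<noteq> 0" "G \<noteq> 0" for A B C D G p S :: complex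
      using that by (cases "S = 0"; cases "D = 0") (simp_all add: field_simps)
    show ?thesis
      unfolding th ratio chi_main_def w_def[symmetric] sp by (rule h) (use Gn in auto)
  qed
  also have "\<dots> = exp (\<i> * pi / 2 * w) / sin (of_real pi * z) *
     (exp (- w * of_real (ln 2)) * exp (- w * of_real (ln pi)) * exp (- \<i> * t * ln pi) * exp (of_real (ln pi) / 2) * exp (- ((1 - w) * of_real (ln 2))))"
  proof -
    have h: "A * (b * b') * c * (p / d / S) = A / S * (b * b' * c * p * inverse d)" for A b b' c p d S :: complex
      by (simp add: divide_inverse mult_ac)
    show ?thesis unfolding pw spe exp_minus[of "(1 - w) * of_real (ln 2)"] by (rule h)
  qed
  also have "exp (- w * of_real (ln 2)) * exp (- w * of_real (ln pi)) * exp (- \<i> * t * ln pi) * exp (of_real (ln pi) / 2) * exp (- ((1 - w) * of_real (ln 2)))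
      = exp (- of_real (ln 2))"
    unfolding exp_add[symmetric] by (rule arg_cong[of _ _ exp]) (simp add: w_def algebra_simps)
  also have "exp (- complex_of_real (ln 2)) = 1 / 2"
    by (simp add: exp_minus exp_of_real)
  finally have c1: "chi_main t * exp (2 * \<i> * theta t) = exp (\<i> * pi / 2 * w) / (2 * sin (of_real pi * z))" by simp
  define E where "E = exp (\<i> * pi / 2 * w)"
  have E0: "E \<noteq> 0" by (simp add: E_def)
  have e1: "exp (\<i> * (of_real pi * z)) = E * of_real (exp (- pi * t))"
    unfolding E_def exp_of_real[symmetric] exp_add[symmetric]
    by (rule arg_cong[of _ _ exp]) (simp add: z_eq w_def field_simps)
  have e2: "exp (- (\<i> * (of_real pi * z))) = E * (- \<i>)"
  proof -
    have "exp (- (\<i> * (of_real pi * z))) = E * exp (- (\<i> * (of_real pi / 2)))"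
      unfolding E_def exp_add[symmetric] by (rule arg_cong[of _ _ exp]) (simp add: z_eq w_def field_simps)
    also have "exp (- (\<i> * (of_real pi / 2))) = - \<i>"
      using exp_Euler[of "- (of_real pi / 2)"] by (simp add: cos_of_real_pi_half sin_of_real_pi_half)
    finally show ?thesis .
  qed
  define u where "u = exp (- pi * t)"
  have u: "u > 0" by (simp add: u_def)
  have n: "of_real u + \<i> \<noteq> 0" by (simp add: complex_eq_iff)
  have s2: "2 * sin (of_real pi * z) = E * (of_real u + \<i>) / \<i>"
    unfolding sin_exp_eq e1 e2 u_def by (simp add: field_simps)
  have "E / (E * x / j) = j / x" if "x \<noteq> 0" "j \<noteq> 0" for x j :: complex
    using that E0 by (simp add: field_simps)
  from this[OF n complex_i_not_zero] have c2: "chi_main t * exp (2 * \<i> * theta t) = \<i> / (of_real u + \<i>)"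
    unfolding c1 E_def[symmetric] s2 .
  from n have "chi_main t * exp (2 * \<i> * theta t) - 1 = - of_real u / (of_real u + \<i>)"
    unfolding c2 by (simp add: field_simps)
  hence "norm (chi_main t * exp (2 * \<i> * theta t) - 1) = u / norm (of_real u + \<i>)"
    using u by (simp add: norm_divide)
  also have "\<dots> \<le> u / 1"
    using abs_Im_le_cmod[of "of_real u + \<i>"] n u by (intro divide_left_mono) auto
  finally show ?thesis by (simp add: u_def)
qed

section \<open>One main sum for the whole window\<close>

definition zsum :: "nat \<Rightarrow> real \<Rightarrow> complex" where
  "zsum N t = (\<Sum>n=1..N. of_nat n powr (- (1/2 + \<i> * t)))"

lemma cnj_zsum: "cnj (zsum N t) = (\<Sum>n=1..N. of_nat n powr (- (1/2 - \<i> * t)))"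
  by (simp add: zsum_def cnj_powr)

lemma norm_nat_powr_half:
  fixes t :: real
  shows "n > 0 \<Longrightarrow> norm (of_nat n powr (- (1/2 + \<i> * t)) :: complex) = 1 / sqrt (real n)"
  by (simp add: norm_powr_real_powr powr_minus powr_half_sqrt inverse_eq_divide)

lemma norm_zsum_le: "norm (zsum M t) \<le> real M"
proof -
  have "norm (zsum M t) \<le> (\<Sum>n=1..M. 1)"
    unfolding zsum_def
  proof (rule sum_norm_le)
    fix n assume "n \<in> {1..M}"
    thus "norm (of_nat n powr (- (1/2 + \<i> * t)) :: complex) \<le> 1"
      by (subst norm_nat_powr_half) auto
  qed
  thus ?thesis by simp
qed

text \<open>For changing the length of a main sum: the cutoffs delivered by the approximate
  functional equation vary with \<open>t\<close>, whereas mean values need one fixed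
  polynomial.\<close>

lemma norm_zsum_diff_le:
  assumes "real m \<ge> x" "real n \<ge> x" "x > 0"
  shows "norm (zsum m t - zsum n t) \<le> \<bar>real m - real n\<bar> / sqrt x"
proof -
  have main: "norm (zsum n t - zsum m t) \<le> \<bar>real n - real m\<bar> / sqrt x"
    if "m \<le> n" "real m \<ge> x" for m n
  proof -
    have "zsum n t - zsum m t = (\<Sum>k\<in>{m<..n}. of_nat k powr (- (1/2 + \<i> * t)))"
    proof -
      have "{1..n} = {1..m} \<union> {m<..n}" using that by auto
      hence "zsum n t = zsum m t + (\<Sum>k\<in>{m<..n}. of_nat k powr (- (1/2 + \<i> * t)))"
        unfolding zsum_def by (simp only:) (rule sum.union_disjoint, auto)
      thus ?thesis by simp
    qed
    also have "norm \<dots> \<le> (\<Sum>k\<in>{m<..n}. 1 / sqrt x)"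
    proof (rule sum_norm_le)
      fix k assume k: "k \<in> {m<..n}"
      hence "x \<le> real k" using that by auto
      thus "norm (of_nat k powr (- (1/2 + \<i> * t)) :: complex) \<le> 1 / sqrt x"
        using k \<open>x > 0\<close> by (subst norm_nat_powr_half) (auto intro!: divide_left_mono)
    qed
    also have "\<dots> = \<bar>real n - real m\<bar> / sqrt x" using that by (simp add: of_nat_diff)
    finally show ?thesis .
  qed
  show ?thesis
    using main[of n m] main[of m n] assms by (cases "m \<le> n") (auto simp: norm_minus_commute abs_minus_commute)
qed

lemma cos_2pi_nonpos_imp_frac:
  assumes "cos (2 * pi * x) \<le> 0"
  shows "of_int \<lfloor>x\<rfloor> + 1/4 \<le> x" "x \<le> of_int \<lfloor>x\<rfloor> + 3/4"
proof -
  define f where "f = x - of_int \<lfloor>x\<rfloor>"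
  have f: "0 \<le> f" "f < 1" unfolding f_def by linarith+
  have "cos (2 * pi * x) = cos (2 * pi * f + 2 * pi * of_int \<lfloor>x\<rfloor>)" by (simp add: f_def algebra_simps)
  also have "\<dots> = cos (2 * pi * f)" by (simp add: cos_add)
  finally have c: "cos (2 * pi * f) \<le> 0" using assms by simp
  have "f \<ge> 1/4"
  proof (rule ccontr)
    assume "\<not> f \<ge> 1/4"
    hence "2 * pi * f < pi / 2" by simp
    moreover have "2 * pi * f \<ge> 0" using f by simp
    hence "- (pi / 2) < 2 * pi * f" using pi_gt_zero by linarith
    ultimately have this: "2 * pi * f < pi / 2" "- (pi / 2) < 2 * pi * f" by auto
    from cos_gt_zero_pi[OF this(2,1)] c show False by simp
  qed
  moreover have "f \<le> 3/4"
  proof (rule ccontr)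
    assume "\<not> f \<le> 3/4"
    hence "2 * pi * (1 - f) < 2 * pi * (1/4)" by (intro mult_strict_left_mono) auto
    moreover have "2 * pi * (1 - f) \<ge> 0" using f by simp
    hence "- (pi / 2) < 2 * pi * (1 - f)" using pi_gt_zero by linarith
    ultimately have this: "2 * pi * (1 - f) < pi / 2" "- (pi / 2) < 2 * pi * (1 - f)" by auto
    from cos_gt_zero_pi[OF this(2,1)] have "cos (2 * pi - 2 * pi * f) > 0" by (simp add: algebra_simps)
    thus False using c by (simp add: cos_diff)
  qed
  ultimately show "of_int \<lfloor>x\<rfloor> + 1/4 \<le> x" "x \<le> of_int \<lfloor>x\<rfloor> + 3/4" by (simp_all add: f_def)
qed

text \<open>
  Both \<open>a\<close> and \<open>t / (2 pi a)\<close> have to stay away from the integers.  One of \<open>a = P\<close> and \<open>a = P + 1/2\<close>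
  achieves this, because \<open>t / (2 pi a)\<close> is then \<open>P\<close>, respectively \<open>P - 1/2 + O(1/P)\<close>.
\<close>

lemma riemann_Z_approx_cutoff:
  assumes t: "t \<ge> 10000"
  defines "P \<equiv> sqrt (t / (2 * pi))"
  shows "\<exists>N K. \<bar>real N - P\<bar> \<le> 2 \<and> \<bar>real K - P\<bar> \<le> 2 \<and>
     norm (riemann_Z t - (exp (\<i> * theta t) * zsum N t + cnj (exp (\<i> * theta t) * zsum K t))) \<le> 41"
proof -
  have P2: "P ^ 2 = t / (2 * pi)" using t by (simp add: P_def)
  have "(20::real) ^ 2 \<le> 10000 / (2 * 4)" by simp
  also have "\<dots> \<le> t / (2 * pi)" using t pi_less_4 by (intro frac_le) auto
  finally have P20: "P \<ge> 20" unfolding P_def by (rule real_le_rsqrt)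
  have Pt: "P + 1/2 \<le> t"
  proof -
    have "P * 20 \<le> P * P" using P20 by (intro mult_left_mono) auto
    also have "P * P = t / (2 * pi)" using P2 by (simp add: power2_eq_square)
    also have "\<dots> \<le> t / 1" using t pi_gt3 by (intro divide_left_mono) auto
    finally show ?thesis using P20 by simp
  qed
  obtain a K where a: "P \<le> a" "a \<le> P + 1/2" "cos (2 * pi * a) \<le> 0"
    and K: "real K + 1/8 \<le> t / (2 * pi * a)" "t / (2 * pi * a) \<le> real K + 7/8" and KP: "\<bar>real K - P\<bar> \<le> 2"
  proof (cases "cos (2 * pi * P) \<le> 0")
    case True
    have "t / (2 * pi * P) = P" using P20 P2 by (simp add: field_simps power2_eq_square)
    moreover have "real (nat \<lfloor>P\<rfloor>) = of_int \<lfloor>P\<rfloor>" using P20 by simp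
    ultimately show ?thesis
      using cos_2pi_nonpos_imp_frac[OF True] True by (intro that[of P "nat \<lfloor>P\<rfloor>"]) auto
  next
    case False
    define Q where "Q = P - 1/2"
    have "cos (2 * pi * Q) = cos (2 * pi * P - pi)" "cos (2 * pi * (P + 1/2)) = cos (2 * pi * P + pi)"
      by (simp_all add: Q_def algebra_simps)
    hence c: "cos (2 * pi * Q) \<le> 0" "cos (2 * pi * (P + 1/2)) \<le> 0" using False by (simp_all add: cos_add cos_diff)
    have "t = 2 * pi * P ^ 2" using P2 by (simp add: field_simps)
    also have "P ^ 2 = (Q + 1 / (4 * P + 2)) * (P + 1/2)"
      using P20 by (simp add: Q_def field_simps power2_eq_square)
    finally have e: "t / (2 * pi * (P + 1/2)) = Q + 1 / (4 * P + 2)" using P20 by simp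
    \<comment> \<open>The fractional part of \<open>Q\<close> lies between 1/4 and 3/4; adding at
      most 1/8 keeps it between 1/8 and 7/8, the margins required of
      \<open>t / (2 * pi * a)\<close>.\<close>
    have "1 / (4 * P + 2) \<le> 1 / 8" "1 / (4 * P + 2) \<ge> 0" using P20 by (auto intro!: divide_left_mono)
    moreover have "real (nat \<lfloor>Q\<rfloor>) = of_int \<lfloor>Q\<rfloor>" using P20 by (simp add: Q_def)
    ultimately show ?thesis
    proof (intro that[of "P + 1/2" "nat \<lfloor>Q\<rfloor>"])
      note f = cos_2pi_nonpos_imp_frac[OF c(1)]
      assume *: "1 / (4 * P + 2) \<le> 1 / 8" "0 \<le> 1 / (4 * P + 2)" "real (nat \<lfloor>Q\<rfloor>) = of_int \<lfloor>Q\<rfloor>"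
      show "real (nat \<lfloor>Q\<rfloor>) + 1/8 \<le> t / (2 * pi * (P + 1/2))" unfolding e *(3) using f *(2) by linarith
      show "t / (2 * pi * (P + 1/2)) \<le> real (nat \<lfloor>Q\<rfloor>) + 7/8" unfolding e *(3) using f *(1) by linarith
      show "\<bar>real (nat \<lfloor>Q\<rfloor>) - P\<bar> \<le> 2" using *(3) f Q_def by linarith
    qed (use c in auto)
  qed
  define N where "N = nat \<lfloor>a\<rfloor>"
  have fa: "of_int \<lfloor>a\<rfloor> + 1/4 \<le> a" "a \<le> of_int \<lfloor>a\<rfloor> + 3/4" using cos_2pi_nonpos_imp_frac[OF a(3)] by auto
  have N: "real N = of_int \<lfloor>a\<rfloor>" using a P20 by (simp add: N_def)
  have set: "{n. 0 < n \<and> real n < a} = {1..N}"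
  proof -
    have "real n < a \<longleftrightarrow> n \<le> N" for n
    proof
      assume "real n < a"
      hence "real n < real N + 1" using fa N by linarith
      thus "n \<le> N" by linarith
    next
      assume "n \<le> N"
      hence "real n \<le> real N" by simp
      thus "real n < a" using fa N by linarith
    qed
    thus ?thesis unfolding set_eq_iff mem_Collect_eq atLeastAtMost_iff by (metis One_nat_def Suc_le_eq)
  qed
  have t2: "t \<le> 2 * pi * a ^ 2"
  proof -
    have "t = 2 * pi * P ^ 2" using P2 by (simp add: field_simps)
    also have "\<dots> \<le> 2 * pi * a ^ 2" using a P20 by (intro mult_left_mono power_mono) auto
    finally show ?thesis .
  qed
  have Z: "norm (zeta (1/2 + \<i> * t) - zsum N t - chi_main t * cnj (zsum K t)) \<le> 40"
    unfolding cnj_zsum unfolding zsum_def set[symmetric]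
    by (rule zeta_approx_functional_equation) (use t a K P20 Pt t2 in auto)
  note cz = norm_zsum_le[of K t]
  \<comment> \<open>Multiplying \<open>chi_main t\<close> by \<open>exp (\<i> * theta t)\<close>
    gives \<open>exp (- \<i> * theta t)\<close> up to the error in the second line, so the dual sum
    turns into the conjugate of a main sum.\<close>
  have "riemann_Z t - (exp (\<i> * theta t) * zsum N t + cnj (exp (\<i> * theta t) * zsum K t)) =
     exp (\<i> * theta t) * (zeta (1/2 + \<i> * t) - zsum N t - chi_main t * cnj (zsum K t)) +
     exp (- (\<i> * theta t)) * (chi_main t * exp (2 * \<i> * theta t) - 1) * cnj (zsum K t)"
  proof -
    have 1: "exp (- (\<i> * theta t)) * exp (2 * \<i> * theta t) = exp (\<i> * theta t)"
      by (simp flip: exp_add)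
    have 2: "cnj (exp (\<i> * theta t)) = exp (- (\<i> * theta t))" by (simp add: exp_cnj)
    have "exp (- (\<i> * theta t)) * (chi_main t * exp (2 * \<i> * theta t) - 1) =
            chi_main t * (exp (- (\<i> * theta t)) * exp (2 * \<i> * theta t)) - exp (- (\<i> * theta t))"
      by (simp only: ring_distribs mult_ac mult_1_right mult_1)
    hence 3: "exp (- (\<i> * theta t)) * (chi_main t * exp (2 * \<i> * theta t) - 1) = chi_main t * exp (\<i> * theta t) - exp (- (\<i> * theta t))"
      by (simp only: 1)
    have 4: "e * z - (e * n + f * k) = e * (z - n - x * k) + (x * e - f) * k" for e z n f k x :: complex
      by (simp add: algebra_simps)
    show ?thesis unfolding 3 complex_cnj_mult 2 riemann_Z_def by (rule 4)
  qed
  also have "norm \<dots> \<le> 1 * 40 + 1 * exp (- pi * t) * real K"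
    using Z norm_chi_main_theta_le[of t] t cz
    by (intro norm_triangle_mono) (auto simp: norm_mult intro!: mult_mono)
  finally have B: "norm (riemann_Z t - (exp (\<i> * theta t) * zsum N t + cnj (exp (\<i> * theta t) * zsum K t)))
     \<le> 1 * 40 + 1 * exp (- pi * t) * real K" .
  have "exp (- pi * t) * real K \<le> 1"
  proof -
    have "real K \<le> 1 + pi * t"
    proof -
      have "real K \<le> P + 2" using KP by linarith
      also have "\<dots> \<le> 1 + 3 * t" using Pt t by linarith
      also have "\<dots> \<le> 1 + pi * t" using pi_gt3 t by simp
      finally show ?thesis .
    qed
    also have "\<dots> \<le> exp (pi * t)" by (rule exp_ge_add_one_self)
    finally show ?thesis by (simp add: exp_minus field_simps)
  qed
  hence "norm (riemann_Z t - (exp (\<i> * theta t) * zsum N t + cnj (exp (\<i> * theta t) * zsum K t))) \<le> 41"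
    using B by simp
  moreover have "\<bar>real N - P\<bar> \<le> 2" using fa N a by linarith
  ultimately show ?thesis using KP by blast
qed

text \<open>Over the window \<open>sqrt (t / (2 * pi))\<close> moves by at most \<open>ln T\<close>,
  and exchanging about \<open>ln T\<close> terms of size \<open>T powr (-1/4)\<close> costs less
  than 1 in each sum; this turns 41 into 43. The window is twice as wide as the one holding the
  points, to leave room for the shifts \<open>tau_bar\<close>.\<close>

lemma riemann_Z_approx:
  "\<exists>T0. \<forall>T\<ge>T0. \<forall>t. \<bar>t - T\<bar> \<le> 2 * sqrt T * ln T \<longrightarrow>
     norm (riemann_Z t - (exp (\<i> * theta t) * zsum (nat \<lfloor>sqrt (T / (2 * pi))\<rfloor>) t
        + cnj (exp (\<i> * theta t) * zsum (nat \<lfloor>sqrt (T / (2 * pi))\<rfloor>) t))) \<le> 43"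
proof -
  have "\<forall>\<^sub>F T in at_top. T \<ge> 20000 \<and> 2 * sqrt T * ln T \<le> T / 2 \<and>
         ln T + 3 \<le> sqrt (T / (2 * pi)) / 2 \<and> ln T + 3 \<le> sqrt (sqrt (T / (2 * pi)) / 2) \<and> ln T \<ge> (0::real)"
    by (intro eventually_conj) real_asymp+
  then obtain T0 where T0: "\<And>T. T \<ge> T0 \<Longrightarrow> T \<ge> 20000 \<and> 2 * sqrt T * ln T \<le> T / 2 \<and>
         ln T + 3 \<le> sqrt (T / (2 * pi)) / 2 \<and> ln T + 3 \<le> sqrt (sqrt (T / (2 * pi)) / 2) \<and> ln T \<ge> (0::real)"
    unfolding eventually_at_top_linorder by blast
  show ?thesis
  proof (intro exI[of _ T0] allI impI)
    fix T t assume T: "T \<ge> T0" and tT: "\<bar>t - T\<bar> \<le> 2 * sqrt T * ln T"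
    note T1 = T0[OF T]
    define P0 P where "P0 = sqrt (T / (2 * pi))" and "P = sqrt (t / (2 * pi))"
    define M where "M = nat \<lfloor>P0\<rfloor>"
    have t: "t \<ge> 10000" using T1 tT by linarith
    obtain N K where NK: "\<bar>real N - P\<bar> \<le> 2" "\<bar>real K - P\<bar> \<le> 2" and
      Z: "norm (riemann_Z t - (exp (\<i> * theta t) * zsum N t + cnj (exp (\<i> * theta t) * zsum K t))) \<le> 41"
      using riemann_Z_approx_cutoff[OF t] unfolding P_def by blast
    have P0pos: "P0 > 0" using T1 by (simp add: P0_def)
    have Ppos: "P \<ge> 0" using t by (simp add: P_def)
    have "\<bar>P - P0\<bar> * (P + P0) = \<bar>P ^ 2 - P0 ^ 2\<bar>"
    proof -
      have "P ^ 2 - P0 ^ 2 = (P - P0) * (P + P0)" by (simp add: power2_eq_square algebra_simps)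
      thus ?thesis using P0pos Ppos by (simp add: abs_mult)
    qed
    also have "P ^ 2 - P0 ^ 2 = (t - T) / (2 * pi)"
      using t T1 by (simp add: P_def P0_def diff_divide_distrib)
    also have "\<bar>(t - T) / (2 * pi)\<bar> \<le> 2 * sqrt T * ln T / (2 * pi)"
    proof -
      have "\<bar>(t - T) / (2 * pi)\<bar> = \<bar>t - T\<bar> / (2 * pi)" by simp
      thus ?thesis using divide_right_mono[OF tT, of "2 * pi"] by simp
    qed
    also have "sqrt T = sqrt (2 * pi) * P0"
    proof -
      have "sqrt (2 * pi) * P0 = sqrt (2 * pi * (T / (2 * pi)))" unfolding P0_def by (rule real_sqrt_mult[symmetric])
      thus ?thesis by simp
    qed
    also have "2 * (sqrt (2 * pi) * P0) * ln T / (2 * pi) = (sqrt (2 * pi) / pi) * ln T * P0" by simp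
    also have "\<dots> \<le> 1 * ln T * P0"
    proof -
      have "sqrt (2 * pi) \<le> sqrt (pi * pi)" using pi_gt3 by (intro real_sqrt_le_mono mult_right_mono) auto
      hence "sqrt (2 * pi) / pi \<le> 1" by simp
      thus ?thesis using T1 P0pos by (intro mult_right_mono) auto
    qed
    finally have "\<bar>P - P0\<bar> * (P + P0) \<le> ln T * P0" by simp
    moreover have "\<bar>P - P0\<bar> * P0 \<le> \<bar>P - P0\<bar> * (P + P0)" using Ppos by (intro mult_left_mono) auto
    ultimately have "\<bar>P - P0\<bar> * P0 \<le> ln T * P0" by linarith
    hence PP: "\<bar>P - P0\<bar> \<le> ln T" using P0pos by (subst (asm) mult_le_cancel_right_pos) auto
    have M: "real M \<le> P0" "P0 \<le> real M + 1" unfolding M_def using P0pos by linarith+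
    define x where "x = P0 / 2"
    have x: "x > 0" using P0pos by (simp add: x_def)
    have big: "ln T + 3 \<le> x" "ln T + 3 \<le> sqrt x" using T1 by (auto simp: P0_def x_def)
    have near: "norm (zsum n t - zsum M t) \<le> 1" if n: "\<bar>real n - P\<bar> \<le> 2" for n
    proof -
      have "norm (zsum n t - zsum M t) \<le> \<bar>real n - real M\<bar> / sqrt x"
        by (rule norm_zsum_diff_le) (use n PP M big x x_def in linarith)+
      also have "\<dots> \<le> (ln T + 3) / sqrt x"
        using x by (intro divide_right_mono) (use n PP M in linarith, auto)
      also have "\<dots> \<le> 1" using big x by simp
      finally show ?thesis .
    qed
    define e where "e = exp (\<i> * theta t)"
    have e: "norm e = 1" by (simp add: e_def)
    have "riemann_Z t - (e * zsum M t + cnj (e * zsum M t)) =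
        (riemann_Z t - (e * zsum N t + cnj (e * zsum K t))) + (e * (zsum N t - zsum M t) + cnj (e * (zsum K t - zsum M t)))"
      by (simp only: right_diff_distrib complex_cnj_diff) simp
    also have "norm \<dots> \<le> 41 + (1 + 1)"
      using Z near[OF NK(1)] near[OF NK(2)] unfolding e_def[symmetric]
      by (intro norm_triangle_mono) (simp_all only: complex_mod_cnj norm_mult e mult_1)
    finally have "norm (riemann_Z t - (e * zsum M t + cnj (e * zsum M t))) \<le> 41 + (1 + 1)" .
    moreover have "41 + (1 + 1) = (43::real)" by simp
    ultimately show "norm (riemann_Z t - (exp (\<i> * theta t) * zsum (nat \<lfloor>sqrt (T / (2 * pi))\<rfloor>) t
        + cnj (exp (\<i> * theta t) * zsum (nat \<lfloor>sqrt (T / (2 * pi))\<rfloor>) t))) \<le> 43"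
      unfolding e_def M_def P0_def by (simp only:)
  qed
qed

section \<open>The theta function and the points \<open>h_seq\<close>\<close>

lemma theta_has_derivative_Digamma:
  "(theta has_real_derivative (Re (Digamma (Complex (1/4) (t/2))) - ln pi) / 2) (at t)"
proof -
  have z: "Complex (1/4) (t/2) \<notin> \<real>\<^sub>\<le>\<^sub>0" by (simp add: complex_nonpos_Reals_iff)
  have "((\<lambda>t. Complex (1/4) (t/2)) has_vector_derivative (\<i> / 2)) (at t)"
  proof -
    have "((\<lambda>t. 1/4 + complex_of_real t * (\<i> / 2)) has_vector_derivative (0 + 1 * (\<i> / 2))) (at t)"
      by (intro has_vector_derivative_add has_vector_derivative_const has_vector_derivative_mult_left
            has_vector_derivative_of_real) (auto intro!: derivative_eq_intros)
    moreover have "(\<lambda>t. 1/4 + complex_of_real t * (\<i> / 2)) = (\<lambda>t. Complex (1/4) (t/2))"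
      by (auto simp: fun_eq_iff complex_eq_iff)
    ultimately show ?thesis by simp
  qed
  from field_vector_diff_chain_at[OF this has_field_derivative_ln_Gamma_complex[OF z]]
  have "((\<lambda>t. ln_Gamma (Complex (1/4) (t/2))) has_vector_derivative (\<i> / 2 * Digamma (Complex (1/4) (t/2)))) (at t)"
    by (simp add: o_def)
  from bounded_linear.has_vector_derivative[OF bounded_linear_Im this]
  have "((\<lambda>t. Im (ln_Gamma (Complex (1/4) (t/2)))) has_real_derivative Re (Digamma (Complex (1/4) (t/2))) / 2) (at t)"
    by (simp add: has_real_derivative_iff_has_vector_derivative)
  moreover have "((\<lambda>t. - (t / 2) * ln pi) has_real_derivative - (1/2) * ln pi) (at t)"
    by (auto intro!: derivative_eq_intros)
  ultimately have "((\<lambda>t. - (t / 2) * ln pi + Im (ln_Gamma (Complex (1/4) (t/2)))) has_real_derivative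
           - (1/2) * ln pi + Re (Digamma (Complex (1/4) (t/2))) / 2) (at t)"
    by (intro DERIV_add)
  moreover have "theta = (\<lambda>t. - (t / 2) * ln pi + Im (ln_Gamma (Complex (1/4) (t/2))))"
    by (simp add: fun_eq_iff theta_def)
  ultimately show ?thesis by (simp add: field_simps)
qed

text \<open>Digamma is the limit of \<open>ln m\<close> minus a sum of reciprocals. Each reciprocal
  is compared with the increment of \<open>ln (norm (z + of_nat n))\<close>, which telescopes; the
  discrepancy is quadratic in \<open>1 / norm (z + of_nat n)\<close>.\<close>

lemma Re_Digamma_approx:
  assumes y: "y \<ge> 2" and x: "x > 0"
  shows "\<bar>Re (Digamma (Complex x y)) - ln (norm (Complex x y))\<bar> \<le> 4 / (y - 1)"
proof -
  define z where "z = Complex x y"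
  define l where "l = (\<lambda>n::nat. ln (norm (z + of_nat n)))"
  have z0: "z \<noteq> 0" using x by (auto simp: z_def complex_eq_iff)
  have nz: "norm (z + of_nat n) ^ 2 \<ge> (real n + y) ^ 2 / 2" for n
  proof -
    have "norm (z + of_nat n) ^ 2 = (x + real n) ^ 2 + y ^ 2" by (simp add: z_def cmod_power2)
    moreover have "(x + real n) ^ 2 \<ge> (real n) ^ 2" using x by (intro power_mono) auto
    moreover have "2 * (real n ^ 2 + y ^ 2) - (real n + y) ^ 2 = (real n - y) ^ 2" by (simp add: power2_eq_square algebra_simps)
    moreover have "(real n - y) ^ 2 \<ge> 0" by simp
    ultimately show ?thesis by argo
  qed
  have nz2: "norm (z + of_nat n) \<ge> 2" for n
    using abs_Im_le_cmod[of "z + of_nat n"] y by (simp add: z_def)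
  have step: "\<bar>Re (inverse (z + of_nat n)) - (l (Suc n) - l n)\<bar> \<le> 4 / (real n + y - 1) - 4 / (real (Suc n) + y - 1)" for n
  proof -
    define w where "w = inverse (z + of_nat n)"
    have zn: "z + of_nat n \<noteq> 0" using nz2[of n] by auto
    have nw': "norm w = 1 / norm (z + of_nat n)" by (simp only: w_def norm_inverse divide_inverse mult_1)
    also have "\<dots> \<le> 1 / 2" using nz2[of n] by (intro frac_le) auto
    finally have nw: "norm w \<le> 1/2" .
    have w1: "1 + w \<noteq> 0"
    proof
      assume "1 + w = 0"
      hence "w = - 1" by (simp add: add_eq_0_iff)
      thus False using nw by simp
    qed
    have "l (Suc n) - l n = ln (norm (1 + w))"
    proof -
      have "z + of_nat (Suc n) = (z + of_nat n) * (1 + w)" using zn by (simp add: w_def distrib_left add_ac)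
      hence "l (Suc n) = ln (norm (z + of_nat n) * norm (1 + w))" by (simp only: l_def norm_mult)
      also have "\<dots> = l n + ln (norm (1 + w))" unfolding l_def using zn w1 by (subst ln_mult) auto
      finally show ?thesis by simp
    qed
    also have "\<dots> = Re (Ln (1 + w))" using w1 by (simp add: Re_Ln)
    finally have "\<bar>Re w - (l (Suc n) - l n)\<bar> = \<bar>Re (Ln (1 + w) - w)\<bar>" by simp
    also have "\<dots> \<le> norm (Ln (1 + w) - w)" by (rule abs_Re_le_cmod)
    also have "\<dots> \<le> norm w ^ 2 / (1 - norm w)" using nw by (intro Ln_approx_linear) auto
    also have "\<dots> \<le> norm w ^ 2 / (1/2)" using nw by (intro divide_left_mono) auto
    also have "\<dots> = 2 / norm (z + of_nat n) ^ 2" unfolding nw' by (simp only: power_divide) simp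
    also have "\<dots> \<le> 2 / ((real n + y) ^ 2 / 2)" using y nz2[of n] by (intro divide_left_mono nz mult_pos_pos) auto
    also have "\<dots> = 4 / (real n + y) ^ 2" by simp
    \<comment> \<open>One square factor is lowered by 1 so that the error bounds telescope
      too.\<close>
    also have "\<dots> \<le> 4 / ((real n + y) * (real n + y - 1))"
      using y by (intro divide_left_mono) (auto simp: power2_eq_square)
    also have "\<dots> = 4 / (real n + y - 1) - 4 / (real (Suc n) + y - 1)"
      using y by (simp add: field_simps)
    finally show ?thesis by (simp add: w_def)
  qed
  have sums: "\<bar>Re (\<Sum>n<m. inverse (z + of_nat n)) - (l m - l 0)\<bar> \<le> 4 / (y - 1)" for m
  proof -
    have "Re (\<Sum>n<m. inverse (z + of_nat n)) - (l m - l 0) = (\<Sum>n<m. Re (inverse (z + of_nat n)) - (l (Suc n) - l n))"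
      unfolding sum_subtractf[of "\<lambda>n. Re (inverse (z + of_nat n))"] sum_lessThan_telescope Re_sum ..
    also have "\<bar>\<dots>\<bar> \<le> (\<Sum>n<m. 4 / (real n + y - 1) - 4 / (real (Suc n) + y - 1))"
      by (rule order_trans[OF sum_abs]) (intro sum_mono step)
    also have "\<dots> = 4 / (real 0 + y - 1) - 4 / (real m + y - 1)"
      using sum_lessThan_telescope'[of "\<lambda>n. 4 / (real n + y - 1)" m] by simp
    also have "\<dots> \<le> 4 / (y - 1)" using y by simp
    finally show ?thesis .
  qed
  have lim1: "(\<lambda>m. ln (real m) - Re (\<Sum>n<m. inverse (z + of_nat n))) \<longlonglongrightarrow> Re (Digamma z)"
    using tendsto_Re[OF Digamma_LIMSEQ[OF z0]] by simp
  have lim2: "(\<lambda>m. l m - ln (real m)) \<longlonglongrightarrow> 0"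
  proof -
    have "(\<lambda>m. z / of_nat m + 1) \<longlonglongrightarrow> 0 + 1"
      by (intro tendsto_intros tendsto_divide_0[OF tendsto_const] tendsto_of_nat)
    hence "(\<lambda>m. ln (norm (z / of_nat m + 1))) \<longlonglongrightarrow> ln (norm (0 + 1 :: complex))"
      by (intro tendsto_intros) auto
    hence "(\<lambda>m. ln (norm (z / of_nat m + 1))) \<longlonglongrightarrow> 0" by simp
    moreover have "\<forall>\<^sub>F m in sequentially. ln (norm (z / of_nat m + 1)) = l m - ln (real m)"
      using eventually_gt_at_top[of 0]
    proof eventually_elim
      case (elim m)
      hence "z / of_nat m + 1 = (z + of_nat m) / of_nat m" by (simp add: field_simps)
      hence "norm (z / of_nat m + 1) = norm (z + of_nat m) / real m" by (simp add: norm_divide)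
      moreover have "norm (z + of_nat m) > 0" using nz2[of m] by linarith
      ultimately show ?case unfolding l_def using elim by (simp only:) (subst ln_div, auto)
    qed
    ultimately show ?thesis by (rule Lim_transform_eventually)
  qed
  have "(\<lambda>m. \<bar>(ln (real m) - Re (\<Sum>n<m. inverse (z + of_nat n))) + (l m - ln (real m)) - l 0\<bar>)
          \<longlonglongrightarrow> \<bar>Re (Digamma z) + 0 - l 0\<bar>"
    by (intro tendsto_intros lim1 lim2)
  moreover have "\<bar>(ln (real m) - Re (\<Sum>n<m. inverse (z + of_nat n))) + (l m - ln (real m)) - l 0\<bar> \<le> 4 / (y - 1)" for m
    using sums[of m] by linarith
  ultimately have "\<bar>Re (Digamma z) + 0 - l 0\<bar> \<le> 4 / (y - 1)"
    by (intro tendsto_upperbound[of _ _ sequentially "4 / (y - 1)"]) auto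
  thus ?thesis by (simp add: l_def z_def)
qed

lemma theta_derivative_approx:
  assumes t: "t \<ge> 10"
  obtains D where "(theta has_real_derivative D) (at t)" "\<bar>D - ln (t / (2 * pi)) / 2\<bar> \<le> 10 / t"
proof -
  define z where "z = Complex (1/4) (t/2)"
  have nz: "norm z \<le> 1/4 + t/2" "t/2 \<le> norm z"
    using cmod_le[of z] abs_Im_le_cmod[of z] t by (simp_all add: z_def)
  have "ln (norm z) \<ge> ln (t/2)" using nz t by (intro ln_mono) auto
  moreover have "ln (norm z) \<le> ln (t/2) + 1 / (2 * t)"
  proof -
    have "ln (norm z) \<le> ln (t/2 * (1 + 1 / (2 * t)))"
    proof -
      have "t/2 * (1 + 1 / (2 * t)) = 1/4 + t/2" using t by (simp add: field_simps)
      moreover have "norm z > 0" using nz t by linarith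
      ultimately show ?thesis using nz t by (intro ln_mono) auto
    qed
    also have "\<dots> = ln (t/2) + ln (1 + 1 / (2 * t))" 
    proof (rule ln_mult_pos)
      have "1 / (2 * t) > 0" using t by simp
      thus "0 < 1 + 1 / (2 * t)" by linarith
    qed (use t in auto)
    also have "ln (1 + 1 / (2 * t)) \<le> 1 / (2 * t)" using t by (intro ln_add_one_self_le_self) auto
    finally show ?thesis by simp
  qed
  moreover have "\<bar>Re (Digamma z) - ln (norm z)\<bar> \<le> 4 / (t/2 - 1)"
    unfolding z_def by (rule Re_Digamma_approx) (use t in auto)
  moreover have "4 / (t/2 - 1) \<le> 10 / t" using t by (simp add: field_simps)
  ultimately have "\<bar>Re (Digamma z) - ln (t/2)\<bar> \<le> 10 / t + 1 / (2 * t)" by linarith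
  also have "\<dots> \<le> 20 / t" using t by (simp add: field_simps)
  finally have "\<bar>(Re (Digamma z) - ln pi) / 2 - (ln (t/2) - ln pi) / 2\<bar> \<le> 10 / t" by (simp add: field_simps)
  moreover have "ln (t/2) - ln pi = ln (t / (2 * pi))" using t by (simp add: ln_div ln_mult)
  ultimately show ?thesis
    using theta_has_derivative_Digamma[of t] by (intro that[of "(Re (Digamma z) - ln pi) / 2"]) (auto simp: z_def)
qed

text \<open>The derivative of \<open>theta\<close> is half a logarithm up to
  \<open>O(1 / t)\<close>, and it changes by \<open>O(ln T / sqrt T)\<close> across the window. That
  rate is small enough to survive multiplication by the trivial bound \<open>sqrt T\<close> of a
  main sum.\<close>

lemma theta_locally_linear:
  "\<exists>T0. \<forall>T\<ge>T0. \<forall>t u. \<bar>t - T\<bar> \<le> 2 * sqrt T * ln T \<longrightarrow> \<bar>u - T\<bar> \<le> 2 * sqrt T * ln T \<longrightarrow>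
     \<bar>theta u - theta t - (u - t) * (ln (T / (2 * pi)) / 2)\<bar> \<le> 3 * ln T / sqrt T * \<bar>u - t\<bar>"
proof -
  have "\<forall>\<^sub>F T in at_top. T \<ge> 20 \<and> 2 * sqrt T * ln T \<le> T / 2 \<and> 20 / T \<le> ln T / sqrt T \<and> ln T \<ge> (0::real)"
    by (intro eventually_conj) real_asymp+
  then obtain T0 where T0: "\<And>T. T \<ge> T0 \<Longrightarrow> T \<ge> 20 \<and> 2 * sqrt T * ln T \<le> T / 2 \<and> 20 / T \<le> ln T / sqrt T \<and> ln T \<ge> (0::real)"
    unfolding eventually_at_top_linorder by blast
  show ?thesis
  proof (intro exI[of _ T0] allI impI)
    fix T t u assume T: "T \<ge> T0" and t: "\<bar>t - T\<bar> \<le> 2 * sqrt T * ln T" and u: "\<bar>u - T\<bar> \<le> 2 * sqrt T * ln T"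
    note T1 = T0[OF T]
    define l where "l = ln (T / (2 * pi)) / 2"
    define B where "B = 3 * ln T / sqrt T"
    define S where "S = {T - 2 * sqrt T * ln T..T + 2 * sqrt T * ln T}"
    have der: "\<exists>D. ((\<lambda>v. theta v - v * l) has_real_derivative D) (at v within S) \<and> norm D \<le> B" if v: "v \<in> S" for v
    proof -
      have vT: "\<bar>v - T\<bar> \<le> 2 * sqrt T * ln T" using v by (auto simp: S_def)
      hence vT2: "\<bar>v - T\<bar> \<le> T / 2" using T1 by linarith
      hence v10: "v \<ge> T / 2" "v \<ge> 10" using T1 by linarith+
      obtain D where D: "(theta has_real_derivative D) (at v)" "\<bar>D - ln (v / (2 * pi)) / 2\<bar> \<le> 10 / v"
        using theta_derivative_approx[OF v10(2)] by blast
      have "10 / v \<le> 20 / T" using v10 T1 by (simp add: field_simps)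
      also have "\<dots> \<le> ln T / sqrt T" using T1 by blast
      finally have 1: "10 / v \<le> ln T / sqrt T" .
      have "ln (v / (2 * pi)) - ln (T / (2 * pi)) = ln v - ln T" using v10 T1 by (simp add: ln_div)
      also have "\<bar>ln v - ln T\<bar> \<le> \<bar>v - T\<bar> / (T / 2)"
      proof -
        have *: "ln b - ln a \<le> (b - a) / (T / 2)" if "a \<le> b" "a \<ge> T / 2" for a b
        proof -
          have a: "a > 0" "T > 0" using that T1 by linarith+
          have "ln b - ln a = ln (b / a)" using a that by (subst ln_div) auto
          also have "\<dots> \<le> b / a - 1" using a that by (intro ln_le_minus_one) auto
          also have "\<dots> = (b - a) / a" using a by (simp add: field_simps)
          also have "\<dots> \<le> (b - a) / (T / 2)" using a that by (intro divide_left_mono) auto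
          finally show ?thesis .
        qed
        show ?thesis
        proof (cases "v \<le> T")
          case True
          have "ln v \<le> ln T" using True v10 T1 by (intro ln_mono) auto
          thus ?thesis using *[OF True v10(1)] True by simp
        next
          case False
          have "ln T \<le> ln v" using False v10 T1 by (intro ln_mono) auto
          thus ?thesis using *[of T v] False T1 by simp
        qed
      qed
      also have "\<dots> \<le> 2 * sqrt T * ln T / (T / 2)" using vT T1 by (intro divide_right_mono) auto
      also have "\<dots> = 4 * ln T / sqrt T"
      proof -
        have "T = sqrt T * sqrt T" using T1 by simp
        moreover have "sqrt T > 0" using T1 by simp
        ultimately show ?thesis by (simp add: field_simps)
      qed
      finally have 2: "\<bar>ln (v / (2 * pi)) - ln (T / (2 * pi))\<bar> \<le> 4 * ln T / sqrt T" .
      have "\<bar>D - l\<bar> \<le> \<bar>D - ln (v / (2 * pi)) / 2\<bar> + \<bar>ln (v / (2 * pi)) - ln (T / (2 * pi))\<bar> / 2"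
        unfolding l_def by argo
      also have "\<dots> \<le> ln T / sqrt T + (4 * ln T / sqrt T) / 2"
        using D(2) 1 2 by (intro add_mono divide_right_mono) auto
      also have "\<dots> = B" by (simp add: B_def)
      finally have "\<bar>D - l\<bar> \<le> B" .
      moreover have "((\<lambda>v. theta v - v * l) has_real_derivative D - 1 * l) (at v)"
        by (intro DERIV_diff D DERIV_cmult_right DERIV_ident)
      ultimately show ?thesis by (auto intro!: exI[of _ "D - l"] has_field_derivative_at_within)
    qed
    then obtain D where D: "\<And>v. v \<in> S \<Longrightarrow> ((\<lambda>v. theta v - v * l) has_real_derivative D v) (at v within S)"
        "\<And>v. v \<in> S \<Longrightarrow> norm (D v) \<le> B" by metis
    have "norm ((theta u - u * l) - (theta t - t * l)) \<le> B * norm (u - t)"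
      by (rule field_differentiable_bound[of S _ D]) (use D t u in \<open>auto simp: S_def\<close>)
    moreover have "(theta u - u * l) - (theta t - t * l) = theta u - theta t - (u - t) * l"
      by (simp add: algebra_simps)
    ultimately show "\<bar>theta u - theta t - (u - t) * (ln (T / (2 * pi)) / 2)\<bar> \<le> 3 * ln T / sqrt T * \<bar>u - t\<bar>"
      unfolding l_def[symmetric] B_def[symmetric] by simp
  qed
qed

lemma theta_increase:
  assumes "1000 \<le> x" "x \<le> y"
  shows "y - x \<le> theta y - theta x"
proof -
  have "theta x - x \<le> theta y - y"
  proof (rule DERIV_nonneg_imp_nondecreasing[OF assms(2)])
    fix t assume "x \<le> t" "t \<le> y"
    hence t: "t \<ge> 1000" using assms by simp
    obtain D where D: "(theta has_real_derivative D) (at t)" "\<bar>D - ln (t / (2 * pi)) / 2\<bar> \<le> 10 / t"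
      using theta_derivative_approx[of t] t by auto
    \<comment> \<open>27 is the cube of 3, and \<open>ln 3 \<ge> 1\<close>: half the logarithm is at
      least 3/2, which leaves 1/2 for the error term above the slope 1.\<close>
    have "27 \<le> 1000 / (2 * 4 :: real)" by simp
    also have "\<dots> \<le> t / (2 * pi)" using t pi_less_4 by (intro frac_le) auto
    finally have "ln (3 ^ 3) \<le> ln (t / (2 * pi))" using t by (intro ln_mono) auto
    moreover have "ln (3 ^ 3 :: real) = 3 * ln 3" using ln_realpow[of 3 3] by simp
    moreover have "ln (3 :: real) \<ge> 1" using exp_le by (simp add: ln_ge_iff)
    moreover have "10 / t \<le> 1 / 2" using t by (simp add: field_simps)
    ultimately have "D - 1 \<ge> 0" using D(2) by argo
    moreover have "((\<lambda>v. theta v - v) has_real_derivative D - 1) (at t)"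
      by (intro DERIV_diff D DERIV_ident)
    ultimately show "\<exists>y. ((\<lambda>v. theta v - v) has_real_derivative y) (at t) \<and> 0 \<le> y" by blast
  qed
  thus ?thesis by simp
qed

section \<open>Location, number and spacing of the points\<close>

lemma continuous_on_theta: "continuous_on A theta"
  by (intro continuous_at_imp_continuous_on ballI DERIV_isCont[OF theta_has_derivative_Digamma])

text \<open>Uniqueness of the described point is settled once \<open>pi * real \<nu>\<close> exceeds
  all values of \<open>theta\<close> on \<open>{0..1000}\<close>, since beyond 1000
  \<open>theta\<close> increases strictly. The finitely many smaller indices are kept out of the
  window later by taking \<open>T\<close> large.\<close>

lemma t_seq_eventually:
  obtains \<nu>\<^sub>0 where "\<And>\<nu>. \<nu> \<ge> \<nu>\<^sub>0 \<Longrightarrow> t_seq \<nu> > 1000 \<and> theta (t_seq \<nu>) = pi * real \<nu>"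
proof -
  have "compact (theta ` {0..1000})"
    by (intro compact_continuous_image continuous_on_theta) auto
  then obtain B where B: "\<And>t. t \<in> {0..1000} \<Longrightarrow> theta t \<le> B"
    using compact_imp_bounded bounded_has_Sup(1)[of "theta ` {0..1000}"]
    by (metis atLeastAtMost_iff empty_iff image_eqI image_is_empty order_refl zero_le_numeral)
  obtain \<nu>\<^sub>0 :: nat where \<nu>\<^sub>0: "B < real \<nu>\<^sub>0" using reals_Archimedean2 by blast
  show ?thesis
  proof (rule that[of \<nu>\<^sub>0])
    fix \<nu> assume \<nu>: "\<nu> \<ge> \<nu>\<^sub>0"
    have "real \<nu> \<le> pi * real \<nu>" using pi_gt3 mult_right_mono[of 1 pi "real \<nu>"] by simp
    hence b: "B < pi * real \<nu>" using \<nu>\<^sub>0 \<nu> by linarith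
    have c: "theta 1000 \<le> B" by (rule B) simp
    define y where "y = 1000 + (pi * real \<nu> - theta 1000)"
    have y: "y \<ge> 1000" using b c by (simp add: y_def)
    have "pi * real \<nu> \<le> theta y" using theta_increase[of 1000 y] y by (simp add: y_def)
    then obtain t where t: "1000 \<le> t" "t \<le> y" "theta t = pi * real \<nu>"
      using IVT'[of theta 1000 "pi * real \<nu>" y] b c y continuous_on_theta by auto
    have t1000: "t > 1000" using t b c by (cases "t = 1000") auto
    have "t_seq \<nu> = t"
      unfolding t_seq_def
    proof (rule the_equality)
      fix u assume u: "u > 0 \<and> theta u = pi * real \<nu>"
      have "u > 1000" using B[of u] u b by (cases "u > 1000") auto
      thus "u = t" using theta_increase[of u t] theta_increase[of t u] t u by (cases "u \<le> t") auto
    qed (use t in auto)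
    thus "t_seq \<nu> > 1000 \<and> theta (t_seq \<nu>) = pi * real \<nu>" using t t1000 by simp
  qed
qed

lemma card_nat_between:
  fixes a b :: real
  assumes "0 \<le> a" "a \<le> b"
  shows "finite {n :: nat. a \<le> real n \<and> real n \<le> b}"
    and "\<bar>real (card {n :: nat. a \<le> real n \<and> real n \<le> b}) - (b - a)\<bar> \<le> 1"
proof -
  have eq: "{n :: nat. a \<le> real n \<and> real n \<le> b} = {nat \<lceil>a\<rceil>..nat \<lfloor>b\<rfloor>}"
    using assms by (auto simp: nat_le_iff le_nat_iff ceiling_le_iff le_floor_iff)
  thus "finite {n :: nat. a \<le> real n \<and> real n \<le> b}" by simp
  have "\<lceil>a\<rceil> \<le> \<lfloor>b\<rfloor> + 1" using assms by linarith
  moreover have "\<lceil>a\<rceil> \<ge> 0" "\<lfloor>b\<rfloor> \<ge> 0" using assms by auto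
  ultimately have "real (card {nat \<lceil>a\<rceil>..nat \<lfloor>b\<rfloor>}) = of_int (\<lfloor>b\<rfloor> + 1 - \<lceil>a\<rceil>)"
    by (simp add: nat_diff_distrib'[symmetric] of_nat_diff nat_le_eq_zle Suc_nat_eq_nat_zadd1 add.commute)
  thus "\<bar>real (card {n :: nat. a \<le> real n \<and> real n \<le> b}) - (b - a)\<bar> \<le> 1"
    unfolding eq by simp linarith
qed

text \<open>\<open>theta\<close> sends the points \<open>t_seq\<close> to multiples of
  \<open>pi\<close>, so counting points means counting integers in an interval; its length and the
  spacing of the points both follow from the local linearity of \<open>theta\<close>.\<close>

lemma h_seq_count:
  "\<exists>T0. \<forall>T\<ge>T0. \<forall>H. 0 \<le> H \<longrightarrow> H \<le> sqrt T * ln T \<longrightarrow>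
     finite {\<nu>. \<nu> \<ge> 1 \<and> h_seq T \<nu> \<in> {T..T+H}} \<and>
     \<bar>real (card {\<nu>. \<nu> \<ge> 1 \<and> h_seq T \<nu> \<in> {T..T+H}}) - 1 / (2 * pi) * H * ln (T / (2 * pi))\<bar> \<le> 1 + 3 * ln T * ln T \<and>
     (\<forall>\<nu> \<mu>. \<nu> \<ge> 1 \<and> h_seq T \<nu> \<in> {T..T+H} \<longrightarrow> \<mu> \<ge> 1 \<and> h_seq T \<mu> \<in> {T..T+H} \<longrightarrow> \<nu> < \<mu> \<longrightarrow>
        h_seq T \<nu> + 2 / ln (T / (2 * pi)) \<le> h_seq T \<mu>)"
proof -
  obtain \<nu>\<^sub>0 where \<nu>\<^sub>0: "\<And>\<nu>. \<nu> \<ge> \<nu>\<^sub>0 \<Longrightarrow> t_seq \<nu> > 1000 \<and> theta (t_seq \<nu>) = pi * real \<nu>"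
    using t_seq_eventually by blast
  obtain T1 where lin: "\<And>T t u. T \<ge> T1 \<Longrightarrow> \<bar>t - T\<bar> \<le> 2 * sqrt T * ln T \<Longrightarrow> \<bar>u - T\<bar> \<le> 2 * sqrt T * ln T \<Longrightarrow>
     \<bar>theta u - theta t - (u - t) * (ln (T / (2 * pi)) / 2)\<bar> \<le> 3 * ln T / sqrt T * \<bar>u - t\<bar>"
    using theta_locally_linear by blast
  have "\<forall>\<^sub>F T in at_top. T \<ge> (2000::real) \<and> ln (T / (2 * pi)) \<ge> 4 \<and> ln T \<ge> 0 \<and> 3 * ln T / sqrt T \<le> 1 \<and> 1 \<le> sqrt T * ln T"
    by (intro eventually_conj) real_asymp+
  then obtain T2 where T2: "\<And>T. T \<ge> T2 \<Longrightarrow> T \<ge> (2000::real) \<and> ln (T / (2 * pi)) \<ge> 4 \<and> ln T \<ge> 0 \<and> 3 * ln T / sqrt T \<le> 1 \<and> 1 \<le> sqrt T * ln T"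
    unfolding eventually_at_top_linorder by blast
  \<comment> \<open>The shift in \<open>h_seq\<close> is at most 1 here, so for
    \<open>T \<ge> T3\<close> the uncontrolled indices have their points to the left of the
    window.\<close>
  define T3 where "T3 = Max (insert 0 (t_seq ` {..<\<nu>\<^sub>0})) + 2"
  have T3: "t_seq \<nu> \<le> T3 - 2" if "\<nu> < \<nu>\<^sub>0" for \<nu>
    unfolding T3_def using that by (simp add: Max_ge)
  \<comment> \<open>Slope at least 1 beyond 1000 lifts \<open>theta (T - d)\<close> above
    \<open>pi * real \<nu>\<^sub>0 + pi\<close>, so that all the integers counted are controlled
    indices.\<close>
  define T4 where "T4 = 1002 + \<bar>theta 1000\<bar> + pi * real \<nu>\<^sub>0 + pi"
  show ?thesis
  proof (intro exI[of _ "Max {T1, T2, T3, T4}"] allI impI)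
    fix T H :: real assume "T \<ge> Max {T1, T2, T3, T4}" and H: "0 \<le> H" "H \<le> sqrt T * ln T"
    hence T: "T \<ge> T1" "T \<ge> T2" "T \<ge> T3" "T \<ge> T4" by auto
    note t2 = T2[OF T(2)]
    define l where "l = ln (T / (2 * pi)) / 2"
    define d where "d = pi / ln (T / (2 * pi))"
    have l: "l \<ge> 2" using t2 by (simp add: l_def)
    have d: "0 < d" "d \<le> 1"
    proof -
      show "0 < d" using t2 pi_less_4 by (auto simp: d_def intro!: divide_pos_pos)
      have "pi \<le> ln (T / (2 * pi))" using t2 pi_less_4 by linarith
      thus "d \<le> 1" using t2 pi_less_4 by (auto simp: d_def divide_le_eq_1)
    qed
    define A where "A = {\<nu>. \<nu> \<ge> 1 \<and> h_seq T \<nu> \<in> {T..T+H}}"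
    have h: "h_seq T \<nu> = t_seq \<nu> + d" for \<nu> by (simp add: h_seq_def d_def)
    have A\<nu>: "\<nu> \<ge> \<nu>\<^sub>0" if "\<nu> \<in> A" for \<nu>
    proof (rule ccontr)
      assume "\<not> \<nu> \<ge> \<nu>\<^sub>0"
      hence "t_seq \<nu> \<le> T3 - 2" by (intro T3) auto
      thus False using that T d by (simp add: A_def h)
    qed
    define \<alpha> \<beta> where "\<alpha> = theta (T - d)" and "\<beta> = theta (T + H - d)"
    have win: "\<bar>v - T\<bar> \<le> 2 * sqrt T * ln T" if "v \<in> {T - d..T + H}" for v
      using that d H t2 by auto
    have pi\<alpha>: "pi * real \<nu>\<^sub>0 + pi \<le> \<alpha>"
      using theta_increase[of 1000 "T - d"] T t2 d by (simp add: \<alpha>_def T4_def)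
    have th_mono: "theta x \<le> theta y \<longleftrightarrow> x \<le> y" if "x \<ge> 1000" "y \<ge> 1000" for x y
      using theta_increase[of x y] theta_increase[of y x] that by (cases "x \<le> y") auto
    have A_eq: "A = {\<nu>. \<alpha> / pi \<le> real \<nu> \<and> real \<nu> \<le> \<beta> / pi}"
    proof (intro set_eqI)
      fix \<nu>
      show "\<nu> \<in> A \<longleftrightarrow> \<nu> \<in> {\<nu>. \<alpha> / pi \<le> real \<nu> \<and> real \<nu> \<le> \<beta> / pi}"
      proof (cases "\<nu> \<ge> \<nu>\<^sub>0 \<and> \<nu> \<ge> 1")
        case True
        hence t: "t_seq \<nu> > 1000" "theta (t_seq \<nu>) = pi * real \<nu>" using \<nu>\<^sub>0 by auto
        have "\<nu> \<in> A \<longleftrightarrow> T - d \<le> t_seq \<nu> \<and> t_seq \<nu> \<le> T + H - d" using True by (auto simp: A_def h)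
        also have "\<dots> \<longleftrightarrow> \<alpha> \<le> pi * real \<nu> \<and> pi * real \<nu> \<le> \<beta>"
          unfolding \<alpha>_def \<beta>_def t(2)[symmetric] using t t2 d H by (subst (1 2) th_mono) auto
        also have "\<dots> \<longleftrightarrow> \<nu> \<in> {\<nu>. \<alpha> / pi \<le> real \<nu> \<and> real \<nu> \<le> \<beta> / pi}"
          by (simp add: field_simps)
        finally show ?thesis .
      next
        case False
        have "\<nu> \<notin> A" using False A\<nu>[of \<nu>] by (auto simp: A_def)
        moreover have "\<not> \<alpha> / pi \<le> real \<nu>"
        proof
          assume "\<alpha> / pi \<le> real \<nu>"
          hence "\<alpha> \<le> pi * real \<nu>" by (simp add: field_simps)
          hence "pi * (real \<nu>\<^sub>0 + 1) \<le> pi * real \<nu>" using pi\<alpha> by (simp add: algebra_simps)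
          hence "real \<nu>\<^sub>0 + 1 \<le> real \<nu>" by (subst (asm) mult_le_cancel_left_pos) auto
          thus False using False by linarith
        qed
        ultimately show ?thesis by simp
      qed
    qed
    have \<alpha>\<beta>: "\<bar>\<beta> - \<alpha> - H * l\<bar> \<le> 3 * ln T / sqrt T * H"
      using lin[OF T(1) win[of "T - d"] win[of "T + H - d"]] d H by (simp add: \<alpha>_def \<beta>_def l_def)
    have \<alpha>_le: "0 \<le> \<alpha> / pi" "\<alpha> / pi \<le> \<beta> / pi"
    proof -
      have "0 \<le> pi * real \<nu>\<^sub>0 + pi" by simp
      hence "0 \<le> \<alpha>" using pi\<alpha> by linarith
      thus "0 \<le> \<alpha> / pi" by simp
      have "\<alpha> \<le> \<beta>" unfolding \<alpha>_def \<beta>_def using t2 d H by (subst th_mono) auto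
      thus "\<alpha> / pi \<le> \<beta> / pi" by (intro divide_right_mono) auto
    qed
    have 1: "finite A" unfolding A_eq by (rule card_nat_between[OF \<alpha>_le])
    have 2: "\<bar>real (card A) - 1 / (2 * pi) * H * ln (T / (2 * pi))\<bar> \<le> 1 + 3 * ln T * ln T"
    proof -
      have c: "\<bar>real (card A) - (\<beta> / pi - \<alpha> / pi)\<bar> \<le> 1" unfolding A_eq by (rule card_nat_between[OF \<alpha>_le])
      have "\<bar>(\<beta> / pi - \<alpha> / pi) - H * l / pi\<bar> = \<bar>\<beta> - \<alpha> - H * l\<bar> / pi"
        by (simp add: diff_divide_distrib[symmetric] abs_divide)
      also have "\<dots> \<le> \<bar>\<beta> - \<alpha> - H * l\<bar> / 1" using pi_gt3 by (intro divide_left_mono) auto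
      also have "\<dots> \<le> 3 * ln T / sqrt T * H" using \<alpha>\<beta> by simp
      also have "\<dots> \<le> 3 * ln T / sqrt T * (sqrt T * ln T)" using H t2 by (intro mult_left_mono) auto
      also have "\<dots> = 3 * ln T * ln T" using t2 by simp
      finally have "\<bar>(\<beta> / pi - \<alpha> / pi) - H * l / pi\<bar> \<le> 3 * ln T * ln T" .
      moreover have "H * l / pi = 1 / (2 * pi) * H * ln (T / (2 * pi))" by (simp add: l_def)
      ultimately show ?thesis using c by linarith
    qed
    have 3: "h_seq T \<nu> + 2 / ln (T / (2 * pi)) \<le> h_seq T \<mu>" if "\<nu> \<in> A" "\<mu> \<in> A" "\<nu> < \<mu>" for \<nu> \<mu>
    proof -
      have t: "t_seq \<nu> > 1000" "theta (t_seq \<nu>) = pi * real \<nu>" "t_seq \<mu> > 1000" "theta (t_seq \<mu>) = pi * real \<mu>"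
        using \<nu>\<^sub>0[OF A\<nu>[OF that(1)]] \<nu>\<^sub>0[OF A\<nu>[OF that(2)]] by auto
      have tt: "t_seq \<nu> \<in> {T - d..T + H}" "t_seq \<mu> \<in> {T - d..T + H}"
        using that d by (auto simp: A_def h)
      define \<Delta> where "\<Delta> = t_seq \<mu> - t_seq \<nu>"
      have "real \<nu> + 1 \<le> real \<mu>" using that by linarith
      hence "pi * (real \<nu> + 1) \<le> pi * real \<mu>" by (intro mult_left_mono) auto
      hence ge: "pi \<le> theta (t_seq \<mu>) - theta (t_seq \<nu>)" by (simp add: t algebra_simps)
      have \<Delta>: "\<Delta> \<ge> 0" using th_mono[of "t_seq \<nu>" "t_seq \<mu>"] t ge pi_gt_zero unfolding \<Delta>_def by linarith
      have "theta (t_seq \<mu>) - theta (t_seq \<nu>) - \<Delta> * l \<le> 3 * ln T / sqrt T * \<Delta>"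
        using lin[OF T(1) win[OF tt(1)] win[OF tt(2)]] \<Delta> unfolding \<Delta>_def l_def by linarith
      \<comment> \<open>The slope is thus at most \<open>2 * l\<close>, while \<open>theta\<close>
        rises by at least \<open>pi > 3\<close>; the distance \<open>1 / l\<close> follows with room
        to spare, the mean spacing being about \<open>pi / l\<close>.\<close>
      also have "\<dots> \<le> l * \<Delta>" using t2 l \<Delta> by (intro mult_right_mono) auto
      finally have "3 \<le> 2 * (l * \<Delta>)" using ge pi_gt3 by (simp add: algebra_simps)
      hence "1 \<le> l * \<Delta>" by simp
      hence "1 / l \<le> \<Delta>" using l by (simp add: field_simps)
      moreover have "1 / l = 2 / ln (T / (2 * pi))" by (simp add: l_def)
      ultimately show ?thesis by (simp add: h \<Delta>_def)
    qed
    show "finite {\<nu>. \<nu> \<ge> 1 \<and> h_seq T \<nu> \<in> {T..T+H}} \<and>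
     \<bar>real (card {\<nu>. \<nu> \<ge> 1 \<and> h_seq T \<nu> \<in> {T..T+H}}) - 1 / (2 * pi) * H * ln (T / (2 * pi))\<bar> \<le> 1 + 3 * ln T * ln T \<and>
     (\<forall>\<nu> \<mu>. \<nu> \<ge> 1 \<and> h_seq T \<nu> \<in> {T..T+H} \<longrightarrow> \<mu> \<ge> 1 \<and> h_seq T \<mu> \<in> {T..T+H} \<longrightarrow> \<nu> < \<mu> \<longrightarrow>
        h_seq T \<nu> + 2 / ln (T / (2 * pi)) \<le> h_seq T \<mu>)"
      using 1 2 3 unfolding A_def by blast
  qed
qed

section \<open>The interpolation defect\<close>

lemma sin_ge_half_self:
  assumes "0 \<le> v" "v \<le> pi / 2"
  shows "v / 2 \<le> sin v"
proof (cases "v \<le> pi / 3")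
  case True
  have "sin 0 - 0 / 2 \<le> sin v - v / 2"
  proof (rule DERIV_nonneg_imp_nondecreasing[OF assms(1)])
    fix u assume u: "0 \<le> u" "u \<le> v"
    have "cos (pi / 3) \<le> cos u" using u True by (intro cos_monotone_0_pi_le) auto
    hence "0 \<le> cos u - 1 / 2" by (simp add: cos_60)
    moreover have "((\<lambda>v. sin v - v / 2) has_real_derivative cos u - 1 / 2) (at u)"
      by (auto intro!: derivative_eq_intros)
    ultimately show "\<exists>y. ((\<lambda>v. sin v - v / 2) has_real_derivative y) (at u) \<and> 0 \<le> y" by blast
  qed
  thus ?thesis by simp
next
  case False
  have "sin (pi / 3) \<le> sin v" using False assms by (intro sin_monotone_2pi_le) auto
  moreover have "sin (pi / 3) = sqrt 3 / 2" by (rule sin_60)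
  moreover have "1.7 \<le> sqrt 3" by (rule real_le_rsqrt) (simp add: power2_eq_square)
  moreover have "pi < 3.2" using pi_approx by simp
  ultimately show ?thesis using assms by simp
qed

text \<open>As \<open>L\<close> grows this tends to \<open>pi / 4\<close> for \<open>v\<close>
  strictly between 0 and \<open>pi\<close>, which is the origin of the factor \<open>4 / pi\<close>
  in the interpolation formula.\<close>

definition square_wave_sum :: "nat \<Rightarrow> real \<Rightarrow> real" where
  "square_wave_sum L v = (\<Sum>p=1..L. sin ((2 * real p - 1) * v) / (2 * real p - 1))"

lemma sum_cos_odd: "2 * sin v * (\<Sum>p=1..L. cos ((2 * real p - 1) * v)) = sin (2 * real L * v)"
proof (induction L)
  case (Suc L)
  have "2 * sin v * cos ((2 * real L + 1) * v) = sin (v + (2 * real L + 1) * v) + sin (v - (2 * real L + 1) * v)"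
    by (simp only: sin_add sin_diff)
  also have "v + (2 * real L + 1) * v = 2 * real (Suc L) * v" by (simp add: algebra_simps)
  also have "v - (2 * real L + 1) * v = - (2 * real L * v)" by (simp add: algebra_simps)
  finally have "2 * sin v * cos ((2 * real L + 1) * v) = sin (2 * real (Suc L) * v) - sin (2 * real L * v)" by simp
  moreover have "2 * real (Suc L) - 1 = 2 * real L + 1" by simp
  ultimately show ?case using Suc.IH by (simp only: sum.cl_ivl_Suc) (simp add: distrib_left)
qed simp

text \<open>The base point is \<open>pi / 2\<close>, where the partial sum is a section of Leibniz'
  series with a known remainder. From there to \<open>v\<close> the derivative oscillates with
  frequency \<open>2 * L\<close>, so integration by parts gains a factor
  \<open>1 / L\<close>.\<close>

lemma square_wave_sum_variation:
  assumes v: "0 < v" "v \<le> pi / 2" and L: "L \<ge> 1"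
  shows "\<bar>square_wave_sum L v - square_wave_sum L (pi / 2)\<bar> \<le> 3 / (4 * real L * sin v)"
proof -
  \<comment> \<open>The correction cancels the oscillating derivative \<open>sin (2 L u) / (2 sin u)\<close> of the partial sum.\<close>
  define g where "g = (\<lambda>v. square_wave_sum L v + cos (2 * real L * v) / (4 * real L * sin v))"
  define G where "G = (\<lambda>v. - (1 / (4 * real L * sin v)))"
  have sp: "sin u > 0" if "u \<in> {v..pi/2}" for u using that v by (intro sin_gt_zero) auto
  have der_g: "(g has_real_derivative - (cos (2 * real L * u) * cos u / (4 * real L * sin u ^ 2))) (at u)"
    if u: "u \<in> {v..pi/2}" for u
  proof -
    have s: "sin u \<noteq> 0" using sp[OF u] by simp
    have "(square_wave_sum L has_real_derivative (\<Sum>p=1..L. cos ((2 * real p - 1) * u))) (at u)"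
      unfolding square_wave_sum_def
    proof (rule DERIV_sum)
      fix p assume "p \<in> {1..L}"
      hence "2 * real p - 1 \<noteq> 0" by auto
      thus "((\<lambda>v. sin ((2 * real p - 1) * v) / (2 * real p - 1)) has_real_derivative cos ((2 * real p - 1) * u)) (at u)"
        by (auto intro!: derivative_eq_intros)
    qed
    moreover have "(\<Sum>p=1..L. cos ((2 * real p - 1) * u)) = sin (2 * real L * u) / (2 * sin u)"
      using sum_cos_odd[of u L] s by (simp add: field_simps)
    ultimately have 1: "(square_wave_sum L has_real_derivative sin (2 * real L * u) / (2 * sin u)) (at u)" by simp
    have 2: "((\<lambda>v. cos (2 * real L * v) / (4 * real L * sin v)) has_real_derivative
        ((- sin (2 * real L * u) * (2 * real L)) * (4 * real L * sin u) - cos (2 * real L * u) * (4 * real L * cos u))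
          / ((4 * real L * sin u) * (4 * real L * sin u))) (at u)"
      using s L by (intro DERIV_divide) (auto intro!: derivative_eq_intros)
    have "sin (2 * real L * u) / (2 * sin u) + ((- sin (2 * real L * u) * (2 * real L)) * (4 * real L * sin u) - cos (2 * real L * u) * (4 * real L * cos u))
          / ((4 * real L * sin u) * (4 * real L * sin u)) = - (cos (2 * real L * u) * cos u / (4 * real L * sin u ^ 2))"
      using s L by (simp add: field_simps power2_eq_square)
    with DERIV_add[OF 1 2] show ?thesis unfolding g_def by simp
  qed
  have der_G: "(G has_real_derivative (cos u / (4 * real L * sin u ^ 2))) (at u)" if u: "u \<in> {v..pi/2}" for u
  proof -
    have s: "sin u \<noteq> 0" using sp[OF u] by simp
    show ?thesis unfolding G_def using s L
      by (auto intro!: derivative_eq_intros simp: field_simps power2_eq_square)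
  qed
  have gG: "\<bar>g (pi/2) - g v\<bar> \<le> G (pi/2) - G v"
  proof (cases "v = pi / 2")
    case False
    hence lt: "v < pi / 2" using v by simp
    have "norm (g (pi/2) - g v) \<le> G (pi/2) - G v"
    proof (rule differentiable_bound_general[OF lt])
      show "continuous_on {v..pi/2} g" "continuous_on {v..pi/2} G"
        using DERIV_isCont[OF der_g] DERIV_isCont[OF der_G] by (auto intro!: continuous_at_imp_continuous_on)
      fix u assume "v < u" "u < pi / 2"
      hence u: "u \<in> {v..pi/2}" by auto
      show "(g has_vector_derivative - (cos (2 * real L * u) * cos u / (4 * real L * sin u ^ 2))) (at u)"
        using der_g[OF u] by (simp add: has_real_derivative_iff_has_vector_derivative)
      show "(G has_vector_derivative (cos u / (4 * real L * sin u ^ 2))) (at u)"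
        using der_G[OF u] by (simp add: has_real_derivative_iff_has_vector_derivative)
      have c: "cos u \<ge> 0" using u v by (intro cos_ge_zero) auto
      have "\<bar>cos (2 * real L * u)\<bar> * (cos u / (4 * real L * sin u ^ 2)) \<le> 1 * (cos u / (4 * real L * sin u ^ 2))"
        using c by (intro mult_right_mono) auto
      thus "norm (- (cos (2 * real L * u) * cos u / (4 * real L * sin u ^ 2))) \<le> cos u / (4 * real L * sin u ^ 2)"
        using c by (simp add: abs_mult)
    qed
    thus ?thesis by simp
  next
    case True
    show ?thesis unfolding True by simp
  qed
  define s where "s = sin v"
  have s: "0 < s" "s \<le> 1" using sp[of v] v by (auto simp: s_def)
  define K where "K = 4 * real L"
  have K: "K > 0" using L by (simp add: K_def)
  have "\<bar>cos (2 * real L * v) / (K * s)\<bar> \<le> 1 / (K * s)"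
    using s K by (simp add: abs_divide divide_right_mono)
  moreover have "\<bar>cos (2 * real L * (pi/2)) / K\<bar> \<le> 1 / K"
    using K by (simp add: abs_divide divide_right_mono)
  moreover have "g (pi/2) = square_wave_sum L (pi/2) + cos (2 * real L * (pi/2)) / K"
    by (simp only: g_def K_def sin_pi_half mult_1_right)
  moreover have "g v = square_wave_sum L v + cos (2 * real L * v) / (K * s)"
    by (simp only: g_def K_def s_def)
  moreover have "G (pi/2) = - (1 / K)" "G v = - (1 / (K * s))"
    by (simp_all only: G_def K_def s_def sin_pi_half mult_1_right)
  ultimately have "\<bar>square_wave_sum L v - square_wave_sum L (pi / 2)\<bar> \<le> 3 * (1 / (K * s))"
    using gG by linarith
  thus ?thesis by (simp add: K_def s_def)
qed

lemma leibniz_pi_bound: "\<bar>square_wave_sum L (pi / 2) - pi / 4\<bar> \<le> 1 / (2 * real L + 1)"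
proof -
  define a where "a = (\<lambda>k::nat. 1 / (2 * real k + 1))"
  have Q: "square_wave_sum L (pi / 2) = (\<Sum>k<L. (-1) ^ k * a k)"
  proof -
    have "square_wave_sum L (pi / 2) = (\<Sum>p=1..L. (-1) ^ (p - 1) * a (p - 1))"
      unfolding square_wave_sum_def
    proof (intro sum.cong refl)
      fix p assume "p \<in> {1..L}"
      then obtain k where k: "p = Suc k" by (cases p) auto
      have e: "(2 * real p - 1) * (pi / 2) = pi / 2 + real k * pi" by (simp add: k algebra_simps)
      have "sin ((2 * real p - 1) * (pi / 2)) = (-1) ^ k" unfolding e sin_add by simp
      thus "sin ((2 * real p - 1) * (pi / 2)) / (2 * real p - 1) = (-1) ^ (p - 1) * a (p - 1)"
        by (simp add: a_def k)
    qed
    also have "\<dots> = (\<Sum>k<L. (-1) ^ k * a k)"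
      by (rule sum.reindex_bij_witness[of _ Suc "\<lambda>p. p - 1"]) auto
    finally show ?thesis .
  qed
  have a0: "a \<longlonglongrightarrow> 0" unfolding a_def by real_asymp
  have pos: "\<And>n. 0 \<le> a n" by (simp add: a_def)
  have mono: "\<And>n. a (Suc n) \<le> a n" by (simp add: a_def frac_le)
  note Lz = summable_Leibniz'[OF a0 pos mono]
  have s: "(\<Sum>i. (-1) ^ i * a i) = pi / 4"
    unfolding pi_series a_def by (intro suminf_cong) (simp add: mult.commute add.commute)
  have even: "(\<Sum>i<2*n. (-1) ^ i * a i) \<le> pi / 4" for n using Lz(2)[of n] s by simp
  have odd: "pi / 4 \<le> (\<Sum>i<2*n+1. (-1) ^ i * a i)" for n using Lz(4)[of n] s by simp
  have "\<bar>(\<Sum>k<L. (-1) ^ k * a k) - pi / 4\<bar> \<le> a L"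
  proof (cases "even L")
    case True
    then obtain n where n: "L = 2 * n" by auto
    show ?thesis using even[of n] odd[of n] by (simp add: n)
  next
    case False
    then obtain n where n: "L = 2 * n + 1" by (elim oddE)
    show ?thesis using even[of "Suc n"] odd[of n] by (simp add: n)
  qed
  thus ?thesis unfolding Q by (simp add: a_def)
qed

lemma square_wave_coefficient_bounds:
  assumes v: "0 \<le> v" "v \<le> pi / 2" and L: "L \<ge> 1"
  shows "\<bar>1 - 4 / pi * square_wave_sum L v\<bar> \<le> 4"
    and "v > 0 \<Longrightarrow> \<bar>1 - 4 / pi * square_wave_sum L v\<bar> \<le> 4 / (real L * v)"
proof -
  have conv: "\<bar>1 - 4 / pi * x\<bar> \<le> 4 / 3 * \<bar>x - pi / 4\<bar>" for x
  proof -
    have "1 - 4 / pi * x = 4 / pi * (pi / 4 - x)" by (simp add: algebra_simps)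
    hence "\<bar>1 - 4 / pi * x\<bar> = \<bar>4 / pi\<bar> * \<bar>pi / 4 - x\<bar>" by (simp only: abs_mult)
    hence "\<bar>1 - 4 / pi * x\<bar> = 4 / pi * \<bar>x - pi / 4\<bar>" by (simp only: abs_minus_commute) simp
    also have "\<dots> \<le> 4 / 3 * \<bar>x - pi / 4\<bar>" using pi_gt3 by (intro mult_right_mono divide_left_mono) auto
    finally show ?thesis .
  qed
  have b: "\<bar>1 - 4 / pi * square_wave_sum L v\<bar> \<le> 4 / (real L * v)" if vp: "v > 0"
  proof -
    have sv: "v / 2 \<le> sin v" by (rule sin_ge_half_self) (use v in auto)
    have "\<bar>square_wave_sum L v - pi / 4\<bar> \<le> 3 / (4 * real L * sin v) + 1 / (2 * real L + 1)"
      using square_wave_sum_variation[OF vp v(2) L] leibniz_pi_bound[of L] by linarith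
    also have "3 / (4 * real L * sin v) \<le> 3 / (4 * real L * (v / 2))"
      using sv vp L by (intro divide_left_mono mult_left_mono mult_pos_pos) auto
    also have "1 / (2 * real L + 1) \<le> 1 / (real L * v)"
    proof (intro divide_left_mono mult_pos_pos)
      have "real L * v \<le> real L * 2" using v pi_less_4 by (intro mult_left_mono) auto
      thus "real L * v \<le> 2 * real L + 1" by simp
    qed (use vp L in auto)
    also have "3 / (4 * real L * (v / 2)) + 1 / (real L * v) = 5 / 2 * (1 / (real L * v))" using vp L by (simp add: field_simps)
    finally have c: "\<bar>square_wave_sum L v - pi / 4\<bar> \<le> 5 / 2 * (1 / (real L * v))" by simp
    have "\<bar>1 - 4 / pi * square_wave_sum L v\<bar> \<le> 4 / 3 * (5 / 2 * (1 / (real L * v)))"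
      by (rule order_trans[OF conv]) (intro mult_left_mono c, simp)
    also have "\<dots> \<le> 4 * (1 / (real L * v))"
    proof -
      have "4 / 3 * (5 / 2 * x) \<le> 4 * x" if "0 \<le> x" for x :: real using that by simp
      from this[of "1 / (real L * v)"] show ?thesis using vp by simp
    qed
    finally show ?thesis by simp
  qed
  show "v > 0 \<Longrightarrow> \<bar>1 - 4 / pi * square_wave_sum L v\<bar> \<le> 4 / (real L * v)" by (rule b)
  show "\<bar>1 - 4 / pi * square_wave_sum L v\<bar> \<le> 4"
  proof (cases "real L * v \<ge> 1")
    case True
    hence "v > 0" using v by (cases "v = 0") auto
    note b[OF this]
    also have "4 / (real L * v) \<le> 4 / 1" using True by (intro divide_left_mono) auto
    finally show ?thesis by simp
  next
    case False
    \<comment> \<open>Close to the jump at 0 the partial sums do not approach the wave uniformly;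
      but there each of the \<open>L\<close> terms is at most \<open>v\<close>, so the sum stays
      below 1.\<close>
    have "\<bar>square_wave_sum L v\<bar> \<le> (\<Sum>p=1..L. v)"
      unfolding square_wave_sum_def
    proof (rule order_trans[OF sum_abs], rule sum_mono)
      fix p assume "p \<in> {1..L}"
      hence p: "2 * real p - 1 > 0" by auto
      have "\<bar>sin ((2 * real p - 1) * v)\<bar> \<le> \<bar>(2 * real p - 1) * v\<bar>" by (rule abs_sin_x_le_abs_x)
      also have "\<dots> = v * (2 * real p - 1)" using p v by (simp add: abs_mult)
      finally show "\<bar>sin ((2 * real p - 1) * v) / (2 * real p - 1)\<bar> \<le> v"
        using p by (simp add: pos_divide_le_eq)
    qed
    also have "\<dots> \<le> 1" using False by simp
    finally have "\<bar>square_wave_sum L v - pi / 4\<bar> \<le> 2" using pi_gt3 pi_less_4 by linarith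
    hence "4 / 3 * \<bar>square_wave_sum L v - pi / 4\<bar> \<le> 4" by simp
    thus ?thesis by (rule order_trans[OF conv])
  qed
qed

text \<open>The source of the alternating signs in the interpolation formula: the phase of the
  \<open>n\<close>-th term at shift \<open>tau_bar T p\<close> is an odd multiple of
  \<open>pi / 2 - v\<close>, and the sign makes every harmonic enter as a sine of
  \<open>v\<close>.\<close>

lemma cos_odd_mult_complement:
  assumes "p \<ge> 1"
  shows "cos ((2 * real p - 1) * (pi / 2 - v)) = (-1) ^ (p + 1) * sin ((2 * real p - 1) * v)"
proof -
  obtain k where k: "p = Suc k" using assms by (cases p) auto
  have e: "(2 * real p - 1) * (pi / 2 - v) = (pi / 2 - (2 * real p - 1) * v) + real k * pi"
    by (simp add: k algebra_simps)
  have "cos ((2 * real p - 1) * (pi / 2 - v)) = (-1) ^ k * cos (pi / 2 - (2 * real p - 1) * v)"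
    unfolding e cos_add by simp
  also have "cos (pi / 2 - (2 * real p - 1) * v) = sin ((2 * real p - 1) * v)"
    using sin_cos_eq[of "(2 * real p - 1) * v"] by simp
  finally show ?thesis by (simp add: k)
qed

text \<open>The factor left on the \<open>n\<close>-th term of the main sum when the interpolation
  sum is subtracted. The argument of the wave runs from 0 to \<open>pi / 2\<close> as
  \<open>n\<close> runs from 1 to the cutoff \<open>sqrt (T / (2 * pi))\<close>; hence the term
  \<open>n = 1\<close> sits exactly at the jump.\<close>

definition defect_coeff :: "real \<Rightarrow> nat \<Rightarrow> nat \<Rightarrow> real" where
  "defect_coeff T L n = 1 - 4 / pi * square_wave_sum L (pi * ln (real n) / ln (T / (2 * pi)))"

definition defect_poly :: "real \<Rightarrow> nat \<Rightarrow> real \<Rightarrow> complex" where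
  "defect_poly T L t = (\<Sum>n=1..nat \<lfloor>sqrt (T / (2 * pi))\<rfloor>. of_real (defect_coeff T L n) * of_nat n powr (- (1/2 + \<i> * t)))"

section \<open>Linearised phases and the pointwise defect\<close>

lemma norm_exp_i_diff_le: "norm (exp (\<i> * of_real x) - exp (\<i> * of_real y)) \<le> \<bar>x - y\<bar>"
proof -
  have "exp (\<i> * of_real x) - exp (\<i> * of_real y) = exp (\<i> * of_real y) * (exp (\<i> * of_real (x - y)) - 1)"
    by (simp add: right_diff_distrib exp_add[symmetric])
  hence "norm (exp (\<i> * of_real x) - exp (\<i> * of_real y)) = norm (exp (\<i> * of_real (x - y)) - 1)"
    by (simp only: norm_mult norm_exp_i_times mult_1)
  also have "\<dots> = 2 * \<bar>sin ((x - y) / 2)\<bar>" by (rule dist_exp_i_1)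
  also have "\<dots> \<le> 2 * \<bar>(x - y) / 2\<bar>" by (intro mult_left_mono abs_sin_x_le_abs_x) auto
  finally show ?thesis by simp
qed

text \<open>For a linear phase the interpolation formula is an exact trigonometric identity with
  \<open>defect_poly\<close> as its error. Passing from \<open>Z\<close> to the linear model costs
  \<open>O(L)\<close> at each of the shifted points; the weights are at most 1, so the total is
  \<open>O(L ^ 2)\<close>.\<close>

lemma interpolation_defect:
  "\<exists>T0. \<forall>T\<ge>T0. \<forall>L h. 1 \<le> L \<longrightarrow> real L \<le> ln T \<longrightarrow> \<bar>h - T\<bar> \<le> sqrt T * ln T \<longrightarrow>
     norm (riemann_Z h - of_real (4 / pi) * (\<Sum>p=1..L. (-1) ^ (p + 1) / (2 * of_nat p - 1) *
              ((riemann_Z (h + tau_bar T p) + riemann_Z (h - tau_bar T p)) / 2)))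
       \<le> 2 * norm (defect_poly T L h) + 300 * real L ^ 2"
proof -
  obtain T1 where Zap: "\<And>T t. T \<ge> T1 \<Longrightarrow> \<bar>t - T\<bar> \<le> 2 * sqrt T * ln T \<Longrightarrow>
     norm (riemann_Z t - (exp (\<i> * theta t) * zsum (nat \<lfloor>sqrt (T / (2 * pi))\<rfloor>) t
        + cnj (exp (\<i> * theta t) * zsum (nat \<lfloor>sqrt (T / (2 * pi))\<rfloor>) t))) \<le> 43"
    using riemann_Z_approx by blast
  obtain T2 where lin: "\<And>T t u. T \<ge> T2 \<Longrightarrow> \<bar>t - T\<bar> \<le> 2 * sqrt T * ln T \<Longrightarrow> \<bar>u - T\<bar> \<le> 2 * sqrt T * ln T \<Longrightarrow>
     \<bar>theta u - theta t - (u - t) * (ln (T / (2 * pi)) / 2)\<bar> \<le> 3 * ln T / sqrt T * \<bar>u - t\<bar>"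
    using theta_locally_linear by blast
  have "\<forall>\<^sub>F T in at_top. T \<ge> (100::real) \<and> ln (T / (2 * pi)) \<ge> 1 \<and> ln T \<le> 2 * ln (T / (2 * pi)) \<and> 16 \<le> sqrt T * ln T \<and> ln T \<ge> 0"
    by (intro eventually_conj) real_asymp+
  then obtain T3 where T3: "\<And>T. T \<ge> T3 \<Longrightarrow> T \<ge> (100::real) \<and> ln (T / (2 * pi)) \<ge> 1 \<and> ln T \<le> 2 * ln (T / (2 * pi)) \<and> 16 \<le> sqrt T * ln T \<and> ln T \<ge> 0"
    unfolding eventually_at_top_linorder by blast
  show ?thesis
  proof (intro exI[of _ "Max {T1, T2, T3}"] allI impI)
    fix T h :: real and L :: nat
    assume "T \<ge> Max {T1, T2, T3}" and L: "1 \<le> L" "real L \<le> ln T" and h: "\<bar>h - T\<bar> \<le> sqrt T * ln T"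
    hence T: "T \<ge> T1" "T \<ge> T2" "T \<ge> T3" by auto
    note t3 = T3[OF T(3)]
    define l where "l = ln (T / (2 * pi)) / 2"
    define M where "M = nat \<lfloor>sqrt (T / (2 * pi))\<rfloor>"
    define e0 where "e0 = exp (\<i> * theta h)"
    define zz where "zz = (\<lambda>n::nat. of_nat n powr (- (1/2 + \<i> * h)) :: complex)"
    \<comment> \<open>The main sum at \<open>h + u\<close> with \<open>theta (h + u)\<close>
      replaced by \<open>theta h + u * l\<close>.\<close>
    define W where "W = (\<lambda>u. e0 * (\<Sum>n=1..M. zz n * exp (\<i> * of_real (u * (l - ln (real n))))))"
    have l: "l \<ge> 1/2" "ln T \<le> 4 * l" using t3 by (auto simp: l_def)
    have tau: "tau_bar T p = (2 * real p - 1) * pi / (2 * l)" for p by (simp add: tau_bar_def l_def)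
    have MT: "real M \<le> sqrt T"
    proof -
      have "real M \<le> sqrt (T / (2 * pi))" unfolding M_def using t3 by simp
      also have "\<dots> \<le> sqrt (T / 1)" using t3 pi_gt3 by (intro real_sqrt_le_mono divide_left_mono) auto
      finally show ?thesis by simp
    qed
    have hw: "\<bar>h - T\<bar> \<le> 2 * sqrt T * ln T" using h t3 by linarith
    have R: "norm (riemann_Z (h + u) - (W u + cnj (W u))) \<le> 43 + 80 * real L" if u: "\<bar>u\<bar> \<le> real L * pi / l" for u
    proof -
      \<comment> \<open>Because \<open>L \<le> ln T \<le> 4 * l\<close>, the shifts stay below 16,
        and all evaluation points remain inside the doubled window.\<close>
      have "real L * pi / l \<le> (4 * l) * 4 / l"
        using L l pi_less_4 by (intro divide_right_mono mult_mono) auto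
      hence "\<bar>u\<bar> \<le> 16" using u l by simp
      hence uw: "\<bar>(h + u) - T\<bar> \<le> 2 * sqrt T * ln T" using h t3 by linarith
      have shift: "of_nat n powr (- (1/2 + \<i> * (h + u))) = zz n * exp (- (\<i> * of_real (u * ln (real n))))"
        if "n \<in> {1..M}" for n
      proof -
        have n: "of_nat n \<noteq> (0 :: complex)" using that by simp
        have "Ln (of_nat n) = of_real (ln (real n))" using that Ln_of_real[of "real n"] by simp
        thus ?thesis unfolding zz_def powr_def using n by (simp add: exp_add[symmetric] algebra_simps)
      qed
      have "W u = exp (\<i> * of_real (theta h + u * l)) * zsum M (h + u)"
        unfolding W_def zsum_def e0_def sum_distrib_left
      proof (intro sum.cong refl)
        fix n assume n: "n \<in> {1..M}"
        have e: "exp (\<i> * theta h) * exp (\<i> * of_real (u * (l - ln (real n)))) =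
               exp (\<i> * of_real (theta h + u * l)) * exp (- (\<i> * of_real (u * ln (real n))))"
          unfolding exp_add[symmetric] by (rule arg_cong[of _ _ exp]) (simp add: algebra_simps)
        show "exp (\<i> * theta h) * (zz n * exp (\<i> * of_real (u * (l - ln (real n))))) =
              exp (\<i> * of_real (theta h + u * l)) * of_nat n powr (- (1/2 + \<i> * (h + u)))"
          unfolding shift[OF n] using e by (metis mult.assoc mult.commute)
      qed
      hence "exp (\<i> * theta (h + u)) * zsum M (h + u) - W u =
               (exp (\<i> * of_real (theta (h + u))) - exp (\<i> * of_real (theta h + u * l))) * zsum M (h + u)"
        by (simp add: left_diff_distrib)
      hence "norm (exp (\<i> * theta (h + u)) * zsum M (h + u) - W u) \<le> \<bar>theta (h + u) - (theta h + u * l)\<bar> * real M"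
        using norm_exp_i_diff_le[of "theta (h + u)" "theta h + u * l"] norm_zsum_le[of M "h + u"]
        by (simp only: norm_mult) (intro mult_mono, auto)
      \<comment> \<open>The sum is estimated by its number of terms, at most \<open>sqrt T\<close>,
        which the factor \<open>1 / sqrt T\<close> of the slope error compensates.\<close>
      also have "\<dots> \<le> (3 * ln T / sqrt T * \<bar>u\<bar>) * sqrt T"
        using lin[OF T(2) hw uw] MT t3 by (intro mult_mono) (auto simp: l_def algebra_simps)
      also have "\<dots> = 3 * ln T * \<bar>u\<bar>" using t3 by simp
      also have "\<dots> \<le> 3 * (4 * l) * (real L * pi / l)" using l u t3 by (intro mult_mono) auto
      also have "\<dots> = 12 * pi * real L" using l by simp
      also have "\<dots> \<le> 40 * real L" using pi_approx by (intro mult_right_mono) auto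
      finally have w: "norm (exp (\<i> * theta (h + u)) * zsum M (h + u) - W u) \<le> 40 * real L" .
      let ?V = "exp (\<i> * theta (h + u)) * zsum M (h + u)"
      have "riemann_Z (h + u) - (W u + cnj (W u)) = (riemann_Z (h + u) - (?V + cnj ?V)) + ((?V - W u) + cnj (?V - W u))"
        by (simp only: complex_cnj_diff) simp
      also have "norm \<dots> \<le> 43 + (40 * real L + 40 * real L)"
        using Zap[OF T(1) uw] w unfolding M_def[symmetric] by (intro norm_triangle_mono) (simp_all only: complex_mod_cnj)
      finally show ?thesis by simp
    qed
    define c where "c = (\<lambda>p::nat. (-1) ^ (p + 1) / (2 * of_nat p - 1) :: complex)"
    have nc: "norm (c p) \<le> 1" if "p \<in> {1..L}" for p
    proof -
      have "norm (2 * of_nat p - 1 :: complex) = 2 * real p - 1"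
      proof -
        have "(2 * of_nat p - 1 :: complex) = of_real (2 * real p - 1)" by simp
        thus ?thesis using that by (simp only: norm_of_real) simp
      qed
      thus ?thesis using that by (simp add: c_def norm_divide norm_power)
    qed
    have tau_le: "\<bar>tau_bar T p\<bar> \<le> real L * pi / l" if "p \<in> {1..L}" for p
    proof -
      have "tau_bar T p \<ge> 0" unfolding tau using that l by auto
      moreover have "tau_bar T p \<le> (2 * real L) * pi / (2 * l)"
        unfolding tau using that l by (intro divide_right_mono mult_right_mono) auto
      ultimately show ?thesis by simp
    qed
    define E where "E = (\<lambda>u. riemann_Z (h + u) - (W u + cnj (W u)))"
    have main: "W 0 - of_real (4 / pi) * (\<Sum>p=1..L. c p * ((W (tau_bar T p) + W (- tau_bar T p)) / 2)) = e0 * defect_poly T L h"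
    proof -
      \<comment> \<open>Symmetric shifts turn the exponentials into cosines. These are real, so the
        conjugate half of \<open>Z\<close> receives the same coefficients.\<close>
      have avg: "(W (tau_bar T p) + W (- tau_bar T p)) / 2 = e0 * (\<Sum>n=1..M. zz n * of_real (cos (tau_bar T p * (l - ln (real n)))))" for p
      proof -
        have "W u + W (- u) = e0 * (\<Sum>n=1..M. zz n * of_real (2 * cos (u * (l - ln (real n)))))" for u
        proof -
          have "exp (\<i> * of_real x) + exp (\<i> * of_real (- x)) = of_real (2 * cos x)" for x
            by (simp add: complex_eq_iff Re_exp Im_exp)
          hence z2: "zz n * exp (\<i> * of_real (u * (l - ln (real n)))) + zz n * exp (\<i> * of_real (- u * (l - ln (real n)))) =
                 zz n * of_real (2 * cos (u * (l - ln (real n))))" for n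
            unfolding distrib_left[symmetric] by (metis mult_minus_left)
          have "W u + W (- u) = e0 * (\<Sum>n=1..M. zz n * exp (\<i> * of_real (u * (l - ln (real n)))) + zz n * exp (\<i> * of_real (- u * (l - ln (real n)))))"
            by (simp only: W_def sum.distrib distrib_left)
          thus ?thesis by (simp only: z2)
        qed
        from this[of "tau_bar T p"] show ?thesis by (simp add: sum_distrib_left mult_ac)
      qed
      have cosv: "cos (tau_bar T p * (l - ln (real n))) = (-1) ^ (p + 1) * sin ((2 * real p - 1) * (pi * ln (real n) / ln (T / (2 * pi))))"
        if "p \<in> {1..L}" for p n
      proof -
        have "tau_bar T p * (l - ln (real n)) = (2 * real p - 1) * (pi / 2 - pi * ln (real n) / ln (T / (2 * pi)))"
        proof -
          have "ln (T / (2 * pi)) = 2 * l" by (simp add: l_def)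
          thus ?thesis unfolding tau using l by (simp add: field_simps)
        qed
        thus ?thesis using cos_odd_mult_complement[of p] that by simp
      qed
      have cc: "c p * of_real ((-1) ^ (p + 1) * x) = of_real (x / (2 * real p - 1))" for p x
      proof -
        have "((-1) ^ (p + 1) :: complex) * (-1) ^ (p + 1) = 1" by (simp add: power_mult_distrib[symmetric])
        thus ?thesis by (simp add: c_def field_simps)
      qed
      have "(\<Sum>p=1..L. c p * ((W (tau_bar T p) + W (- tau_bar T p)) / 2)) =
         (\<Sum>p=1..L. e0 * (\<Sum>n=1..M. zz n * (c p * of_real (cos (tau_bar T p * (l - ln (real n)))))))"
        unfolding avg by (simp add: sum_distrib_left mult_ac)
      also have "\<dots> = (\<Sum>p=1..L. e0 * (\<Sum>n=1..M. zz n * of_real (sin ((2 * real p - 1) * (pi * ln (real n) / ln (T / (2 * pi)))) / (2 * real p - 1))))"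
        by (intro sum.cong refl) (simp only: cosv cc)
      also have "\<dots> = e0 * (\<Sum>n=1..M. zz n * of_real (square_wave_sum L (pi * ln (real n) / ln (T / (2 * pi)))))"
        unfolding square_wave_sum_def of_real_sum sum_distrib_left by (subst sum.swap) simp
      finally have S: "(\<Sum>p=1..L. c p * ((W (tau_bar T p) + W (- tau_bar T p)) / 2)) =
          e0 * (\<Sum>n=1..M. zz n * of_real (square_wave_sum L (pi * ln (real n) / ln (T / (2 * pi)))))" .
      have "W 0 = e0 * (\<Sum>n=1..M. zz n)" by (simp add: W_def)
      moreover have "defect_poly T L h = (\<Sum>n=1..M. zz n) - of_real (4 / pi) * (\<Sum>n=1..M. zz n * of_real (square_wave_sum L (pi * ln (real n) / ln (T / (2 * pi)))))"
        unfolding defect_poly_def M_def[symmetric] zz_def defect_coeff_def sum_distrib_left sum_subtractf[symmetric]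
        by (intro sum.cong refl) (simp add: algebra_simps)
      ultimately show ?thesis unfolding S by (simp only: right_diff_distrib) (simp add: mult_ac)
    qed
    have cc: "cnj (c p) = c p" for p by (simp add: c_def)
    define Y where "Y = W 0 - of_real (4 / pi) * (\<Sum>p=1..L. c p * ((W (tau_bar T p) + W (- tau_bar T p)) / 2))"
    have cY: "cnj Y = cnj (W 0) - of_real (4 / pi) * (\<Sum>p=1..L. c p * ((cnj (W (tau_bar T p)) + cnj (W (- tau_bar T p))) / 2))"
      by (simp add: Y_def cc)
    have decomp: "riemann_Z h - of_real (4 / pi) * (\<Sum>p=1..L. c p * ((riemann_Z (h + tau_bar T p) + riemann_Z (h - tau_bar T p)) / 2))
       = (Y + cnj Y) + (E 0 - of_real (4 / pi) * (\<Sum>p=1..L. c p * ((E (tau_bar T p) + E (- tau_bar T p)) / 2)))"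
    proof -
      have Zu: "riemann_Z (h + u) = W u + cnj (W u) + E u" for u by (simp add: E_def)
      have "riemann_Z h = W 0 + cnj (W 0) + E 0" using Zu[of 0] by simp
      moreover have "riemann_Z (h - u) = W (- u) + cnj (W (- u)) + E (- u)" for u using Zu[of "- u"] by simp
      moreover have "(\<Sum>p=1..L. c p * ((W (tau_bar T p) + cnj (W (tau_bar T p)) + E (tau_bar T p) + (W (- tau_bar T p) + cnj (W (- tau_bar T p)) + E (- tau_bar T p))) / 2))
         = (\<Sum>p=1..L. c p * ((W (tau_bar T p) + W (- tau_bar T p)) / 2)) + (\<Sum>p=1..L. c p * ((cnj (W (tau_bar T p)) + cnj (W (- tau_bar T p))) / 2))
           + (\<Sum>p=1..L. c p * ((E (tau_bar T p) + E (- tau_bar T p)) / 2))"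
        unfolding sum.distrib[symmetric] by (intro sum.cong refl) (simp add: field_simps)
      ultimately show ?thesis unfolding Zu cY unfolding Y_def by (simp only: distrib_left) simp
    qed
    have E0: "norm (E u) \<le> 43 + 80 * real L" if "\<bar>u\<bar> \<le> real L * pi / l" for u
      unfolding E_def by (rule R[OF that])
    have sumE: "norm (\<Sum>p=1..L. c p * ((E (tau_bar T p) + E (- tau_bar T p)) / 2)) \<le> real L * (43 + 80 * real L)"
    proof -
      have "norm (\<Sum>p=1..L. c p * ((E (tau_bar T p) + E (- tau_bar T p)) / 2)) \<le> (\<Sum>p=1..L. 43 + 80 * real L)"
      proof (rule sum_norm_le)
        fix p assume p: "p \<in> {1..L}"
        have "norm (E (tau_bar T p) + E (- tau_bar T p)) \<le> 2 * (43 + 80 * real L)"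
          using norm_triangle_ineq[of "E (tau_bar T p)" "E (- tau_bar T p)"] E0[of "tau_bar T p"] E0[of "- tau_bar T p"] tau_le[OF p]
          by simp
        hence "norm (c p) * norm ((E (tau_bar T p) + E (- tau_bar T p)) / 2) \<le> 1 * (43 + 80 * real L)"
          using nc[OF p] by (intro mult_mono) (auto simp: norm_divide)
        thus "norm (c p * ((E (tau_bar T p) + E (- tau_bar T p)) / 2)) \<le> 43 + 80 * real L" by (simp only: norm_mult mult_1)
      qed
      thus ?thesis by simp
    qed
    have "norm (riemann_Z h - of_real (4 / pi) * (\<Sum>p=1..L. c p * ((riemann_Z (h + tau_bar T p) + riemann_Z (h - tau_bar T p)) / 2)))
      \<le> (norm Y + norm (cnj Y)) + ((43 + 80 * real L) + 4 / pi * (real L * (43 + 80 * real L)))"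
      unfolding decomp
    proof (intro norm_triangle_mono norm_triangle_ineq)
      have "0 \<le> real L * pi / l" using l by simp
      hence "norm (E 0) \<le> 43 + 80 * real L" by (intro E0) simp
      moreover have "norm (of_real (4 / pi) * (\<Sum>p=1..L. c p * ((E (tau_bar T p) + E (- tau_bar T p)) / 2))) \<le> 4 / pi * (real L * (43 + 80 * real L))"
        unfolding norm_mult norm_of_real using sumE by (intro mult_mono) auto
      ultimately show "norm (E 0 - of_real (4 / pi) * (\<Sum>p=1..L. c p * ((E (tau_bar T p) + E (- tau_bar T p)) / 2)))
        \<le> (43 + 80 * real L) + 4 / pi * (real L * (43 + 80 * real L))"
        by (intro order_trans[OF norm_triangle_ineq4] add_mono)
    qed simp_all
    also have "norm (cnj Y) = norm Y" by simp
    also have "norm Y = norm (defect_poly T L h)"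
      unfolding Y_def main by (simp add: norm_mult e0_def)
    finally have fin: "norm (riemann_Z h - of_real (4 / pi) * (\<Sum>p=1..L. c p * ((riemann_Z (h + tau_bar T p) + riemann_Z (h - tau_bar T p)) / 2)))
      \<le> (norm (defect_poly T L h) + norm (defect_poly T L h)) + ((43 + 80 * real L) + 4 / pi * (real L * (43 + 80 * real L)))" .
    have "4 / pi * (real L * (43 + 80 * real L)) \<le> 4 / 3 * (real L * (43 + 80 * real L))"
      using pi_gt3 by (intro mult_right_mono divide_left_mono) auto
    hence "norm (riemann_Z h - of_real (4 / pi) * (\<Sum>p=1..L. c p * ((riemann_Z (h + tau_bar T p) + riemann_Z (h - tau_bar T p)) / 2)))
      \<le> 2 * norm (defect_poly T L h) + ((43 + 80 * real L) + 4 / 3 * (real L * (43 + 80 * real L)))"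
      using fin by linarith
    \<comment> \<open>With \<open>1 \<le> L\<close> every term is at most its constant times
      \<open>L ^ 2\<close>, and the constants add up to 287.\<close>
    moreover have "(43 + 80 * real L) + 4 / 3 * (real L * (43 + 80 * real L)) \<le> 300 * real L ^ 2"
    proof -
      have "1 \<le> real L" using L by simp
      hence "real L \<le> real L ^ 2" "1 \<le> real L ^ 2" by (simp_all add: power2_eq_square mult_ge1_I)
      thus ?thesis by (simp add: algebra_simps power2_eq_square)
    qed
    ultimately show "norm (riemann_Z h - of_real (4 / pi) * (\<Sum>p=1..L. (-1) ^ (p + 1) / (2 * of_nat p - 1) *
              ((riemann_Z (h + tau_bar T p) + riemann_Z (h - tau_bar T p)) / 2)))
       \<le> 2 * norm (defect_poly T L h) + 300 * real L ^ 2"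
      unfolding c_def by linarith
  qed
qed

section \<open>Mean squares of Dirichlet polynomials\<close>

lemma harm_le_ln: "n \<ge> 1 \<Longrightarrow> harm n \<le> 1 + ln (real n)"
proof -
  assume "n \<ge> 1"
  then obtain k where k: "n = Suc k" by (cases n) auto
  have "harm (Suc k) - ln (real (Suc k)) \<le> harm (Suc 0) - ln (real (Suc 0))"
    using decseqD[OF decseq_harm_diff_ln, of 0 k] by simp
  thus ?thesis by (simp add: k harm_expand)
qed

text \<open>The square is expanded and each off-diagonal integral is bounded by 2 over its
  frequency, without exploiting cancellation. With the frequencies \<open>ln n\<close> this costs a
  logarithm, which is harmless here: the diagonal sum of \<open>1 / n\<close> carries a logarithm as
  well.\<close>

lemma mean_value_exponential_sum:
  fixes a freq :: "nat \<Rightarrow> real"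
  assumes N: "finite N" and inj: "inj_on freq N" and AB: "A \<le> B"
  shows "integral {A..B} (\<lambda>t. (norm (\<Sum>n\<in>N. of_real (a n) * exp (- (\<i> * of_real (freq n * t))))) ^ 2)
     \<le> (B - A) * (\<Sum>n\<in>N. a n ^ 2) + (\<Sum>m\<in>N. \<Sum>n\<in>N - {m}. 2 * (\<bar>a m\<bar> * \<bar>a n\<bar> / \<bar>freq m - freq n\<bar>))"
proof -
  define f where "f = (\<lambda>t. \<Sum>n\<in>N. of_real (a n) * exp (- (\<i> * of_real (freq n * t))))"
  define r where "r = (\<lambda>t. (norm (f t)) ^ 2)"
  define J where "J = (\<lambda>x. if x = 0 then of_real (B - A) else (exp (- (\<i> * of_real (x * B))) - exp (- (\<i> * of_real (x * A)))) / (- \<i> * of_real x))"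
  have J: "((\<lambda>t. exp (- (\<i> * of_real (x * t)))) has_integral J x) {A..B}" for x
  proof (cases "x = 0")
    case True
    have "((\<lambda>t. 1 :: complex) has_integral of_real (B - A)) {A..B}"
      using has_integral_const_real[of "1 :: complex" A B] AB by (simp add: scaleR_conv_of_real)
    thus ?thesis using True by (simp add: J_def)
  next
    case False
    have "((\<lambda>t. exp (- (\<i> * of_real (x * t)))) has_integral
        (exp (- (\<i> * of_real (x * B))) / (- \<i> * of_real x) - exp (- (\<i> * of_real (x * A))) / (- \<i> * of_real x))) {A..B}"
    proof (rule fundamental_theorem_of_calculus[OF AB])
      fix t assume "t \<in> {A..B}"
      have "((\<lambda>z. exp (- (\<i> * (of_real x * z))) / (- \<i> * of_real x)) has_field_derivative exp (- (\<i> * (of_real x * of_real t)))) (at (of_real t))"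
        using False by (auto intro!: derivative_eq_intros simp: field_simps)
      from has_vector_derivative_real_field[OF this]
      show "((\<lambda>t. exp (- (\<i> * of_real (x * t))) / (- \<i> * of_real x)) has_vector_derivative exp (- (\<i> * of_real (x * t)))) (at t within {A..B})"
        by (simp add: has_vector_derivative_at_within)
    qed
    thus ?thesis using False by (simp add: J_def diff_divide_distrib)
  qed
  have Jn: "norm (J x) \<le> 2 / \<bar>x\<bar>" if "x \<noteq> 0" for x
  proof -
    have "norm (exp (- (\<i> * of_real (x * B))) - exp (- (\<i> * of_real (x * A)))) \<le> 1 + 1"
      by (rule order_trans[OF norm_triangle_ineq4]) simp
    thus ?thesis using that by (simp add: J_def norm_divide norm_mult divide_right_mono)
  qed
  have sq: "of_real (r t) = (\<Sum>m\<in>N. \<Sum>n\<in>N. of_real (a m * a n) * exp (- (\<i> * of_real ((freq m - freq n) * t))))" for t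
  proof -
    have "of_real (r t) = f t * cnj (f t)" by (simp only: r_def complex_norm_square)
    also have "cnj (f t) = (\<Sum>n\<in>N. of_real (a n) * exp (\<i> * of_real (freq n * t)))"
      by (simp add: f_def exp_cnj)
    finally have "of_real (r t) = (\<Sum>m\<in>N. \<Sum>n\<in>N. (of_real (a m) * exp (- (\<i> * of_real (freq m * t)))) * (of_real (a n) * exp (\<i> * of_real (freq n * t))))"
      by (simp only: f_def sum_product)
    also have "\<dots> = (\<Sum>m\<in>N. \<Sum>n\<in>N. of_real (a m * a n) * exp (- (\<i> * of_real ((freq m - freq n) * t))))"
    proof (intro sum.cong refl)
      fix m n
      have "exp (- (\<i> * of_real (freq m * t))) * exp (\<i> * of_real (freq n * t)) = exp (- (\<i> * of_real ((freq m - freq n) * t)))"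
        unfolding exp_add[symmetric] by (rule arg_cong[of _ _ exp]) (simp add: algebra_simps)
      thus "(of_real (a m) * exp (- (\<i> * of_real (freq m * t)))) * (of_real (a n) * exp (\<i> * of_real (freq n * t))) =
            of_real (a m * a n) * exp (- (\<i> * of_real ((freq m - freq n) * t)))"
        by (simp only: of_real_mult) (metis mult.assoc mult.commute)
    qed
    finally show ?thesis .
  qed
  define S where "S = (\<Sum>m\<in>N. \<Sum>n\<in>N. of_real (a m * a n) * J (freq m - freq n))"
  have "((\<lambda>t. complex_of_real (r t)) has_integral S) {A..B}"
    unfolding sq S_def by (intro has_integral_sum N has_integral_mult_right J)
  from has_integral_linear[OF this bounded_linear_Re]
  have "(r has_integral Re S) {A..B}" by (simp add: o_def)
  hence "integral {A..B} r = Re S" by (rule integral_unique)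
  also have "S = (\<Sum>m\<in>N. of_real (a m ^ 2 * (B - A))) + (\<Sum>m\<in>N. \<Sum>n\<in>N - {m}. of_real (a m * a n) * J (freq m - freq n))"
    unfolding S_def sum.distrib[symmetric]
  proof (intro sum.cong refl)
    fix m assume m: "m \<in> N"
    show "(\<Sum>n\<in>N. of_real (a m * a n) * J (freq m - freq n)) =
      of_real (a m ^ 2 * (B - A)) + (\<Sum>n\<in>N - {m}. of_real (a m * a n) * J (freq m - freq n))"
      by (subst sum.remove[OF N m]) (simp add: J_def power2_eq_square)
  qed
  also have "Re ((\<Sum>m\<in>N. of_real (a m ^ 2 * (B - A))) + (\<Sum>m\<in>N. \<Sum>n\<in>N - {m}. of_real (a m * a n) * J (freq m - freq n)))
     = (B - A) * (\<Sum>n\<in>N. a n ^ 2) + Re (\<Sum>m\<in>N. \<Sum>n\<in>N - {m}. of_real (a m * a n) * J (freq m - freq n))"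
    by (simp add: sum_distrib_left mult.commute)
  also have "Re (\<Sum>m\<in>N. \<Sum>n\<in>N - {m}. of_real (a m * a n) * J (freq m - freq n))
     \<le> norm (\<Sum>m\<in>N. \<Sum>n\<in>N - {m}. of_real (a m * a n) * J (freq m - freq n))" by (rule complex_Re_le_cmod)
  also have "\<dots> \<le> (\<Sum>m\<in>N. \<Sum>n\<in>N - {m}. 2 * (\<bar>a m\<bar> * \<bar>a n\<bar> / \<bar>freq m - freq n\<bar>))"
  proof (intro sum_norm_le)
    fix m n assume mn: "m \<in> N" "n \<in> N - {m}"
    hence "freq m - freq n \<noteq> 0" using inj by (auto simp: inj_on_def)
    from Jn[OF this] have "norm (of_real (a m * a n) * J (freq m - freq n)) \<le> \<bar>a m * a n\<bar> * (2 / \<bar>freq m - freq n\<bar>)"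
      unfolding norm_mult[of "of_real (a m * a n)"] norm_of_real by (intro mult_left_mono) auto
    thus "norm (of_real (a m * a n) * J (freq m - freq n)) \<le> 2 * (\<bar>a m\<bar> * \<bar>a n\<bar> / \<bar>freq m - freq n\<bar>)"
      by (simp add: abs_mult mult_ac)
  qed
  finally show ?thesis by (simp add: r_def f_def)
qed

text \<open>For \<open>x < y\<close> one has \<open>ln y - ln x \<ge> (y - x) / y\<close>, and the
  inequality of the means for \<open>sqrt (y / x)\<close> then separates a part depending on a
  single index from the pure difference \<open>1 / (y - x)\<close>. Both sum to harmonic
  numbers.\<close>

lemma off_diagonal_term_le:
  fixes m n :: nat
  assumes "m \<ge> 1" "n \<ge> 1" "m \<noteq> n"
  shows "1 / (sqrt (real m) * sqrt (real n) * \<bar>ln (real m) - ln (real n)\<bar>)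
           \<le> (1 / real m + 1 / real n) / 2 + 1 / \<bar>real m - real n\<bar>"
proof -
  have main: "1 / (sqrt x * sqrt y * (ln y - ln x)) \<le> (1 / x) / 2 + 1 / (y - x)"
    if xy: "0 < x" "x < y" for x y :: real
  proof -
    define d where "d = y - x"
    have d: "d > 0" using xy by (simp add: d_def)
    have "ln (x / y) \<le> x / y - 1" using xy by (intro ln_le_minus_one) auto
    hence "ln y - ln x \<ge> 1 - x / y" using xy by (simp add: ln_div)
    moreover have "1 - x / y = d / y" using xy by (simp add: d_def field_simps)
    ultimately have l: "ln y - ln x \<ge> d / y" by simp
    have s: "sqrt x > 0" "sqrt y > 0" using xy by auto
    have "1 / (sqrt x * sqrt y * (ln y - ln x)) \<le> 1 / (sqrt x * sqrt y * (d / y))"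
      using l s d xy by (intro divide_left_mono mult_left_mono mult_pos_pos) (auto intro: less_le_trans[of 0 "d / y"])
    also have "\<dots> = (sqrt y / sqrt x) / d"
    proof -
      have "1 / (r * v * (d / (v * v))) = (v / r) / d" if "r > 0" "v > 0" for r v :: real
        using that d by (simp add: field_simps)
      from this[OF s] show ?thesis using xy by simp
    qed
    also have "sqrt y / sqrt x \<le> (1 + y / x) / 2"
    proof -
      define q where "q = sqrt y / sqrt x"
      have "2 * q \<le> 1 + q ^ 2" using zero_le_power2[of "1 - q"] by (simp add: power2_diff)
      moreover have "q ^ 2 = y / x" using xy by (simp add: q_def power_divide)
      ultimately show ?thesis unfolding q_def[symmetric] by simp
    qed
    also have "(1 + y / x) / 2 / d = (1 / x) / 2 + 1 / d"
    proof -
      have "y = x + d" by (simp add: d_def)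
      thus ?thesis using xy d by (simp add: field_simps)
    qed
    finally show ?thesis using d by (simp add: d_def divide_right_mono)
  qed
  have half: "x \<le> (a + b) / 2 + c" if "x \<le> a / 2 + c" "0 \<le> b" for x a b c :: real
    using that by (simp add: add_divide_distrib)
  have half': "x \<le> (b + a) / 2 + c" if "x \<le> a / 2 + c" "0 \<le> b" for x a b c :: real
    using half[OF that] by (simp only: add.commute)
  show ?thesis
  proof (cases "m < n")
    case True
    hence "\<bar>real m - real n\<bar> = real n - real m" "\<bar>ln (real m) - ln (real n)\<bar> = ln (real n) - ln (real m)"
      using assms by auto
    moreover have "1 / (sqrt (real m) * sqrt (real n) * (ln (real n) - ln (real m))) \<le> (1 / real m) / 2 + 1 / (real n - real m)"
      by (rule main) (use True assms in auto)
    moreover have "1 / real n \<ge> 0" by simp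
    ultimately show ?thesis by (simp only: half)
  next
    case False
    hence lt: "n < m" using assms by simp
    hence "\<bar>real m - real n\<bar> = real m - real n" "\<bar>ln (real m) - ln (real n)\<bar> = ln (real m) - ln (real n)"
      using assms by auto
    moreover have "1 / (sqrt (real n) * sqrt (real m) * (ln (real m) - ln (real n))) \<le> (1 / real n) / 2 + 1 / (real m - real n)"
      by (rule main) (use lt assms in auto)
    moreover have "sqrt (real m) * sqrt (real n) = sqrt (real n) * sqrt (real m)" by (rule mult.commute)
    moreover have "1 / real m \<ge> 0" by simp
    ultimately show ?thesis by (simp only: half')
  qed
qed

lemma sum_inverse_distance_le:
  assumes "m \<in> {1..M}"
  shows "(\<Sum>n\<in>{1..M} - {m}. 1 / \<bar>real m - real n\<bar>) \<le> 2 * harm M"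
proof -
  have "n \<in> {1..M} - {m} \<longleftrightarrow> n \<in> {1..<m} \<union> {m<..M}" for n using assms by (simp; arith)
  hence "{1..M} - {m} = {1..<m} \<union> {m<..M}" by blast
  moreover have "{1..<m} \<inter> {m<..M} = {}" by (simp add: disjoint_iff)
  ultimately have "(\<Sum>n\<in>{1..M} - {m}. 1 / \<bar>real m - real n\<bar>) = (\<Sum>n\<in>{1..<m}. 1 / \<bar>real m - real n\<bar>) + (\<Sum>n\<in>{m<..M}. 1 / \<bar>real m - real n\<bar>)"
    using sum.union_disjoint[of "{1..<m}" "{m<..M}" "\<lambda>n. 1 / \<bar>real m - real n\<bar>"]
    by (simp only: finite_atLeastLessThan finite_greaterThanAtMost)
  also have "(\<Sum>n\<in>{1..<m}. 1 / \<bar>real m - real n\<bar>) = (\<Sum>k\<in>{1..<m}. inverse (real k))"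
  proof (rule sum.reindex_bij_witness[of _ "\<lambda>k. m - k" "\<lambda>n. m - n"])
    fix n assume "n \<in> {1..<m}"
    hence "real (m - n) = \<bar>real m - real n\<bar>" by (simp add: of_nat_diff)
    thus "inverse (real (m - n)) = 1 / \<bar>real m - real n\<bar>" by (simp only: inverse_eq_divide)
  qed auto
  also have "\<dots> \<le> harm M" unfolding harm_def using assms by (intro sum_mono2) auto
  also have "(\<Sum>n\<in>{m<..M}. 1 / \<bar>real m - real n\<bar>) = (\<Sum>k\<in>{1..M - m}. inverse (real k))"
  proof (rule sum.reindex_bij_witness[of _ "\<lambda>k. m + k" "\<lambda>n. n - m"])
    fix n assume "n \<in> {m<..M}"
    hence "real (n - m) = \<bar>real m - real n\<bar>" by (simp add: of_nat_diff)
    thus "inverse (real (n - m)) = 1 / \<bar>real m - real n\<bar>" by (simp only: inverse_eq_divide)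
  qed auto
  also have "\<dots> \<le> harm M" unfolding harm_def by (intro sum_mono2) auto
  finally show ?thesis by linarith
qed

lemma off_diagonal_sum_le:
  "(\<Sum>m\<in>{1..M}. \<Sum>n\<in>{1..M} - {m}. 1 / (sqrt (real m) * sqrt (real n) * \<bar>ln (real m) - ln (real n)\<bar>)) \<le> 3 * real M * harm M"
proof -
  have "(\<Sum>m\<in>{1..M}. \<Sum>n\<in>{1..M} - {m}. 1 / (sqrt (real m) * sqrt (real n) * \<bar>ln (real m) - ln (real n)\<bar>))
     \<le> (\<Sum>m\<in>{1..M}. (\<Sum>n\<in>{1..M}. (1 / real m + 1 / real n) / 2) + 2 * harm M)"
  proof (intro sum_mono)
    fix m assume m: "m \<in> {1..M}"
    have "(\<Sum>n\<in>{1..M} - {m}. 1 / (sqrt (real m) * sqrt (real n) * \<bar>ln (real m) - ln (real n)\<bar>))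
       \<le> (\<Sum>n\<in>{1..M} - {m}. (1 / real m + 1 / real n) / 2 + 1 / \<bar>real m - real n\<bar>)"
      using m by (intro sum_mono off_diagonal_term_le) auto
    also have "\<dots> = (\<Sum>n\<in>{1..M} - {m}. (1 / real m + 1 / real n) / 2) + (\<Sum>n\<in>{1..M} - {m}. 1 / \<bar>real m - real n\<bar>)"
      by (rule sum.distrib)
    also have "\<dots> \<le> (\<Sum>n\<in>{1..M}. (1 / real m + 1 / real n) / 2) + 2 * harm M"
      using m by (intro add_mono sum_mono2 sum_inverse_distance_le) auto
    finally show "(\<Sum>n\<in>{1..M} - {m}. 1 / (sqrt (real m) * sqrt (real n) * \<bar>ln (real m) - ln (real n)\<bar>))
       \<le> (\<Sum>n\<in>{1..M}. (1 / real m + 1 / real n) / 2) + 2 * harm M" .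
  qed
  also have "\<dots> = 3 * real M * harm M"
  proof -
    have h: "(\<Sum>n\<in>{1..M}. 1 / real n) = harm M" by (simp add: harm_def inverse_eq_divide)
    have "(\<Sum>m\<in>{1..M}. \<Sum>n\<in>{1..M}. (1 / real m + 1 / real n) / 2) = (\<Sum>m\<in>{1..M}. (real M * (1 / real m) + harm M) / 2)"
      by (simp only: sum_divide_distrib[symmetric] sum.distrib h) simp
    also have "\<dots> = (real M * harm M + real M * harm M) / 2"
      by (simp only: sum_divide_distrib[symmetric] sum.distrib sum_distrib_left[symmetric] h) simp
    finally show ?thesis by (simp only: sum.distrib) simp
  qed
  finally show ?thesis .
qed

text \<open>The derivative of the squared modulus is at most twice
  \<open>norm (f t) * norm (f' t)\<close>, hence at most the function \<open>k\<close>, by the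
  weighted inequality of the means. The weight is the interval length, which balances the two
  integrals when \<open>f'\<close> is about \<open>1 / d\<close> times as large as
  \<open>f\<close>.\<close>

lemma sobolev_point_bound:
  fixes f f' :: "real \<Rightarrow> complex"
  assumes d: "d > 0"
    and der: "\<And>t. (f has_vector_derivative f' t) (at t)" and cf': "continuous_on UNIV f'"
  shows "(norm (f x)) ^ 2 \<le> 2 / d * integral {x..x+d} (\<lambda>t. (norm (f t)) ^ 2) + d * integral {x..x+d} (\<lambda>t. (norm (f' t)) ^ 2)"
proof -
  define g where "g = (\<lambda>t. (norm (f t)) ^ 2)"
  define k where "k = (\<lambda>t. (norm (f t)) ^ 2 / d + d * (norm (f' t)) ^ 2)"
  have cf: "continuous_on S f" for S
    using der by (intro continuous_at_imp_continuous_on ballI has_vector_derivative_continuous) auto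
  have cf'': "continuous_on S f'" for S by (rule continuous_on_subset[OF cf']) simp
  have kint: "k integrable_on {u..v}" for u v
    unfolding k_def by (intro integrable_continuous_real continuous_intros cf cf'') (use d in auto)
  have gint: "g integrable_on {u..v}" "(\<lambda>t. (norm (f' t)) ^ 2) integrable_on {u..v}" for u v
    unfolding g_def by (intro integrable_continuous_real continuous_intros cf cf'')+
  have k0: "k t \<ge> 0" for t using d by (simp add: k_def)
  have gd: "(g has_vector_derivative 2 * (f t \<bullet> f' t)) (at t)" for t
  proof -
    have "((\<lambda>t. f t \<bullet> f t) has_derivative (\<lambda>h. f t \<bullet> (h *\<^sub>R f' t) + (h *\<^sub>R f' t) \<bullet> f t)) (at t)"
      using der[of t] unfolding has_vector_derivative_def by (intro has_derivative_inner)
    moreover have "(\<lambda>h. f t \<bullet> (h *\<^sub>R f' t) + (h *\<^sub>R f' t) \<bullet> f t) = (\<lambda>h. h *\<^sub>R (2 * (f t \<bullet> f' t)))"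
      by (auto simp: fun_eq_iff inner_commute)
    moreover have "(\<lambda>t. f t \<bullet> f t) = g" by (simp add: g_def fun_eq_iff power2_norm_eq_inner)
    ultimately show ?thesis by (simp add: has_vector_derivative_def)
  qed
  have gdb: "\<bar>2 * (f t \<bullet> f' t)\<bar> \<le> k t" for t
  proof -
    have "\<bar>f t \<bullet> f' t\<bar> \<le> norm (f t) * norm (f' t)" by (rule Cauchy_Schwarz_ineq2)
    moreover have "2 * (norm (f t) * norm (f' t)) \<le> k t"
    proof -
      define u v where "u = norm (f t)" and "v = norm (f' t)"
      have "d * (u ^ 2 / d + d * v ^ 2 - 2 * (u * v)) = (u - d * v) ^ 2"
        using d by (simp add: power2_eq_square ring_distribs mult_ac)
      hence "0 \<le> d * (u ^ 2 / d + d * v ^ 2 - 2 * (u * v))" by simp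
      hence "0 \<le> u ^ 2 / d + d * v ^ 2 - 2 * (u * v)" using d by (simp only: zero_le_mult_iff) auto
      thus ?thesis by (simp add: k_def u_def v_def)
    qed
    ultimately show ?thesis by simp
  qed
  have pt: "g x \<le> g y + integral {x..x+d} k" if y: "y \<in> {x..x+d}" for y
  proof -
    have hi: "((\<lambda>t. 2 * (f t \<bullet> f' t)) has_integral g y - g x) {x..y}"
    proof (rule fundamental_theorem_of_calculus)
      show "x \<le> y" using y by simp
    qed (rule has_vector_derivative_at_within[OF gd])
    have "norm (integral {x..y} (\<lambda>t. 2 * (f t \<bullet> f' t))) \<le> integral {x..y} k"
      by (rule integral_norm_bound_integral[OF has_integral_integrable[OF hi] kint]) (simp only: real_norm_def gdb)
    hence "norm (g y - g x) \<le> integral {x..y} k" by (simp only: integral_unique[OF hi])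
    also have "\<dots> \<le> integral {x..x+d} k"
      using y k0 by (intro integral_subset_le kint) auto
    finally show ?thesis unfolding real_norm_def by linarith
  qed
  define I1 I2 where "I1 = integral {x..x+d} g" and "I2 = integral {x..x+d} (\<lambda>t. (norm (f' t)) ^ 2)"
  have I: "(g has_integral I1) {x..x+d}" "((\<lambda>t. (norm (f' t)) ^ 2) has_integral I2) {x..x+d}"
    unfolding I1_def I2_def using gint by (simp_all only: integrable_integral)
  have "((\<lambda>t. g t / d + d * (norm (f' t)) ^ 2) has_integral I1 / d + d * I2) {x..x+d}"
    by (intro has_integral_add has_integral_divide has_integral_mult_right I)
  hence K: "integral {x..x+d} k = I1 / d + d * I2" unfolding k_def g_def by (rule integral_unique)
  \<comment> \<open>Integrating the pointwise bound over \<open>y\<close> replaces the unknown value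
    \<open>g y\<close> by its mean over the interval.\<close>
  have "((\<lambda>y. g x) has_integral (d * g x)) {x..x+d}"
    using has_integral_const_real[of "g x" x "x + d"] d by simp
  moreover have "((\<lambda>y. g y + integral {x..x+d} k) has_integral (I1 + d * integral {x..x+d} k)) {x..x+d}"
    using has_integral_add[OF I(1) has_integral_const_real[of "integral {x..x+d} k" x "x + d"]] d by simp
  ultimately have "d * g x \<le> I1 + d * integral {x..x+d} k"
    using pt by (rule has_integral_le)
  also have "\<dots> = d * (2 / d * I1 + d * I2)" unfolding K using d by (simp add: field_simps)
  finally have "g x \<le> 2 / d * I1 + d * I2" using d by (subst (asm) mult_le_cancel_left_pos) auto
  thus ?thesis by (simp only: g_def I1_def I2_def)
qed

lemma sum_separated_integrals_le:
  fixes F :: "real \<Rightarrow> real" and x :: "'a \<Rightarrow> real"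
  assumes X: "finite X" and F: "continuous_on UNIV F" "\<And>t. F t \<ge> 0"
    and range: "\<And>i. i \<in> X \<Longrightarrow> A \<le> x i \<and> x i + d \<le> B"
    and sep: "\<And>i j. i \<in> X \<Longrightarrow> j \<in> X \<Longrightarrow> i \<noteq> j \<Longrightarrow> x i + d \<le> x j \<or> x j + d \<le> x i"
  shows "(\<Sum>i\<in>X. integral {x i..x i + d} F) \<le> integral {A..B} F"
proof -
  have Fi: "F integrable_on {u..v}" for u v
    by (intro integrable_continuous_real continuous_on_subset[OF F(1)]) auto
  have U: "(F has_integral (\<Sum>i\<in>X. integral {x i..x i + d} F)) (\<Union>i\<in>X. {x i..x i + d})"
  proof (rule has_integral_UN[OF X])
    show "(F has_integral integral {x i..x i + d} F) {x i..x i + d}" for i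
      using Fi by (simp add: integrable_integral)
    show "pairwise (\<lambda>i i'. negligible ({x i..x i + d} \<inter> {x i'..x i' + d})) X"
    proof (rule pairwiseI)
      fix i j assume "i \<in> X" "j \<in> X" "i \<noteq> j"
      hence "{x i..x i + d} \<inter> {x j..x j + d} \<subseteq> {x i, x j}" using sep[of i j] by auto
      thus "negligible ({x i..x i + d} \<inter> {x j..x j + d})" by (rule negligible_subset[rotated]) auto
    qed
  qed
  have "(\<Sum>i\<in>X. integral {x i..x i + d} F) = integral (\<Union>i\<in>X. {x i..x i + d}) F"
    using U by (simp add: integral_unique)
  also have "\<dots> \<le> integral {A..B} F"
  proof (rule integral_subset_le)
    show "(\<Union>i\<in>X. {x i..x i + d}) \<subseteq> {A..B}" using range by force
    show "F integrable_on (\<Union>i\<in>X. {x i..x i + d})" using U by blast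
  qed (use Fi F in auto)
  finally show ?thesis .
qed

section \<open>The exceptional set\<close>

lemma mean_value_log_sum:
  fixes b :: "nat \<Rightarrow> real"
  assumes AB: "A \<le> B" and b: "\<And>n. n \<in> {1..M} \<Longrightarrow> \<bar>b n\<bar> \<le> \<beta>"
  shows "integral {A..B} (\<lambda>t. (norm (\<Sum>n=1..M. of_real (b n / sqrt (real n)) * exp (- (\<i> * of_real (ln (real n) * t))))) ^ 2)
     \<le> (B - A) * (\<Sum>n=1..M. b n ^ 2 / real n) + 6 * \<beta> ^ 2 * (real M * harm M)"
proof (cases "M = 0")
  case False
  hence \<beta>: "\<beta> \<ge> 0" using b[of 1] by auto
  have inj: "inj_on (\<lambda>n. ln (real n)) {1..M}" by (auto simp: inj_on_def)
  have "integral {A..B} (\<lambda>t. (norm (\<Sum>n\<in>{1..M}. of_real (b n / sqrt (real n)) * exp (- (\<i> * of_real (ln (real n) * t))))) ^ 2)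
      \<le> (B - A) * (\<Sum>n\<in>{1..M}. (b n / sqrt (real n)) ^ 2)
        + (\<Sum>m\<in>{1..M}. \<Sum>n\<in>{1..M} - {m}. 2 * (\<bar>b m / sqrt (real m)\<bar> * \<bar>b n / sqrt (real n)\<bar> / \<bar>ln (real m) - ln (real n)\<bar>))"
    by (rule mean_value_exponential_sum[OF _ inj AB]) simp
  also have "(\<Sum>n\<in>{1..M}. (b n / sqrt (real n)) ^ 2) = (\<Sum>n\<in>{1..M}. b n ^ 2 / real n)"
    by (intro sum.cong refl) (simp add: power_divide)
  also have "(\<Sum>m\<in>{1..M}. \<Sum>n\<in>{1..M} - {m}. 2 * (\<bar>b m / sqrt (real m)\<bar> * \<bar>b n / sqrt (real n)\<bar> / \<bar>ln (real m) - ln (real n)\<bar>))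
     \<le> (\<Sum>m\<in>{1..M}. \<Sum>n\<in>{1..M} - {m}. 2 * \<beta> ^ 2 * (1 / (sqrt (real m) * sqrt (real n) * \<bar>ln (real m) - ln (real n)\<bar>)))"
  proof (intro sum_mono)
    fix m n assume mn: "m \<in> {1..M}" "n \<in> {1..M} - {m}"
    have e: "\<bar>x / r\<bar> * \<bar>y / s\<bar> / \<bar>d\<bar> = (\<bar>x\<bar> * \<bar>y\<bar>) * (1 / (r * s * \<bar>d\<bar>))" if "r \<ge> 0" "s \<ge> 0" for x y r s d :: real
      using that by (simp add: abs_divide)
    have "\<bar>b m\<bar> * \<bar>b n\<bar> \<le> \<beta> ^ 2"
      unfolding power2_eq_square using b[of m] b[of n] mn \<beta> by (intro mult_mono) auto
    hence "(\<bar>b m\<bar> * \<bar>b n\<bar>) * (1 / (sqrt (real m) * sqrt (real n) * \<bar>ln (real m) - ln (real n)\<bar>))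
        \<le> \<beta> ^ 2 * (1 / (sqrt (real m) * sqrt (real n) * \<bar>ln (real m) - ln (real n)\<bar>))"
      by (intro mult_right_mono) auto
    hence "\<bar>b m / sqrt (real m)\<bar> * \<bar>b n / sqrt (real n)\<bar> / \<bar>ln (real m) - ln (real n)\<bar>
        \<le> \<beta> ^ 2 * (1 / (sqrt (real m) * sqrt (real n) * \<bar>ln (real m) - ln (real n)\<bar>))"
      by (subst e) auto
    thus "2 * (\<bar>b m / sqrt (real m)\<bar> * \<bar>b n / sqrt (real n)\<bar> / \<bar>ln (real m) - ln (real n)\<bar>)
      \<le> 2 * \<beta> ^ 2 * (1 / (sqrt (real m) * sqrt (real n) * \<bar>ln (real m) - ln (real n)\<bar>))"
      by (simp only: mult.assoc)
  qed
  also have "\<dots> = 2 * \<beta> ^ 2 * (\<Sum>m\<in>{1..M}. \<Sum>n\<in>{1..M} - {m}. 1 / (sqrt (real m) * sqrt (real n) * \<bar>ln (real m) - ln (real n)\<bar>))"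
    by (simp only: sum_distrib_left)
  also have "\<dots> \<le> 2 * \<beta> ^ 2 * (3 * real M * harm M)"
    by (intro mult_left_mono off_diagonal_sum_le) auto
  also have "\<dots> = 6 * \<beta> ^ 2 * (real M * harm M)" by simp
  finally show ?thesis by simp
qed simp

lemma defect_coeff_bounds:
  assumes T: "ln (T / (2 * pi)) \<ge> 1" "T > 0" and L: "L \<ge> 1" and n: "n \<in> {1..nat \<lfloor>sqrt (T / (2 * pi))\<rfloor>}"
  shows "ln (real n) \<le> ln (T / (2 * pi)) / 2"
    and "\<bar>defect_coeff T L n\<bar> \<le> 4"
    and "ln (real n) > 0 \<Longrightarrow> \<bar>defect_coeff T L n\<bar> \<le> 4 / (real L * (ln (real n) / (ln (T / (2 * pi)) / 2)))"
proof -
  define q where "q = T / (2 * pi)"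
  define v where "v = pi * ln (real n) / ln q"
  have q: "q > 0" using T by (simp add: q_def)
  have lq: "ln q \<ge> 1" using T by (simp add: q_def)
  have n1: "n \<ge> 1" using n by simp
  have "real n \<le> of_int \<lfloor>sqrt q\<rfloor>"
  proof -
    have "int n \<le> \<lfloor>sqrt q\<rfloor>" using n n1 unfolding q_def[symmetric] by auto
    thus ?thesis by linarith
  qed
  hence "real n \<le> sqrt q" by linarith
  hence "ln (real n) \<le> ln (sqrt q)" using n1 by (intro ln_mono) auto
  also have "\<dots> = ln q / 2" using q by (simp add: ln_sqrt)
  finally have ln_n: "ln (real n) \<le> ln q / 2" .
  thus "ln (real n) \<le> ln (T / (2 * pi)) / 2" by (simp add: q_def)
  have v0: "v \<ge> 0" using n1 lq by (simp add: v_def)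
  have v1: "v \<le> pi / 2"
  proof -
    have "v \<le> pi * (ln q / 2) / ln q" unfolding v_def using ln_n lq by (intro divide_right_mono mult_left_mono) auto
    thus ?thesis using lq by simp
  qed
  show "\<bar>defect_coeff T L n\<bar> \<le> 4"
    using square_wave_coefficient_bounds(1)[OF v0 v1 L] by (simp add: defect_coeff_def v_def q_def)
  show "\<bar>defect_coeff T L n\<bar> \<le> 4 / (real L * (ln (real n) / (ln (T / (2 * pi)) / 2)))" if ln: "ln (real n) > 0"
  proof -
    have vp: "v > 0" using ln lq by (simp add: v_def)
    have "\<bar>defect_coeff T L n\<bar> \<le> 4 / (real L * v)"
      using square_wave_coefficient_bounds(2)[OF v0 v1 L vp] by (simp add: defect_coeff_def v_def q_def)
    also have "\<dots> \<le> 4 / (real L * (ln (real n) / (ln q / 2)))"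
    proof (intro divide_left_mono mult_left_mono mult_pos_pos)
      have "2 * ln (real n) \<le> pi * ln (real n)" using ln pi_gt3 by (intro mult_right_mono) auto
      hence "2 * ln (real n) / ln q \<le> v" unfolding v_def using lq by (intro divide_right_mono) auto
      thus "ln (real n) / (ln q / 2) \<le> v" by (simp add: mult.commute)
    qed (use ln lq L vp in auto)
    finally show ?thesis by (simp add: q_def)
  qed
qed

text \<open>The sum is split at \<open>n = exp (lam * l)\<close>. Below the cut the coefficients are
  merely bounded, but the harmonic mass is only about \<open>lam * l\<close>; above it
  \<open>ln n / l\<close> exceeds \<open>lam\<close>, so the decay of the coefficients gives
  \<open>4 / (L * lam)\<close>.\<close>

lemma defect_coeff_sum_le:
  assumes T: "ln (T / (2 * pi)) \<ge> 1" "T > 0" and L: "L \<ge> 1" and lam: "lam > 0"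
  defines "l \<equiv> ln (T / (2 * pi)) / 2" and "M \<equiv> nat \<lfloor>sqrt (T / (2 * pi))\<rfloor>"
  shows "(\<Sum>n=1..M. defect_coeff T L n ^ 2 / real n) \<le> 16 * (1 + lam * l) + 16 / (real L * lam) ^ 2 * harm M"
proof -
  have l: "l > 0" using T unfolding l_def by linarith
  define N where "N = nat \<lfloor>exp (lam * l)\<rfloor>"
  have "exp (lam * l) \<ge> 1" using lam l by simp
  hence N: "N \<ge> 1" "real N \<le> exp (lam * l)" by (auto simp: N_def le_nat_iff)
  have "(\<Sum>n=1..M. defect_coeff T L n ^ 2 / real n)
     \<le> (\<Sum>n=1..M. 16 * (if n \<le> N then inverse (real n) else 0) + 16 / (real L * lam) ^ 2 * inverse (real n))"
  proof (rule sum_mono)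
    fix n assume n: "n \<in> {1..M}"
    note c = defect_coeff_bounds[OF T L n[unfolded M_def]]
    have n1: "n \<ge> 1" using n by simp
    show "defect_coeff T L n ^ 2 / real n
       \<le> 16 * (if n \<le> N then inverse (real n) else 0) + 16 / (real L * lam) ^ 2 * inverse (real n)"
    proof (cases "n \<le> N")
      case True
      have "defect_coeff T L n ^ 2 \<le> 4 ^ 2" using c(2) by (intro abs_le_square_iff[THEN iffD1]) auto
      hence "defect_coeff T L n ^ 2 * inverse (real n) \<le> 16 * inverse (real n)" by (intro mult_right_mono) auto
      moreover have "0 \<le> 16 / (real L * lam) ^ 2 * inverse (real n)" by simp
      ultimately have "defect_coeff T L n ^ 2 * inverse (real n) \<le> 16 * inverse (real n) + 16 / (real L * lam) ^ 2 * inverse (real n)"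
        by (intro add_increasing2)
      thus ?thesis using True by (simp add: divide_inverse)
    next
      case False
      have "exp (lam * l) < real n"
      proof -
        have "exp (lam * l) < real N + 1" unfolding N_def using lam l by linarith
        thus ?thesis using False by linarith
      qed
      hence "ln (exp (lam * l)) < ln (real n)" using n1 by (subst ln_less_cancel_iff) auto
      hence "lam * l < ln (real n)" by simp
      hence lam_le: "lam \<le> ln (real n) / l" and lnp: "ln (real n) > 0"
        using l lam by (auto simp: pos_le_divide_eq intro: less_trans[of 0 "lam * l"])
      have Lp: "real L > 0" using L by simp
      have "\<bar>defect_coeff T L n\<bar> \<le> 4 / (real L * (ln (real n) / l))" using c(3)[OF lnp] by (simp only: l_def)
      also have "\<dots> \<le> 4 / (real L * lam)"
        using lam_le lam Lp lnp l by (intro divide_left_mono mult_left_mono mult_pos_pos) auto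
      finally have "\<bar>defect_coeff T L n\<bar> \<le> \<bar>4 / (real L * lam)\<bar>" by linarith
      hence "defect_coeff T L n ^ 2 \<le> (4 / (real L * lam)) ^ 2" by (simp only: abs_le_square_iff)
      also have "\<dots> = 16 / (real L * lam) ^ 2" by (simp only: power_divide) simp
      finally have "defect_coeff T L n ^ 2 * inverse (real n) \<le> 16 / (real L * lam) ^ 2 * inverse (real n)"
        by (intro mult_right_mono) auto
      thus ?thesis using False by (simp add: divide_inverse)
    qed
  qed
  also have "\<dots> = 16 * (\<Sum>n=1..M. if n \<le> N then inverse (real n) else 0) + 16 / (real L * lam) ^ 2 * harm M"
    by (simp only: sum.distrib sum_distrib_left[symmetric] harm_def)
  also have "(\<Sum>n=1..M. if n \<le> N then inverse (real n) else 0) \<le> 1 + lam * l"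
  proof -
    have "(\<Sum>n=1..M. if n \<le> N then inverse (real n) else 0) = (\<Sum>n\<in>{n\<in>{1..M}. n \<le> N}. inverse (real n))"
      by (rule sum.inter_filter[symmetric]) simp
    also have "\<dots> \<le> harm N" unfolding harm_def by (intro sum_mono2) auto
    also have "\<dots> \<le> 1 + ln (real N)" by (rule harm_le_ln[OF N(1)])
    also have "ln (real N) \<le> ln (exp (lam * l))" using N by (intro ln_mono) auto
    finally show ?thesis by simp
  qed
  finally show ?thesis by simp
qed

text \<open>The Sobolev inequality is used at length \<open>1 / l\<close>. Differentiation
  multiplies the coefficients by \<open>ln n \<le> l\<close>, so the derivative has mean square at
  most \<open>l ^ 2\<close> times the same bound; the weights \<open>2 * l\<close> and
  \<open>l\<close> then add up to \<open>3 * l\<close>. The 96 is \<open>6 * 4 ^ 2\<close>, for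
  coefficients bounded by 4.\<close>

lemma defect_poly_discrete_mean_square:
  fixes x :: "'a \<Rightarrow> real"
  assumes T: "ln (T / (2 * pi)) \<ge> 1" "T > 0" and L: "L \<ge> 1" and AB: "A \<le> B"
  defines "l \<equiv> ln (T / (2 * pi)) / 2" and "M \<equiv> nat \<lfloor>sqrt (T / (2 * pi))\<rfloor>"
  assumes X: "finite X" and range: "\<And>i. i \<in> X \<Longrightarrow> x i \<in> {A..B}"
    and sep: "\<And>i j. i \<in> X \<Longrightarrow> j \<in> X \<Longrightarrow> i \<noteq> j \<Longrightarrow> x i + 1 / l \<le> x j \<or> x j + 1 / l \<le> x i"
  shows "(\<Sum>i\<in>X. (norm (defect_poly T L (x i))) ^ 2)
     \<le> 3 * l * ((B - A + 1 / l) * (\<Sum>n=1..M. defect_coeff T L n ^ 2 / real n) + 96 * (real M * harm M))"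
proof -
  have l: "l > 0" using T unfolding l_def by linarith
  define \<beta> where "\<beta> = defect_coeff T L"
  define G where "G = (\<Sum>n=1..M. \<beta> n ^ 2 / real n)"
  \<comment> \<open>Room for the interval attached to a point at the right end of the
    window.\<close>
  define B' where "B' = B + 1 / l"
  have AB': "A \<le> B'" "B' - A = B - A + 1 / l" using AB l by (auto simp: B'_def intro: order_trans)
  define f where "f = (\<lambda>t. \<Sum>n=1..M. of_real (\<beta> n / sqrt (real n)) * exp (- (\<i> * of_real (ln (real n) * t))))"
  define f' where "f' = (\<lambda>t. \<Sum>n=1..M. of_real (\<beta> n / sqrt (real n)) * (- (\<i> * of_real (ln (real n))) * exp (- (\<i> * of_real (ln (real n) * t)))))"
  have fd: "defect_poly T L t = f t" for t
    unfolding defect_poly_def f_def M_def[symmetric] \<beta>_def[symmetric]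
  proof (intro sum.cong refl)
    fix n assume n: "n \<in> {1..M}"
    have "Ln (of_nat n) = of_real (ln (real n))" using n Ln_of_real[of "real n"] by simp
    hence "of_nat n powr (- (1/2 + \<i> * t)) = exp (- (1/2) * of_real (ln (real n))) * exp (- (\<i> * of_real (ln (real n) * t)))"
    proof -
      have "of_nat n powr (- (1/2 + \<i> * t)) = exp (- (1/2 + \<i> * t) * of_real (ln (real n)))"
        using n \<open>Ln (of_nat n) = of_real (ln (real n))\<close> by (simp add: powr_def)
      also have "\<dots> = exp (- (1/2) * of_real (ln (real n)) + - (\<i> * of_real (ln (real n) * t)))"
        by (rule arg_cong[of _ _ exp]) (simp add: algebra_simps)
      finally show ?thesis by (simp only: exp_add)
    qed
    also have "exp (- (1/2) * complex_of_real (ln (real n))) = of_real (1 / sqrt (real n))"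
    proof -
      have "exp (- (1/2) * ln (real n)) = 1 / sqrt (real n)"
        using n by (simp add: powr_half_sqrt[symmetric] powr_def exp_minus inverse_eq_divide)
      moreover have "exp (- (1/2) * complex_of_real (ln (real n))) = of_real (exp (- (1/2) * ln (real n)))"
        by (simp only: exp_of_real[symmetric]) simp
      ultimately show ?thesis by simp
    qed
    finally show "of_real (\<beta> n) * of_nat n powr (- (1/2 + \<i> * t)) = of_real (\<beta> n / sqrt (real n)) * exp (- (\<i> * of_real (ln (real n) * t)))"
      by simp
  qed
  have der: "(f has_vector_derivative f' t) (at t)" for t
    unfolding f_def f'_def
  proof (intro has_vector_derivative_sum has_vector_derivative_mult_right)
    fix n
    have "((\<lambda>z. exp (- (\<i> * (of_real (ln (real n)) * z)))) has_field_derivative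
        - (\<i> * of_real (ln (real n))) * exp (- (\<i> * (of_real (ln (real n)) * of_real t)))) (at (of_real t))"
      by (auto intro!: derivative_eq_intros)
    from has_vector_derivative_real_field[OF this]
    show "((\<lambda>t. exp (- (\<i> * of_real (ln (real n) * t)))) has_vector_derivative
        - (\<i> * of_real (ln (real n))) * exp (- (\<i> * of_real (ln (real n) * t)))) (at t)" by simp
  qed
  have cf': "continuous_on UNIV f'" unfolding f'_def by (intro continuous_intros)
  have cf: "continuous_on UNIV f" unfolding f_def by (intro continuous_intros)
  have nf': "norm (f' t) = norm (\<Sum>n=1..M. of_real (\<beta> n * ln (real n) / sqrt (real n)) * exp (- (\<i> * of_real (ln (real n) * t))))" for t
  proof -
    have "f' t = - \<i> * (\<Sum>n=1..M. of_real (\<beta> n * ln (real n) / sqrt (real n)) * exp (- (\<i> * of_real (ln (real n) * t))))"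
      unfolding f'_def sum_distrib_left by (intro sum.cong refl) simp
    thus ?thesis by (simp only: norm_mult norm_minus_cancel norm_ii mult_1)
  qed
  have \<beta>4: "\<bar>\<beta> n\<bar> \<le> 4" and lnl: "0 \<le> ln (real n)" "ln (real n) \<le> l" if "n \<in> {1..M}" for n
    using defect_coeff_bounds(1,2)[OF T L that[unfolded M_def]] that by (auto simp: \<beta>_def l_def)
  have I1: "integral {A..B'} (\<lambda>t. (norm (f t)) ^ 2) \<le> (B' - A) * G + 96 * (real M * harm M)"
    using mean_value_log_sum[OF AB'(1) \<beta>4] by (simp add: f_def G_def)
  have I2: "integral {A..B'} (\<lambda>t. (norm (f' t)) ^ 2) \<le> l ^ 2 * ((B' - A) * G + 96 * (real M * harm M))"
  proof -
    have "\<bar>\<beta> n * ln (real n)\<bar> \<le> 4 * l" if "n \<in> {1..M}" for n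
      unfolding abs_mult using \<beta>4[OF that] lnl[OF that] by (intro mult_mono) auto
    from mean_value_log_sum[OF AB'(1) this]
    have 1: "integral {A..B'} (\<lambda>t. (norm (f' t)) ^ 2) \<le> (B' - A) * (\<Sum>n=1..M. (\<beta> n * ln (real n)) ^ 2 / real n) + 6 * (4 * l) ^ 2 * (real M * harm M)"
      unfolding nf' by simp
    have "(\<Sum>n=1..M. (\<beta> n * ln (real n)) ^ 2 / real n) \<le> (\<Sum>n=1..M. l ^ 2 * (\<beta> n ^ 2 / real n))"
    proof (rule sum_mono)
      fix n assume n: "n \<in> {1..M}"
      have "ln (real n) ^ 2 \<le> l ^ 2" using lnl[OF n] by (intro power_mono) auto
      hence "(\<beta> n ^ 2 / real n) * ln (real n) ^ 2 \<le> (\<beta> n ^ 2 / real n) * l ^ 2" by (intro mult_left_mono) auto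
      thus "(\<beta> n * ln (real n)) ^ 2 / real n \<le> l ^ 2 * (\<beta> n ^ 2 / real n)" by (simp add: power_mult_distrib mult_ac)
    qed
    also have "(\<Sum>n=1..M. l ^ 2 * (\<beta> n ^ 2 / real n)) = l ^ 2 * G" by (simp only: G_def sum_distrib_left)
    finally have "(B' - A) * (\<Sum>n=1..M. (\<beta> n * ln (real n)) ^ 2 / real n) \<le> (B' - A) * (l ^ 2 * G)"
      using AB'(1) by (intro mult_left_mono) auto
    with 1 have "integral {A..B'} (\<lambda>t. (norm (f' t)) ^ 2) \<le> (B' - A) * (l ^ 2 * G) + 6 * (4 * l) ^ 2 * (real M * harm M)"
      by linarith
    thus ?thesis by (simp add: power_mult_distrib algebra_simps)
  qed
  define Q where "Q = (B' - A) * G + 96 * (real M * harm M)"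
  have "(\<Sum>i\<in>X. (norm (f (x i))) ^ 2) \<le>
     (\<Sum>i\<in>X. 2 / (1 / l) * integral {x i..x i + 1 / l} (\<lambda>t. (norm (f t)) ^ 2) + 1 / l * integral {x i..x i + 1 / l} (\<lambda>t. (norm (f' t)) ^ 2))"
    using l by (intro sum_mono sobolev_point_bound der cf') auto
  also have "\<dots> = 2 / (1 / l) * (\<Sum>i\<in>X. integral {x i..x i + 1 / l} (\<lambda>t. (norm (f t)) ^ 2)) + 1 / l * (\<Sum>i\<in>X. integral {x i..x i + 1 / l} (\<lambda>t. (norm (f' t)) ^ 2))"
    by (simp only: sum.distrib sum_distrib_left)
  also have "\<dots> \<le> 2 / (1 / l) * Q + 1 / l * (l ^ 2 * Q)"
  proof (intro add_mono mult_left_mono)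
    have rng: "A \<le> x i \<and> x i + 1 / l \<le> B'" if "i \<in> X" for i using range[OF that] by (simp add: B'_def)
    have "(\<Sum>i\<in>X. integral {x i..x i + 1 / l} (\<lambda>t. (norm (f t)) ^ 2)) \<le> integral {A..B'} (\<lambda>t. (norm (f t)) ^ 2)"
      by (rule sum_separated_integrals_le[OF X _ _ rng sep]) (auto intro!: continuous_intros cf)
    also have "\<dots> \<le> Q" using I1 by (simp add: Q_def)
    finally show "(\<Sum>i\<in>X. integral {x i..x i + 1 / l} (\<lambda>t. (norm (f t)) ^ 2)) \<le> Q" .
    have "(\<Sum>i\<in>X. integral {x i..x i + 1 / l} (\<lambda>t. (norm (f' t)) ^ 2)) \<le> integral {A..B'} (\<lambda>t. (norm (f' t)) ^ 2)"
      by (rule sum_separated_integrals_le[OF X _ _ rng sep]) (auto intro!: continuous_intros cf')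
    also have "\<dots> \<le> l ^ 2 * Q" using I2 by (simp add: Q_def)
    finally show "(\<Sum>i\<in>X. integral {x i..x i + 1 / l} (\<lambda>t. (norm (f' t)) ^ 2)) \<le> l ^ 2 * Q" .
  qed (use l in auto)
  also have "\<dots> = 3 * l * Q" using l by (simp add: power2_eq_square)
  finally show ?thesis unfolding fd Q_def AB'(2) G_def \<beta>_def .
qed

section \<open>Growth of the iterated logarithms and Chebyshev's inequality\<close>

lemma iter_ln_filterlim_at_top: "filterlim (iter_ln k) at_top at_top"
proof (induction k)
  case 0
  show ?case unfolding iter_ln_def by (simp add: filterlim_ident)
next
  case (Suc k)
  have "iter_ln (Suc k) = (\<lambda>T. ln (iter_ln k T))" by (simp add: iter_ln_def fun_eq_iff)
  thus ?case using filterlim_compose[OF ln_at_top Suc.IH] by simp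
qed

text \<open>Since \<open>ln x \<le> x - 1\<close>, each further logarithm only decreases the value;
  every growth condition can then be checked for the third iterate.\<close>

lemma iter_ln_le_ln_ln_ln:
  assumes "k \<ge> 3"
  shows "\<forall>\<^sub>F T in at_top. iter_ln k T \<le> ln (ln (ln T))"
  using assms
proof (induction k rule: dec_induct)
  case base
  show ?case by (simp add: iter_ln_def eval_nat_numeral)
next
  case (step k)
  have "\<forall>\<^sub>F T in at_top. iter_ln k T > 0"
    using iter_ln_filterlim_at_top[of k] by (simp add: filterlim_at_top_dense)
  with step.IH show ?case
  proof eventually_elim
    case (elim T)
    have "iter_ln (Suc k) T = ln (iter_ln k T)" by (simp add: iter_ln_def)
    also have "\<dots> \<le> iter_ln k T" using ln_le_minus_one[OF elim(2)] by linarith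
    finally show ?case using elim by linarith
  qed
qed

lemma Z_star_minus_interp_sum:
  "Z_star T (h_seq T \<nu>) - interp_sum \<psi> \<epsilon> T \<nu> =
     (riemann_Z (h_seq T \<nu>) - of_real (4 / pi) * (\<Sum>p=1..L_num \<psi> \<epsilon> T. (-1) ^ (p + 1) / (2 * of_nat p - 1) *
         ((riemann_Z (h_seq T \<nu> + tau_bar T p) + riemann_Z (h_seq T \<nu> - tau_bar T p)) / 2)))
       / of_real (sqrt (ln (T / (2 * pi))))"
proof -
  have "c * ((a / r + b / r) / 2) = (c * ((a + b) / 2)) / r" for a b c r :: complex
    by (cases "r = 0") (simp_all add: field_simps)
  thus ?thesis
    unfolding interp_sum_def Z_star_def
    by (simp only: sum_divide_distrib[symmetric] diff_divide_distrib times_divide_eq_right)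
qed

text \<open>Chebyshev's inequality. At an exceptional point the squared defect polynomial is at
  least about \<open>l * y powr (- \<epsilon> / 2)\<close>, \<open>y = \<psi> T\<close>, while the
  sum of these squares over all points is
  \<open>O(l ^ 2 * H * y powr (- 2 * \<epsilon> / 3))\<close>. The exponent
  \<open>- \<epsilon> / 6\<close> is the difference of the two.\<close>

lemma exceptional_count_le:
  assumes "k \<ge> 3" and \<psi>: "\<psi> = iter_ln k" and \<epsilon>: "0 < \<epsilon>" "\<epsilon> \<le> 1"
  shows "\<forall>\<^sub>F T in at_top. real (card {\<nu>. \<nu> \<ge> 1 \<and> h_seq T \<nu> \<in> {T..T + H_bar \<psi> T} \<and>
             \<not> norm (Z_star T (h_seq T \<nu>) - interp_sum \<psi> \<epsilon> T \<nu>) \<le> 2 * \<psi> T powr (- \<epsilon> / 4)})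
           \<le> 2688 * \<psi> T powr (- \<epsilon> / 6) * (ln (T / (2 * pi)) / 2 * H_bar \<psi> T)"
proof -
  obtain T1 where cnt: "\<And>T H. T \<ge> T1 \<Longrightarrow> 0 \<le> H \<Longrightarrow> H \<le> sqrt T * ln T \<Longrightarrow>
     finite {\<nu>. \<nu> \<ge> 1 \<and> h_seq T \<nu> \<in> {T..T+H}} \<and>
     \<bar>real (card {\<nu>. \<nu> \<ge> 1 \<and> h_seq T \<nu> \<in> {T..T+H}}) - 1 / (2 * pi) * H * ln (T / (2 * pi))\<bar> \<le> 1 + 3 * ln T * ln T \<and>
     (\<forall>\<nu> \<mu>. \<nu> \<ge> 1 \<and> h_seq T \<nu> \<in> {T..T+H} \<longrightarrow> \<mu> \<ge> 1 \<and> h_seq T \<mu> \<in> {T..T+H} \<longrightarrow> \<nu> < \<mu> \<longrightarrow>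
        h_seq T \<nu> + 2 / ln (T / (2 * pi)) \<le> h_seq T \<mu>)"
    using h_seq_count by blast
  obtain T2 where interp: "\<And>T L h. T \<ge> T2 \<Longrightarrow> 1 \<le> L \<Longrightarrow> real L \<le> ln T \<Longrightarrow> \<bar>h - T\<bar> \<le> sqrt T * ln T \<Longrightarrow>
     norm (riemann_Z h - of_real (4 / pi) * (\<Sum>p=1..L. (-1) ^ (p + 1) / (2 * of_nat p - 1) *
              ((riemann_Z (h + tau_bar T p) + riemann_Z (h - tau_bar T p)) / 2)))
       \<le> 2 * norm (defect_poly T L h) + 300 * real L ^ 2"
    using interpolation_defect by blast
  have "\<forall>\<^sub>F T in at_top. \<psi> T \<ge> 1"
    using iter_ln_filterlim_at_top[of k] by (simp add: filterlim_at_top \<psi>)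
  moreover have "\<forall>\<^sub>F T in at_top. \<psi> T \<le> ln (ln (ln T))"
    using iter_ln_le_ln_ln_ln[OF assms(1)] by (simp add: \<psi>)
  \<comment> \<open>The cube pays for \<open>300 * L ^ 2\<close>, as \<open>L \<le> y\<close>, and
    for the loss \<open>y powr (- \<epsilon> / 4) \<ge> 1 / y\<close>, where
    \<open>y = \<psi> T\<close>.\<close>
  moreover have "\<forall>\<^sub>F T in at_top. ln (ln (ln T)) \<le> ln T \<and> ln (ln (ln T)) \<le> ln (T / (2 * pi)) / 2 \<and>
      300 * ln (ln (ln T)) ^ 3 \<le> sqrt (ln (T / (2 * pi))) \<and> ln (T / (2 * pi)) \<ge> 4 \<and> T \<ge> 100"
    by (intro eventually_conj) real_asymp+
  ultimately show ?thesis
    using eventually_ge_at_top[of T1] eventually_ge_at_top[of T2]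
  proof eventually_elim
    case (elim T)
    define y where "y = \<psi> T"
    define l where "l = ln (T / (2 * pi)) / 2"
    define H where "H = H_bar \<psi> T"
    define L where "L = L_num \<psi> \<epsilon> T"
    define M where "M = nat \<lfloor>sqrt (T / (2 * pi))\<rfloor>"
    have y: "y \<ge> 1" "y \<le> ln T" "y \<le> l" "y \<le> ln (ln (ln T))" using elim by (auto simp: y_def l_def)
    have l2: "l \<ge> 2" using elim by (simp add: l_def)
    have T0: "T \<ge> 100" "T > 0" using elim by auto
    have lT: "1 \<le> ln (T / (2 * pi))" using elim by simp
    have HT: "H = sqrt T * y" by (simp add: H_def H_bar_def y_def)
    have HB: "0 \<le> H" "H \<le> sqrt T * ln T" using y T0 by (auto simp: HT intro!: mult_left_mono)
    have H10: "H \<ge> 10"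
    proof -
      have "10 \<le> sqrt T" by (rule real_le_rsqrt) (use T0 in simp)
      also have "sqrt T * 1 \<le> sqrt T * y" using y T0 by (intro mult_left_mono) auto
      finally show ?thesis by (simp add: HT)
    qed
    have yp: "y powr \<epsilon> \<ge> 1" "y powr \<epsilon> \<le> y"
      using y \<epsilon> powr_mono[of \<epsilon> 1 y] by (auto simp: ge_one_powr_ge_zero)
    have L: "L \<ge> 1" "real L \<le> y powr \<epsilon>" "y powr \<epsilon> / 2 \<le> real L"
    proof -
      have f1: "\<lfloor>y powr \<epsilon>\<rfloor> \<ge> 1" using yp by simp
      hence rL: "real L = of_int \<lfloor>y powr \<epsilon>\<rfloor>" by (simp add: L_def L_num_def y_def)
      have "1 \<le> real L" unfolding rL using f1 by linarith
      thus "L \<ge> 1" by simp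
      show "real L \<le> y powr \<epsilon>" unfolding rL by simp
      show "y powr \<epsilon> / 2 \<le> real L" unfolding rL using f1 by linarith
    qed
    have Ly: "real L \<le> y" using L yp by linarith
    define A where "A = {\<nu>. \<nu> \<ge> 1 \<and> h_seq T \<nu> \<in> {T..T + H}}"
    define Bad where "Bad = {\<nu>. \<nu> \<ge> 1 \<and> h_seq T \<nu> \<in> {T..T + H_bar \<psi> T} \<and>
             \<not> norm (Z_star T (h_seq T \<nu>) - interp_sum \<psi> \<epsilon> T \<nu>) \<le> 2 * \<psi> T powr (- \<epsilon> / 4)}"
    have BA: "Bad \<subseteq> A" by (auto simp: Bad_def A_def H_def)
    note c = cnt[OF elim(4) HB]
    have finA: "finite A" using c by (simp add: A_def)
    have finB: "finite Bad" using BA finA by (rule finite_subset)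
    have one_l: "1 / l = 2 / ln (T / (2 * pi))" by (simp add: l_def)
    have sepA: "h_seq T i + 1 / l \<le> h_seq T j \<or> h_seq T j + 1 / l \<le> h_seq T i" if "i \<in> A" "j \<in> A" "i \<noteq> j" for i j
      using c that unfolding one_l A_def by (cases "i < j") auto
    \<comment> \<open>balances the two terms of \<open>defect_coeff_sum_le\<close>\<close>
    define lam where "lam = real L powr (-2/3)"
    have lam: "lam > 0" using L by (simp add: lam_def)
    \<comment> \<open>This lets the 1 in \<open>1 + lam * l\<close> be absorbed; it holds because
      \<open>L \<le> y \<le> l\<close>.\<close>
    have lam_l: "1 \<le> lam * l"
    proof -
      have "real L powr (2/3) \<le> real L powr 1" using L by (intro powr_mono) auto
      also have "\<dots> \<le> l" using L Ly y by simp
      finally have "real L powr (2/3) * lam \<le> l * lam" using lam by (intro mult_right_mono) auto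
      moreover have "real L powr (2/3) * lam = 1" using L by (simp add: lam_def powr_add[symmetric])
      ultimately show ?thesis by (simp add: mult.commute)
    qed
    have Llam: "16 / (real L * lam) ^ 2 = 16 * lam"
    proof -
      have "(real L * lam) ^ 2 = real L powr (2/3)"
      proof -
        have "real L * lam = real L powr (1/3)" using L powr_add[of "real L" 1 "-2/3"] by (simp add: lam_def)
        thus ?thesis using L by (simp add: power2_eq_square powr_add[symmetric])
      qed
      thus ?thesis using L by (simp add: lam_def powr_minus_divide)
    qed
    have M: "M \<ge> 1" "real M \<le> sqrt T" "harm M \<le> 2 * l"
    proof -
      have "1 \<le> T / (2 * pi)" using T0 pi_less_4 by (simp add: field_simps)
      hence "1 \<le> sqrt (T / (2 * pi))" by simp
      thus M1: "M \<ge> 1" unfolding M_def by (intro le_nat_floor) simp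
      have "real M \<le> sqrt (T / (2 * pi))" unfolding M_def using T0 by simp
      also have "\<dots> \<le> sqrt (T / 1)" using T0 pi_gt3 by (intro real_sqrt_le_mono divide_left_mono) auto
      finally show "real M \<le> sqrt T" by simp
      have "harm M \<le> 1 + ln (real M)" by (rule harm_le_ln[OF M1])
      also have "ln (real M) \<le> l"
        unfolding l_def using M1 by (intro defect_coeff_bounds(1)[OF lT T0(2) L(1)]) (simp add: M_def[symmetric])
      finally show "harm M \<le> 2 * l" using l2 by simp
    qed
    define G where "G = (\<Sum>n=1..M. defect_coeff T L n ^ 2 / real n)"
    have G: "G \<le> 64 * lam * l"
    proof -
      have "G \<le> 16 * (1 + lam * l) + 16 * lam * harm M"
        using defect_coeff_sum_le[OF lT T0(2) L(1) lam] unfolding Llam by (simp add: G_def M_def l_def)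
      also have "\<dots> \<le> 16 * (lam * l + lam * l) + 16 * lam * (2 * l)"
        using lam_l M lam by (intro add_mono mult_left_mono) auto
      finally show ?thesis by (simp add: mult_ac)
    qed
    have lamy: "lam \<le> 2 * y powr (- 2 * \<epsilon> / 3)"
    proof -
      have "lam \<le> (y powr \<epsilon> / 2) powr (-2/3)"
        unfolding lam_def using L yp by (intro powr_mono2') auto
      also have "\<dots> = y powr (- 2 * \<epsilon> / 3) / 2 powr (-2/3)"
        using y by (simp add: powr_divide powr_powr mult.commute)
      also have "\<dots> = 2 powr (2/3) * y powr (- 2 * \<epsilon> / 3)"
        by (simp add: powr_minus_divide)
      also have "\<dots> \<le> 2 powr 1 * y powr (- 2 * \<epsilon> / 3)"
        by (intro mult_right_mono powr_mono) auto
      finally show ?thesis by simp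
    qed
    have MS: "(\<Sum>\<nu>\<in>A. (norm (defect_poly T L (h_seq T \<nu>))) ^ 2) \<le> l ^ 2 * (384 * lam * H + 576 * sqrt T)"
    proof -
      have "(\<Sum>\<nu>\<in>A. (norm (defect_poly T L (h_seq T \<nu>))) ^ 2) \<le> 3 * l * ((T + H - T + 1 / l) * G + 96 * (real M * harm M))"
        unfolding l_def G_def M_def
        by (rule defect_poly_discrete_mean_square[OF lT T0(2) L(1)])
           (use HB finA sepA in \<open>auto simp: A_def l_def\<close>)
      also have "\<dots> \<le> 3 * l * ((2 * H) * (64 * lam * l) + 96 * (sqrt T * (2 * l)))"
      proof (intro mult_left_mono add_mono mult_mono G)
        have "1 / l \<le> 1" using l2 by simp
        thus "T + H - T + 1 / l \<le> 2 * H" using H10 by linarith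
        show "0 \<le> G" by (auto simp: G_def intro!: sum_nonneg)
      qed (use HB M l2 T0 harm_nonneg[of M, where 'a = real] in auto)
      also have "\<dots> = l ^ 2 * (384 * lam * H + 576 * sqrt T)" by (simp add: power2_eq_square algebra_simps)
      finally show ?thesis .
    qed
    \<comment> \<open>\<open>Z_star\<close> is \<open>Z\<close> over \<open>sqrt (2 * l)\<close>.
      Half of the threshold \<open>2 * e\<close> is used up by the \<open>L ^ 2\<close> error; the
      other half forces \<open>2 * D \<ge> e * sqrt (2 * l)\<close>.\<close>
    have bad: "l / 2 * y powr (- \<epsilon> / 2) \<le> (norm (defect_poly T L (h_seq T \<nu>))) ^ 2" if "\<nu> \<in> Bad" for \<nu>
    proof -
      define D where "D = norm (defect_poly T L (h_seq T \<nu>))"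
      define s where "s = sqrt (ln (T / (2 * pi)))"
      define e where "e = y powr (- \<epsilon> / 4)"
      have s: "s > 0" "s ^ 2 = 2 * l" using lT by (auto simp: s_def l_def)
      have e0: "e \<ge> 0" by (simp add: e_def)
      have "h_seq T \<nu> \<in> {T..T + H}" using that by (simp add: Bad_def H_def)
      hence "\<bar>h_seq T \<nu> - T\<bar> \<le> sqrt T * ln T" using HB by auto
      moreover have "real L \<le> ln T" using Ly y by linarith
      ultimately have I: "norm (riemann_Z (h_seq T \<nu>) - of_real (4 / pi) * (\<Sum>p=1..L. (-1) ^ (p + 1) / (2 * of_nat p - 1) *
              ((riemann_Z (h_seq T \<nu> + tau_bar T p) + riemann_Z (h_seq T \<nu> - tau_bar T p)) / 2)))
          \<le> 2 * D + 300 * real L ^ 2"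
        unfolding D_def using interp[OF elim(5) L(1)] by blast
      have "2 * e < norm (Z_star T (h_seq T \<nu>) - interp_sum \<psi> \<epsilon> T \<nu>)"
        using that by (simp add: Bad_def e_def y_def)
      also have "\<dots> \<le> (2 * D + 300 * real L ^ 2) / s"
        unfolding Z_star_minus_interp_sum norm_divide L_def[symmetric] s_def[symmetric] norm_of_real
        using I s by (simp add: divide_right_mono)
      finally have "2 * e * s < 2 * D + 300 * real L ^ 2" using s by (simp add: pos_less_divide_eq)
      moreover have "300 * real L ^ 2 \<le> e * s"
      proof -
        have "300 * real L ^ 2 * y \<le> 300 * y ^ 2 * y"
          using Ly y by (intro mult_right_mono mult_left_mono power_mono) auto
        also have "\<dots> = 300 * y ^ 3" by (simp add: power2_eq_square power3_eq_cube)
        also have "\<dots> \<le> 300 * ln (ln (ln T)) ^ 3" using y by (intro mult_left_mono power_mono) auto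
        also have "\<dots> \<le> s" using elim by (simp add: s_def)
        finally have 1: "300 * real L ^ 2 * y \<le> s" .
        have "y powr (-1) \<le> e" unfolding e_def using y \<epsilon> by (intro powr_mono) auto
        hence "1 \<le> e * y" using y by (simp add: powr_minus_divide field_simps)
        hence "300 * real L ^ 2 * 1 \<le> 300 * real L ^ 2 * (e * y)" by (intro mult_left_mono) auto
        also have "\<dots> = e * (300 * real L ^ 2 * y)" by simp
        also have "\<dots> \<le> e * s" using 1 e0 by (intro mult_left_mono)
        finally show ?thesis by simp
      qed
      ultimately have "e * s \<le> 2 * D" by linarith
      hence "(e * s) ^ 2 \<le> (2 * D) ^ 2" using e0 s by (intro power_mono) auto
      hence "e ^ 2 * (2 * l) \<le> 4 * D ^ 2" by (simp add: power_mult_distrib s)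
      moreover have "e ^ 2 = y powr (- \<epsilon> / 2)" by (simp add: e_def power2_eq_square powr_add[symmetric])
      ultimately have "y powr (- \<epsilon> / 2) * (2 * l) \<le> 4 * D ^ 2" by simp
      thus ?thesis unfolding D_def by (simp add: mult.commute)
    qed
    have "real (card Bad) * (l / 2 * y powr (- \<epsilon> / 2)) \<le> (\<Sum>\<nu>\<in>Bad. (norm (defect_poly T L (h_seq T \<nu>))) ^ 2)"
      using sum_bounded_below[of Bad "l / 2 * y powr (- \<epsilon> / 2)", OF bad] by simp
    also have "\<dots> \<le> (\<Sum>\<nu>\<in>A. (norm (defect_poly T L (h_seq T \<nu>))) ^ 2)"
      by (intro sum_mono2 finA BA) auto
    also have "\<dots> \<le> l ^ 2 * (384 * lam * H + 576 * sqrt T)" by (rule MS)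
    \<comment> \<open>Here the excess of the window over the length of the polynomial is spent:
      \<open>sqrt T = H / y\<close>, and \<open>1 / y \<le> y powr (- 2 * \<epsilon> / 3)\<close>
      because \<open>\<epsilon> \<le> 1\<close>.\<close>
    also have "\<dots> \<le> l ^ 2 * (768 * y powr (- 2 * \<epsilon> / 3) * H + 576 * (y powr (- 2 * \<epsilon> / 3) * H))"
    proof (intro mult_left_mono add_mono)
      show "384 * lam * H \<le> 768 * y powr (- 2 * \<epsilon> / 3) * H"
        using lamy HB by (intro mult_right_mono) auto
      have "y powr (-1) \<le> y powr (- 2 * \<epsilon> / 3)" using y \<epsilon> by (intro powr_mono) auto
      hence "y powr (-1) * H \<le> y powr (- 2 * \<epsilon> / 3) * H" using HB by (intro mult_right_mono) auto
      moreover have "y powr (-1) * H = sqrt T" using y by (simp add: HT powr_minus_divide)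
      ultimately show "sqrt T \<le> y powr (- 2 * \<epsilon> / 3) * H" by simp
    qed auto
    also have "\<dots> = (1344 * y powr (- 2 * \<epsilon> / 3)) * (l ^ 2 * H)" by (simp add: algebra_simps)
    also have "y powr (- 2 * \<epsilon> / 3) = y powr (- \<epsilon> / 6) * y powr (- \<epsilon> / 2)" by (simp add: powr_add[symmetric])
    also have "1344 * (y powr (- \<epsilon> / 6) * y powr (- \<epsilon> / 2)) * (l ^ 2 * H) =
       (2688 * y powr (- \<epsilon> / 6) * (l * H)) * (l / 2 * y powr (- \<epsilon> / 2))" by (simp add: power2_eq_square)
    finally have "real (card Bad) \<le> 2688 * y powr (- \<epsilon> / 6) * (l * H)"
      using l2 y by (subst (asm) mult_le_cancel_right_pos) auto
    thus ?case by (simp add: Bad_def y_def l_def H_def)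
  qed
qed

theorem mainTheorem1:
  fixes k :: nat and \<psi> :: "real \<Rightarrow> real"
  assumes "k \<ge> 3" and "\<psi> = iter_ln k"
  shows "\<exists>\<epsilon>\<^sub>0>0. \<forall>\<epsilon>. 0 < \<epsilon> \<and> \<epsilon> \<le> \<epsilon>\<^sub>0 \<longrightarrow>
    (\<exists>C>0.
      (\<lambda>T. real (card {\<nu>. \<nu> \<ge> 1 \<and> h_seq T \<nu> \<in> {T..T + H_bar \<psi> T} \<and>
              norm (Z_star T (h_seq T \<nu>) - interp_sum \<psi> \<epsilon> T \<nu>) \<le> C * \<psi> T powr (- \<epsilon> / 4)}))
      \<sim>[at_top]
      (\<lambda>T. 1 / (2 * pi) * H_bar \<psi> T * ln (T / (2 * pi))))"
proof (rule exI[of _ "1 :: real"], intro conjI allI impI, simp, rule exI[of _ "2 :: real"], rule conjI, simp)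
  \<comment> \<open>The bound 1 for \<open>\<epsilon>\<close> ensures that a factor
    \<open>1 / \<psi> T\<close> beats all the powers of \<open>\<psi> T\<close> compared with it.
    The constant 2 gives one unit to the defect polynomial and one to the approximation
    errors.\<close>
  fix \<epsilon> :: real assume "0 < \<epsilon> \<and> \<epsilon> \<le> 1"
  hence \<epsilon>: "0 < \<epsilon>" "\<epsilon> \<le> 1" by auto
  define good where "good = (\<lambda>T. real (card {\<nu>. \<nu> \<ge> 1 \<and> h_seq T \<nu> \<in> {T..T + H_bar \<psi> T} \<and>
              norm (Z_star T (h_seq T \<nu>) - interp_sum \<psi> \<epsilon> T \<nu>) \<le> 2 * \<psi> T powr (- \<epsilon> / 4)}))"
  define X where "X = (\<lambda>T. 1 / (2 * pi) * H_bar \<psi> T * ln (T / (2 * pi)))"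
  obtain T1 where cnt: "\<And>T H. T \<ge> T1 \<Longrightarrow> 0 \<le> H \<Longrightarrow> H \<le> sqrt T * ln T \<Longrightarrow>
     finite {\<nu>. \<nu> \<ge> 1 \<and> h_seq T \<nu> \<in> {T..T+H}} \<and>
     \<bar>real (card {\<nu>. \<nu> \<ge> 1 \<and> h_seq T \<nu> \<in> {T..T+H}}) - 1 / (2 * pi) * H * ln (T / (2 * pi))\<bar> \<le> 1 + 3 * ln T * ln T"
    using h_seq_count by blast
  have psi_top: "filterlim \<psi> at_top at_top" using iter_ln_filterlim_at_top[of k] by (simp add: assms)
  have "\<forall>\<^sub>F T in at_top. \<psi> T \<ge> 1" using psi_top by (simp add: filterlim_at_top)
  moreover have "\<forall>\<^sub>F T in at_top. \<psi> T \<le> ln (ln (ln T))"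
    using iter_ln_le_ln_ln_ln[OF assms(1)] by (simp add: assms)
  moreover have "\<forall>\<^sub>F T in at_top. ln (ln (ln T)) \<le> ln T \<and> ln (T / (2 * pi)) \<ge> 4 \<and> T \<ge> 100"
    by (intro eventually_conj) real_asymp+
  ultimately have bound: "\<forall>\<^sub>F T in at_top. norm (good T / X T - 1) \<le> 4 * (1 + 3 * ln T * ln T) / sqrt T + 2688 * pi * \<psi> T powr (- \<epsilon> / 6)"
    using exceptional_count_le[OF assms \<epsilon>] eventually_ge_at_top[of T1]
  proof eventually_elim
    case (elim T)
    define H where "H = H_bar \<psi> T"
    define l where "l = ln (T / (2 * pi)) / 2"
    define A where "A = {\<nu>. \<nu> \<ge> 1 \<and> h_seq T \<nu> \<in> {T..T + H}}"
    define Good where "Good = {\<nu>. \<nu> \<ge> 1 \<and> h_seq T \<nu> \<in> {T..T + H_bar \<psi> T} \<and>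
              norm (Z_star T (h_seq T \<nu>) - interp_sum \<psi> \<epsilon> T \<nu>) \<le> 2 * \<psi> T powr (- \<epsilon> / 4)}"
    define Bad where "Bad = {\<nu>. \<nu> \<ge> 1 \<and> h_seq T \<nu> \<in> {T..T + H_bar \<psi> T} \<and>
              \<not> norm (Z_star T (h_seq T \<nu>) - interp_sum \<psi> \<epsilon> T \<nu>) \<le> 2 * \<psi> T powr (- \<epsilon> / 4)}"
    have l: "l \<ge> 2" using elim by (simp add: l_def)
    have T0: "T \<ge> 100" using elim by auto
    have HB: "0 \<le> H" "H \<le> sqrt T * ln T" "sqrt T \<le> H"
      unfolding H_def H_bar_def using elim mult_left_mono[of 1 "\<psi> T" "sqrt T"] by (auto intro!: mult_left_mono)
    have Hp: "H > 0" using HB T0 by (auto intro: less_le_trans[of 0 "sqrt T"])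
    note c = cnt[OF elim(5) HB(1,2)]
    have XT: "X T = H * l / pi" by (simp add: X_def H_def l_def)
    have Xp: "X T > 0" using Hp l by (simp add: XT)
    \<comment> \<open>The good points are all points minus the exceptional ones. Relative to
      \<open>X T\<close> the counting error is \<open>O((ln T) ^ 2 / sqrt T)\<close> and the
      exceptional share is \<open>O(\<psi> T powr (- \<epsilon> / 6))\<close>; both vanish in the
      limit.\<close>
    have "A = Good \<union> Bad" "Good \<inter> Bad = {}" by (auto simp: A_def Good_def Bad_def H_def)
    moreover have "finite A" using c by (simp add: A_def)
    ultimately have "card A = card Good + card Bad" by (simp add: card_Un_disjoint)
    hence "good T - X T = (real (card A) - X T) - real (card Bad)" by (simp add: good_def Good_def)
    moreover have "\<bar>real (card A) - X T\<bar> \<le> 1 + 3 * ln T * ln T" using c by (simp add: A_def X_def H_def)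
    moreover have "real (card Bad) \<le> 2688 * \<psi> T powr (- \<epsilon> / 6) * (l * H)"
      using elim(4) by (simp add: Bad_def l_def H_def)
    ultimately have d: "\<bar>good T - X T\<bar> \<le> (1 + 3 * ln T * ln T) + 2688 * \<psi> T powr (- \<epsilon> / 6) * (l * H)" by linarith
    have "norm (good T / X T - 1) = \<bar>good T - X T\<bar> / X T"
      using Xp by (simp add: diff_divide_distrib[symmetric] field_simps abs_divide)
    also have "\<dots> \<le> ((1 + 3 * ln T * ln T) + 2688 * \<psi> T powr (- \<epsilon> / 6) * (l * H)) / X T"
      using d Xp by (intro divide_right_mono) auto
    also have "\<dots> = (1 + 3 * ln T * ln T) / X T + 2688 * pi * \<psi> T powr (- \<epsilon> / 6)"
    proof -
      have "2688 * x * (l * H) / (H * l / pi) = 2688 * pi * x" for x using Hp l by (simp add: field_simps)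
      thus ?thesis by (simp only: add_divide_distrib XT)
    qed
    also have "(1 + 3 * ln T * ln T) / X T \<le> (1 + 3 * ln T * ln T) / (sqrt T / 4)"
    proof (intro divide_left_mono)
      have "sqrt T * 1 / 4 \<le> H * l / pi"
        using HB l pi_less_4 T0 by (intro frac_le mult_mono) auto
      thus "sqrt T / 4 \<le> X T" by (simp add: XT)
      show "0 < X T * (sqrt T / 4)" using Xp T0 by simp
      show "0 \<le> 1 + 3 * ln T * ln T" using T0 by simp
    qed
    finally show ?case by (simp add: mult.commute)
  qed
  have lim1: "((\<lambda>T. 4 * (1 + 3 * ln T * ln T) / sqrt T) \<longlongrightarrow> (0::real)) at_top" by real_asymp
  have "((\<lambda>T. \<psi> T powr (- \<epsilon> / 6)) \<longlongrightarrow> 0) at_top"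
    by (rule tendsto_neg_powr[OF _ psi_top]) (use \<epsilon> in simp)
  hence "((\<lambda>T. 4 * (1 + 3 * ln T * ln T) / sqrt T + 2688 * pi * \<psi> T powr (- \<epsilon> / 6)) \<longlongrightarrow> 0 + 2688 * pi * 0) at_top"
    by (intro tendsto_intros lim1)
  hence "((\<lambda>T. good T / X T - 1) \<longlongrightarrow> 0) at_top"
    by (intro Lim_null_comparison[OF bound]) simp
  hence "((\<lambda>T. good T / X T) \<longlongrightarrow> 1) at_top" by (rule LIM_zero_cancel)
  thus "(\<lambda>T. real (card {\<nu>. \<nu> \<ge> 1 \<and> h_seq T \<nu> \<in> {T..T + H_bar \<psi> T} \<and>
              norm (Z_star T (h_seq T \<nu>) - interp_sum \<psi> \<epsilon> T \<nu>) \<le> 2 * \<psi> T powr (- \<epsilon> / 4)}))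
      \<sim>[at_top] (\<lambda>T. 1 / (2 * pi) * H_bar \<psi> T * ln (T / (2 * pi)))"
    unfolding good_def X_def by (rule asymp_equivI')
qed

end
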